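(* Given a Cartesian restriction category $\mathbb{X}$, there is a Cartesian restriction category $\mathbf{Fa\grave{a}}(\mathbb{X})$ which has: (a) objects: pairs $((A,+,0),X)$ (abbreviated $(A,X)$), where $X$ is an object of $\mathbb{X}$ and $(A,+,0)$ is a total commutative monoid in $\mathbb{X}$; (b) maps $(A,X)\to(B,Y)$: sequences $(f_*,f_1,f_2,\ldots)$ where $f_*:X\to Y$ and $f_n:A^n\times X\to B$ are maps of $\mathbb{X}$ such that for each $n\ge1$, $\overline{f_n}=1\times\overline{f_*}=\overline{\pi_nf_*}$, and each $f_n$ is additive and symmetric in its first $n$ variables; (c) identities $(1_X,\pi_0,0,0,\ldots)$ and composition of $f:(A,X)\to(B,Y)$ and $g:(B,Y)\to(C,Z)$ given by $(fg)_*=f_*g_*$ and $$(fg)_n=\sum_{\{B_1,\ldots,B_k\}}\big\langle\langle a_{B_1},x\rangle f_{|B_1|},\ldots,\langle a_{B_k},x\rangle f_{|B_k|},\,xf_*\big\rangle g_k,$$ the sum being over all partitions of $\{1,\ldots,n\}$ into nonempty blocks, where $a_1,\ldots,a_n,x$ denote the projections from $A^n\times X$ and $\langle a_B,x\rangle=\langle a_{i_1},\ldots,a_{i_m},x\rangle$ for $B=\{i_1<\cdots<i_m\}$; (d) restriction given by $$\overline{(f_*,f_1,f_2,\ldots)}:=(\overline{f_*},\ \overline{\pi_1f_*}\,\pi_0,\ \overline{\pi_2f_*}\,0,\ \overline{\pi_3f_*}\,0,\ldots).$$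
   Context: Composition is diagrammatic: $fg$ means first $f$, then $g$. A restriction category is a category with an operation assigning to each $f:X\to Y$ a map $\overline{f}:X\to X$ with: [R.1] $\overline{f}f=f$; [R.2] $\overline{f}\,\overline{g}=\overline{g}\,\overline{f}$ for $f,g$ with the same domain; [R.3] $\overline{\overline{f}g}=\overline{f}\,\overline{g}$ for $f,g$ with the same domain; [R.4] $f\overline{g}=\overline{fg}f$. A map $f$ is total if $\overline{f}=1$. A Cartesian restriction category is a restriction category with chosen restriction products: a chosen object $1$ with, for each $X$, a unique total map $!:X\to1$, such that every $f:X\to1$ equals $\overline{f}\,!$; and for all $X,Y$ a chosen object $X\times Y$ with total projections $\pi_0,\pi_1$ such that for all $f:Z\to X$, $g:Z\to Y$ there is a unique $\langle f,g\rangle:Z\to X\times Y$ with $\langle f,g\rangle\pi_0=\overline{g}f$ and $\langle f,g\rangle\pi_1=\overline{f}g$. A total commutative monoid $(A,+,0)$ is a commutative monoid whose structure maps $+:A\times A\to A$ and $0:1\to A$ are total; for $f,g:X\to A$, $f+g:=\langle f,g\rangle+$ and $0:X\to A$ denotes $!\,0$. In $A^n\times X$, $\pi_0,\ldots,\pi_{n-1}$ are the projections to the copies of $A$ and $\pi_n$ the projection to $X$. A map $f_n:A^n\times X\to B$ with $\overline{f_n}=\overline{\pi_nf_*}$ is additive in its $i$-th variable if substituting a sum $a+b$ in that variable gives the sum of the maps obtained by substituting $a$ and $b$, and substituting $0$ gives the corresponding restriction of zero, $\langle\ldots,0,\ldots,x\rangle f_n=\overline{\langle\ldots,0,\ldots,x\rangle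 f_n}\,0$. *)

theory Defs
  imports "HOL-Algebra.FiniteProduct" "HOL-Library.Disjoint_Sets" "HOL-Combinatorics.Permutations"
begin

section \<open>Restriction categories\<close>

text \<open>
  Categories are given by sets of objects and arrows; the operations are meaningful only on these
  sets and on composable arrows.  Composition is diagrammatic: \<open>f \<Zsemi> g\<close> is first \<open>f\<close>, then \<open>g\<close>.
\<close>

record ('o, 'm) rcat =
  Obj :: "'o set"
  Arr :: "'m set"
  Dom :: "'m \<Rightarrow> 'o"
  Cod :: "'m \<Rightarrow> 'o"
  Id :: "'o \<Rightarrow> 'm"
  Comp :: "'m \<Rightarrow> 'm \<Rightarrow> 'm" (infixl "\<Zsemi>\<index>" 70)
  Rst :: "'m \<Rightarrow> 'm"

definition Hom :: "('o, 'm, 'z) rcat_scheme \<Rightarrow> 'o \<Rightarrow> 'o \<Rightarrow> 'm set" where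
  "Hom C X Y = {f \<in> Arr C. Dom C f = X \<and> Cod C f = Y}"

definition total :: "('o, 'm, 'z) rcat_scheme \<Rightarrow> 'm \<Rightarrow> bool" where
  "total C f \<longleftrightarrow> f \<in> Arr C \<and> Rst C f = Id C (Dom C f)"

locale restriction_category =
  fixes C :: "('o, 'm, 'z) rcat_scheme" (structure)
  assumes Dom_Obj: "f \<in> Arr C \<Longrightarrow> Dom C f \<in> Obj C"
    and Cod_Obj: "f \<in> Arr C \<Longrightarrow> Cod C f \<in> Obj C"
    and Id_Hom: "X \<in> Obj C \<Longrightarrow> Id C X \<in> Hom C X X"
    and Comp_Hom: "\<lbrakk>f \<in> Hom C X Y; g \<in> Hom C Y Z\<rbrakk> \<Longrightarrow> f \<Zsemi> g \<in> Hom C X Z"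
    and Id_left: "f \<in> Hom C X Y \<Longrightarrow> Id C X \<Zsemi> f = f"
    and Id_right: "f \<in> Hom C X Y \<Longrightarrow> f \<Zsemi> Id C Y = f"
    and Comp_assoc: "\<lbrakk>f \<in> Hom C X Y; g \<in> Hom C Y Z; h \<in> Hom C Z W\<rbrakk>
        \<Longrightarrow> (f \<Zsemi> g) \<Zsemi> h = f \<Zsemi> (g \<Zsemi> h)"
    and Rst_Hom: "f \<in> Hom C X Y \<Longrightarrow> Rst C f \<in> Hom C X X"
    and R1: "f \<in> Arr C \<Longrightarrow> Rst C f \<Zsemi> f = f"
    and R2: "\<lbrakk>f \<in> Hom C X Y; g \<in> Hom C X Z\<rbrakk> \<Longrightarrow> Rst C f \<Zsemi> Rst C g = Rst C g \<Zsemi> Rst C f"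
    and R3: "\<lbrakk>f \<in> Hom C X Y; g \<in> Hom C X Z\<rbrakk> \<Longrightarrow> Rst C (Rst C f \<Zsemi> g) = Rst C f \<Zsemi> Rst C g"
    and R4: "\<lbrakk>f \<in> Hom C X Y; g \<in> Hom C Y Z\<rbrakk> \<Longrightarrow> f \<Zsemi> Rst C g = Rst C (f \<Zsemi> g) \<Zsemi> f"


section \<open>Cartesian restriction categories\<close>

text \<open>
  The chosen data are the objects \<open>1\<close> and \<open>X \<times> Y\<close> and the projections; the maps \<open>!\<close> and
  \<open>\<langle>f, g\<rangle>\<close> are determined by them.
\<close>

record ('o, 'm) crcat = "('o, 'm) rcat" +
  One :: 'o
  Prod :: "'o \<Rightarrow> 'o \<Rightarrow> 'o"
  prj0 :: "'o \<Rightarrow> 'o \<Rightarrow> 'm"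
  prj1 :: "'o \<Rightarrow> 'o \<Rightarrow> 'm"

definition bang :: "('o, 'm, 'z) crcat_scheme \<Rightarrow> 'o \<Rightarrow> 'm" where
  "bang C X = (THE t. t \<in> Hom C X (One C) \<and> total C t)"

definition is_pairing :: "('o, 'm, 'z) crcat_scheme \<Rightarrow> 'm \<Rightarrow> 'm \<Rightarrow> 'm \<Rightarrow> bool" where
  "is_pairing C f g h \<longleftrightarrow>
     h \<in> Hom C (Dom C f) (Prod C (Cod C f) (Cod C g)) \<and>
     h \<Zsemi>\<^bsub>C\<^esub> prj0 C (Cod C f) (Cod C g) = Rst C g \<Zsemi>\<^bsub>C\<^esub> f \<and>
     h \<Zsemi>\<^bsub>C\<^esub> prj1 C (Cod C f) (Cod C g) = Rst C f \<Zsemi>\<^bsub>C\<^esub> g"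

definition pair :: "('o, 'm, 'z) crcat_scheme \<Rightarrow> 'm \<Rightarrow> 'm \<Rightarrow> 'm" where
  "pair C f g = (THE h. is_pairing C f g h)"

locale cartesian_restriction_category = restriction_category C
  for C :: "('o, 'm, 'z) crcat_scheme" (structure) +
  assumes One_Obj: "One C \<in> Obj C"
    and bang_ex1: "X \<in> Obj C \<Longrightarrow> \<exists>!t. t \<in> Hom C X (One C) \<and> total C t"
    and to_One: "f \<in> Hom C X (One C) \<Longrightarrow> f = Rst C f \<Zsemi> bang C X"
    and Prod_Obj: "\<lbrakk>X \<in> Obj C; Y \<in> Obj C\<rbrakk> \<Longrightarrow> Prod C X Y \<in> Obj C"
    and prj0: "\<lbrakk>X \<in> Obj C; Y \<in> Obj C\<rbrakk> \<Longrightarrow> prj0 C X Y \<in> Hom C (Prod C X Y) X \<and> total C (prj0 C X Y)"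
    and prj1: "\<lbrakk>X \<in> Obj C; Y \<in> Obj C\<rbrakk> \<Longrightarrow> prj1 C X Y \<in> Hom C (Prod C X Y) Y \<and> total C (prj1 C X Y)"
    and pair_ex1: "\<lbrakk>f \<in> Hom C Z X; g \<in> Hom C Z Y\<rbrakk> \<Longrightarrow> \<exists>!h. is_pairing C f g h"

text \<open>
  \<open>A\<^sup>n \<times> X\<close> as an \<open>(n+1)\<close>-ary product, bracketed as \<open>A \<times> (A \<times> \<dots> (A \<times> X))\<close>, so that
  \<open>A\<^sup>0 \<times> X = X\<close> and \<open>A\<^sup>1 \<times> X = A \<times> X\<close>.  For \<open>i < n\<close>, \<open>proj C A X n i\<close> is the projection
  \<open>\<pi>\<^sub>i\<close> to the \<open>i\<close>-th copy of \<open>A\<close> (counting from 0), and \<open>proj C A X n n\<close> is the projection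
  \<open>\<pi>\<^sub>n\<close> to \<open>X\<close>.  \<open>tuple C [a\<^sub>1, \<dots>, a\<^sub>n] x\<close> is \<open>\<langle>a\<^sub>1, \<dots>, a\<^sub>n, x\<rangle>\<close>.
\<close>

primrec npow :: "('o, 'm, 'z) crcat_scheme \<Rightarrow> 'o \<Rightarrow> 'o \<Rightarrow> nat \<Rightarrow> 'o" where
  "npow C A X 0 = X"
| "npow C A X (Suc n) = Prod C A (npow C A X n)"

fun proj :: "('o, 'm, 'z) crcat_scheme \<Rightarrow> 'o \<Rightarrow> 'o \<Rightarrow> nat \<Rightarrow> nat \<Rightarrow> 'm" where
  "proj C A X 0 i = Id C X"
| "proj C A X (Suc n) 0 = prj0 C A (npow C A X n)"
| "proj C A X (Suc n) (Suc i) = prj1 C A (npow C A X n) \<Zsemi>\<^bsub>C\<^esub> proj C A X n i"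

primrec tuple :: "('o, 'm, 'z) crcat_scheme \<Rightarrow> 'm list \<Rightarrow> 'm \<Rightarrow> 'm" where
  "tuple C [] x = x"
| "tuple C (a # as) x = pair C a (tuple C as x)"


section \<open>Total commutative monoids\<close>

datatype ('o, 'm) cmon = CMon (cobj: 'o) (cadd: 'm) (czero: 'm)

definition add_maps :: "('o, 'm, 'z) crcat_scheme \<Rightarrow> ('o, 'm) cmon \<Rightarrow> 'm \<Rightarrow> 'm \<Rightarrow> 'm" where
  "add_maps C M f g = pair C f g \<Zsemi>\<^bsub>C\<^esub> cadd M"

definition zero_map :: "('o, 'm, 'z) crcat_scheme \<Rightarrow> ('o, 'm) cmon \<Rightarrow> 'o \<Rightarrow> 'm" where
  "zero_map C M X = bang C X \<Zsemi>\<^bsub>C\<^esub> czero M"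

text \<open>
  The monoid equations are the usual diagrams, written with the projections of
  \<open>(A \<times> A) \<times> A\<close> and \<open>A \<times> A\<close>.
\<close>

definition total_comm_monoid :: "('o, 'm, 'z) crcat_scheme \<Rightarrow> ('o, 'm) cmon \<Rightarrow> bool" where
  "total_comm_monoid C M \<longleftrightarrow>
     (let A = cobj M; AA = Prod C A A;
          p = prj0 C A A; q = prj1 C A A;
          a = prj0 C AA A \<Zsemi>\<^bsub>C\<^esub> p; b = prj0 C AA A \<Zsemi>\<^bsub>C\<^esub> q; c = prj1 C AA A
      in A \<in> Obj C \<and>
         cadd M \<in> Hom C AA A \<and> total C (cadd M) \<and>
         czero M \<in> Hom C (One C) A \<and> total C (czero M) \<and>
         add_maps C M (add_maps C M a b) c = add_maps C M a (add_maps C M b c) \<and>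
         add_maps C M (zero_map C M A) (Id C A) = Id C A \<and>
         add_maps C M (Id C A) (zero_map C M A) = Id C A \<and>
         add_maps C M p q = add_maps C M q p)"

text \<open>
  Maps \<open>X \<rightarrow> A\<close> into a total commutative monoid, with pointwise sum; iterated sums
  \<open>\<Sum>\<close> are \<^const>\<open>finprod\<close> in this monoid.
\<close>

definition hom_monoid :: "('o, 'm, 'z) crcat_scheme \<Rightarrow> 'o \<Rightarrow> ('o, 'm) cmon \<Rightarrow> 'm monoid" where
  "hom_monoid C X M =
     \<lparr>carrier = Hom C X (cobj M), monoid.mult = add_maps C M, one = zero_map C M X\<rparr>"


section \<open>The Faa di Bruno construction\<close>

text \<open>
  Additivity and symmetry of \<open>f : A\<^sup>n \<times> X \<rightarrow> B\<close> in its first \<open>n\<close> variables, expressed by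
  substituting arbitrary (possibly partial) maps \<open>a\<^sub>1, \<dots>, a\<^sub>n : Z \<rightarrow> A\<close> and \<open>x : Z \<rightarrow> X\<close>.
\<close>

definition additive ::
  "('o, 'm, 'z) crcat_scheme \<Rightarrow> ('o, 'm) cmon \<Rightarrow> 'o \<Rightarrow> ('o, 'm) cmon \<Rightarrow> nat \<Rightarrow> 'm \<Rightarrow> bool" where
  "additive C M X N n f \<longleftrightarrow>
     (\<forall>i<n. \<forall>Z\<in>Obj C. \<forall>as x. length as = n \<and> set as \<subseteq> Hom C Z (cobj M) \<and> x \<in> Hom C Z X \<longrightarrow>
        (\<forall>a\<in>Hom C Z (cobj M). \<forall>b\<in>Hom C Z (cobj M).
           tuple C (as[i := add_maps C M a b]) x \<Zsemi>\<^bsub>C\<^esub> f =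
           add_maps C N (tuple C (as[i := a]) x \<Zsemi>\<^bsub>C\<^esub> f) (tuple C (as[i := b]) x \<Zsemi>\<^bsub>C\<^esub> f)) \<and>
        tuple C (as[i := zero_map C M Z]) x \<Zsemi>\<^bsub>C\<^esub> f =
        Rst C (tuple C (as[i := zero_map C M Z]) x \<Zsemi>\<^bsub>C\<^esub> f) \<Zsemi>\<^bsub>C\<^esub> zero_map C N Z)"

definition symmetric ::
  "('o, 'm, 'z) crcat_scheme \<Rightarrow> ('o, 'm) cmon \<Rightarrow> 'o \<Rightarrow> nat \<Rightarrow> 'm \<Rightarrow> bool" where
  "symmetric C M X n f \<longleftrightarrow>
     (\<forall>p. p permutes {..<n} \<longrightarrow>
       (\<forall>Z\<in>Obj C. \<forall>as x. length as = n \<and> set as \<subseteq> Hom C Z (cobj M) \<and> x \<in> Hom C Z X \<longrightarrow>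
          tuple C (permute_list p as) x \<Zsemi>\<^bsub>C\<^esub> f = tuple C as x \<Zsemi>\<^bsub>C\<^esub> f))"

type_synonym ('o, 'm) faa_obj = "('o, 'm) cmon \<times> 'o"

text \<open>A sequence \<open>(f\<^sub>*, f\<^sub>1, f\<^sub>2, \<dots>)\<close> is a function on \<^typ>\<open>nat\<close>, with \<open>f\<^sub>*\<close> in position 0.\<close>

type_synonym 'm faa_seq = "nat \<Rightarrow> 'm"

definition faa_Obj :: "('o, 'm, 'z) crcat_scheme \<Rightarrow> ('o, 'm) faa_obj set" where
  "faa_Obj C = {(M, X). total_comm_monoid C M \<and> X \<in> Obj C}"

text \<open>In the condition on restrictions, the first tuple is the map \<open>1 \<times> \<close>(restriction of \<open>f\<^sub>*\<close>).\<close>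

definition faa_Hom ::
  "('o, 'm, 'z) crcat_scheme \<Rightarrow> ('o, 'm) faa_obj \<Rightarrow> ('o, 'm) faa_obj \<Rightarrow> 'm faa_seq set" where
  "faa_Hom C P Q =
     (let M = fst P; A = cobj M; X = snd P; N = fst Q; B = cobj N; Y = snd Q in
      {f. f 0 \<in> Hom C X Y \<and>
          (\<forall>n\<ge>1. f n \<in> Hom C (npow C A X n) B \<and>
             Rst C (f n) =
               tuple C (map (proj C A X n) [0..<n]) (proj C A X n n \<Zsemi>\<^bsub>C\<^esub> Rst C (f 0)) \<and>
             Rst C (f n) = Rst C (proj C A X n n \<Zsemi>\<^bsub>C\<^esub> f 0) \<and>
             additive C M X N n (f n) \<and> symmetric C M X n (f n))})"

definition faa_id :: "('o, 'm, 'z) crcat_scheme \<Rightarrow> ('o, 'm) faa_obj \<Rightarrow> 'm faa_seq" where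
  "faa_id C P =
     (let M = fst P; A = cobj M; X = snd P in
      (\<lambda>n. if n = 0 then Id C X
           else if n = 1 then proj C A X 1 0
           else zero_map C M (npow C A X n)))"

text \<open>
  The summand of a partition: its blocks are listed by increasing minimum (the order is
  immaterial by symmetry of \<open>g\<^sub>k\<close>), and the variables \<open>a\<^sub>1, \<dots>, a\<^sub>n\<close> are \<open>\<pi>\<^sub>0, \<dots>, \<pi>\<^sub>n\<^sub>-\<^sub>1\<close>.
\<close>

definition faa_term ::
  "('o, 'm, 'z) crcat_scheme \<Rightarrow> ('o, 'm) faa_obj \<Rightarrow> 'm faa_seq \<Rightarrow> 'm faa_seq \<Rightarrow>
   nat \<Rightarrow> nat set set \<Rightarrow> 'm" where
  "faa_term C P f g n \<B> =
     (let A = cobj (fst P); X = snd P;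
          a = (\<lambda>i. proj C A X n (i - 1));
          x = proj C A X n n;
          blk = (\<lambda>B. tuple C (map a (sorted_list_of_set B)) x \<Zsemi>\<^bsub>C\<^esub> f (card B))
      in tuple C (map blk (sorted_key_list_of_set Min \<B>)) (x \<Zsemi>\<^bsub>C\<^esub> f 0) \<Zsemi>\<^bsub>C\<^esub> g (card \<B>))"

definition faa_comp ::
  "('o, 'm, 'z) crcat_scheme \<Rightarrow> ('o, 'm) faa_obj \<Rightarrow> ('o, 'm) faa_obj \<Rightarrow>
   'm faa_seq \<Rightarrow> 'm faa_seq \<Rightarrow> 'm faa_seq" where
  "faa_comp C P R f g =
     (\<lambda>n. if n = 0 then f 0 \<Zsemi>\<^bsub>C\<^esub> g 0
          else finprod (hom_monoid C (npow C (cobj (fst P)) (snd P) n) (fst R))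
                 (faa_term C P f g n) {\<B>. partition_on {1..n} \<B>})"

definition faa_rst :: "('o, 'm, 'z) crcat_scheme \<Rightarrow> ('o, 'm) faa_obj \<Rightarrow> 'm faa_seq \<Rightarrow> 'm faa_seq" where
  "faa_rst C P f =
     (let M = fst P; A = cobj M; X = snd P in
      (\<lambda>n. if n = 0 then Rst C (f 0)
          else Rst C (proj C A X n n \<Zsemi>\<^bsub>C\<^esub> f 0) \<Zsemi>\<^bsub>C\<^esub>
                 (if n = 1 then proj C A X 1 0 else zero_map C M (npow C A X n))))"

text \<open>
  A sequence does not determine the monoid structures on its source and target, so an arrow of
  the Faa di Bruno category is a sequence together with its source and target.
\<close>

type_synonym ('o, 'm) faa_arr = "('o, 'm) faa_obj \<times> 'm faa_seq \<times> ('o, 'm) faa_obj"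

end

theory Submission
  imports Defs
begin

text \<open>
  Everything is evaluated at generalised elements.  For a finite index set \<open>I\<close>, a family
  \<open>a\<close> over \<open>I\<close> and a point \<open>x\<close>, let \<open>f\<^sub>I(a, x)\<close> be the value of \<open>f\<^bsub>|I|\<^esub>\<close>; this is
  well defined by symmetry, and \<open>f\<close> is determined by these values.  It suffices to take elements
  of one common restriction: these form honest commutative monoids, in which \<open>f\<^sub>I\<close> is multiadditive,
  zeros included.  Then
  \<open>(fg)\<^sub>I(a, x) = \<Sum>\<^sub>\<pi> g\<^sub>\<pi>(B \<mapsto> f\<^sub>B(a, x), x f\<^sub>*)\<close> over the partitions \<open>\<pi>\<close> of \<open>I\<close>, and associativity
  amounts to expanding \<open>h\<^sub>\<pi>\<close> by multiadditivity and matching partitions of the blocks of a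
  partition with partitions of a partition.  Identities, restrictions, projections and the
  maps to \<open>1\<close> are linear (components beyond the first vanish), so composition with them leaves a single summand,
  and the remaining axioms reduce to componentwise ones in the base category.
\<close>

section \<open>Sums and nested partitions\<close>

text \<open>The obstacle is partiality. In the monoid of all maps from \<open>Z\<close> to
  \<open>A\<close>, substituting zero into \<open>f n\<close> gives zero cut down to a smaller
  domain, not the unit, so sums of arguments cannot be expanded there. The condition on the
  restriction of \<open>f n\<close> removes the obstacle: it makes the restriction of a value f_B(a,
  x) equal to that of \<open>x \<Zsemi> f 0\<close>, whatever the block \<open>B\<close> and the
  arguments \<open>a\<close>. Hence the values of \<open>f\<close> on the blocks of a partition
  again have one common restriction and can serve as arguments of \<open>g\<close>, and all summands
  of (fg)_I(a, x) have the restriction of \<open>x \<Zsemi> f 0 \<Zsemi> g 0\<close>. Arbitrary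
  finite index sets, instead of initial segments, let blocks and later sets of blocks be index sets
  without renumbering. Nothing is lost by testing at such points, since the projections from A^n x X
  are points with the identity as common restriction.\<close>

lemma (in comm_monoid) finprod_Sigma:
  assumes "finite I" "\<And>i. i \<in> I \<Longrightarrow> finite (A i)"
    and g: "\<And>i j. i \<in> I \<Longrightarrow> j \<in> A i \<Longrightarrow> g i j \<in> carrier G"
  shows "finprod G (\<lambda>i. finprod G (g i) (A i)) I = finprod G (\<lambda>(i, j). g i j) (SIGMA i:I. A i)"
proof -
  have S: "(SIGMA i:I. A i) = \<Union> ((\<lambda>i. Pair i ` A i) ` I)"
    by auto
  have "finprod G (\<lambda>(i, j). g i j) (\<Union> ((\<lambda>i. Pair i ` A i) ` I)) =
      finprod G (\<lambda>i. finprod G (\<lambda>(i, j). g i j) (Pair i ` A i)) I"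
    by (rule finprod_UN_disjoint) (use assms in \<open>auto simp: pairwise_def disjnt_def\<close>)
  also have "\<dots> = finprod G (\<lambda>i. finprod G (g i) (A i)) I"
  proof (rule finprod_cong')
    fix i assume i: "i \<in> I"
    have "finprod G (\<lambda>(i, j). g i j) (Pair i ` A i) = finprod G (\<lambda>j. case (i, j) of (i, j) \<Rightarrow> g i j) (A i)"
      by (rule finprod_reindex) (use g i in \<open>auto simp: inj_on_def\<close>)
    then show "finprod G (\<lambda>(i, j). g i j) (Pair i ` A i) = finprod G (g i) (A i)"
      by simp
  qed (use g in \<open>auto intro!: finprod_closed\<close>)
  finally show ?thesis by (simp add: S)
qed

text \<open>Distributivity with choice functions: each \<open>\<rho>\<close> in
  \<open>PiE I T\<close> picks one summand for every slot. \<open>\<phi>\<close> is kept abstract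
  and will be the evaluation of a map at a family of arguments; \<open>cong\<close> says that it
  sees only the slots in \<open>I\<close>. An empty \<open>T i\<close> makes both sides the unit,
  which is what \<open>zero\<close> is for.\<close>

lemma finprod_multiadditive:
  fixes \<phi> :: "('i \<Rightarrow> 'a) \<Rightarrow> 'b"
  assumes G: "comm_monoid G" and H: "comm_monoid H"
    and I: "finite I" "\<And>i. i \<in> I \<Longrightarrow> finite (T i)"
    and t: "\<And>i j. i \<in> I \<Longrightarrow> j \<in> T i \<Longrightarrow> t i j \<in> carrier G"
    and closed: "\<And>a. a \<in> I \<rightarrow> carrier G \<Longrightarrow> \<phi> a \<in> carrier H"
    and cong: "\<And>a b. (\<And>i. i \<in> I \<Longrightarrow> a i = b i) \<Longrightarrow> \<phi> a = \<phi> b"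
    and add: "\<And>a i u v. \<lbrakk>a \<in> I \<rightarrow> carrier G; i \<in> I; u \<in> carrier G; v \<in> carrier G\<rbrakk> \<Longrightarrow>
        \<phi> (a(i := u \<otimes>\<^bsub>G\<^esub> v)) = \<phi> (a(i := u)) \<otimes>\<^bsub>H\<^esub> \<phi> (a(i := v))"
    and zero: "\<And>a i. \<lbrakk>a \<in> I \<rightarrow> carrier G; i \<in> I\<rbrakk> \<Longrightarrow> \<phi> (a(i := \<one>\<^bsub>G\<^esub>)) = \<one>\<^bsub>H\<^esub>"
  shows "\<phi> (\<lambda>i. finprod G (t i) (T i)) = finprod H (\<lambda>\<rho>. \<phi> (\<lambda>i. t i (\<rho> i))) (PiE I T)"
proof -
  interpret G: comm_monoid G by (rule G)
  interpret H: comm_monoid H by (rule H)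
  have tclosed: "finprod G (t i) (T i) \<in> carrier G" if "i \<in> I" for i
    by (rule G.finprod_closed) (use t that in auto)
  have slot: "\<phi> (a(k := finprod G s U)) = finprod H (\<lambda>j. \<phi> (a(k := s j))) U"
    if "a \<in> I \<rightarrow> carrier G" "k \<in> I" "finite U" "s \<in> U \<rightarrow> carrier G" for a k s and U :: "'j set"
    using that(3,4)
  proof induction
    case empty
    then show ?case using zero[OF that(1,2)] by (simp only: G.finprod_empty H.finprod_empty)
  next
    case (insert j U)
    have cl: "\<phi> (a(k := s l)) \<in> carrier H" if "l \<in> insert j U" for l
      by (rule closed) (use \<open>a \<in> I \<rightarrow> carrier G\<close> insert.prems that in auto)
    have "\<phi> (a(k := finprod G s (insert j U))) = \<phi> (a(k := s j \<otimes>\<^bsub>G\<^esub> finprod G s U))"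
      using insert by (subst G.finprod_insert) auto
    also have "\<dots> = \<phi> (a(k := s j)) \<otimes>\<^bsub>H\<^esub> \<phi> (a(k := finprod G s U))"
      by (rule add) (use that insert in \<open>auto intro!: G.finprod_closed\<close>)
    also have "\<dots> = finprod H (\<lambda>j. \<phi> (a(k := s j))) (insert j U)"
      using insert cl by (subst H.finprod_insert) (auto simp: fun_upd_def)
    finally show ?case .
  qed
  \<comment> \<open>\<open>J\<close> is the set of slots already expanded, while \<open>c\<close>
    fills the others. It is arbitrary in the induction because the new slot \<open>k\<close> keeps
    its whole sum inside \<open>c\<close> while the induction hypothesis expands
    \<open>J\<close>.\<close>
  have main: "\<phi> (\<lambda>i. if i \<in> J then finprod G (t i) (T i) else c i) =
      finprod H (\<lambda>\<rho>. \<phi> (\<lambda>i. if i \<in> J then t i (\<rho> i) else c i)) (PiE J T)"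
    if "finite J" "J \<subseteq> I" "c \<in> I \<rightarrow> carrier G" for J c
    using that
  proof (induction arbitrary: c)
    case empty
    then show ?case using closed by auto
  next
    case (insert k J)
    let ?S = "\<lambda>i. finprod G (t i) (T i)"
    let ?a = "\<lambda>\<rho> i. if i \<in> J then t i (\<rho> i) else c i"
    have k: "k \<in> I" "J \<subseteq> I" and c': "c(k := ?S k) \<in> I \<rightarrow> carrier G"
      using insert tclosed by auto
    have a: "?a \<rho> \<in> I \<rightarrow> carrier G" if "\<rho> \<in> PiE J T" for \<rho>
      using that t insert.prems k by (auto simp: PiE_iff)
    have cl: "\<phi> ((?a \<rho>)(k := t k j)) \<in> carrier H" if "\<rho> \<in> PiE J T" "j \<in> T k" for \<rho> j
      by (rule closed) (use funcset_mem[OF a[OF that(1)]] t[OF k(1) that(2)] in simp)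
    have fin: "finite (PiE J T)"
      using insert I k by (intro finite_PiE) auto
    have "\<phi> (\<lambda>i. if i \<in> insert k J then ?S i else c i) =
        \<phi> (\<lambda>i. if i \<in> J then ?S i else (c(k := ?S k)) i)"
      by (rule cong) auto
    also have "\<dots> = finprod H (\<lambda>\<rho>. \<phi> (\<lambda>i. if i \<in> J then t i (\<rho> i) else (c(k := ?S k)) i)) (PiE J T)"
      using insert k c' by blast
    also have "\<dots> = finprod H (\<lambda>\<rho>. finprod H (\<lambda>j. \<phi> ((?a \<rho>)(k := t k j))) (T k)) (PiE J T)"
    proof (rule H.finprod_cong')
      fix \<rho> assume \<rho>: "\<rho> \<in> PiE J T"
      have "\<phi> (\<lambda>i. if i \<in> J then t i (\<rho> i) else (c(k := ?S k)) i) = \<phi> ((?a \<rho>)(k := ?S k))"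
        by (rule cong) (use insert in auto)
      also have "\<dots> = finprod H (\<lambda>j. \<phi> ((?a \<rho>)(k := t k j))) (T k)"
        by (rule slot) (use a \<rho> k I t in auto)
      finally show "\<phi> (\<lambda>i. if i \<in> J then t i (\<rho> i) else (c(k := ?S k)) i) = \<dots>" .
    qed (use cl in \<open>auto intro!: H.finprod_closed\<close>)
    also have "\<dots> = finprod H (\<lambda>(\<rho>, j). \<phi> ((?a \<rho>)(k := t k j))) (PiE J T \<times> T k)"
      by (rule H.finprod_Sigma) (use k I fin cl in auto)
    also have "\<dots> = finprod H (\<lambda>p. \<phi> (\<lambda>i. if i \<in> insert k J
        then t i (((fst p)(k := snd p)) i) else c i)) (PiE J T \<times> T k)"
    proof (rule H.finprod_cong')
      show "(\<lambda>p. \<phi> (\<lambda>i. if i \<in> insert k J then t i (((fst p)(k := snd p)) i) else c i))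
          \<in> PiE J T \<times> T k \<rightarrow> carrier H"
        using insert.prems k t by (auto intro!: closed simp: PiE_iff)
    qed (auto intro!: cong simp: insert)
    also have "\<dots> = finprod H (\<lambda>\<rho>. \<phi> (\<lambda>i. if i \<in> insert k J then t i (\<rho> i) else c i))
        ((\<lambda>p. (fst p)(k := snd p)) ` (PiE J T \<times> T k))"
    proof (rule H.finprod_reindex[symmetric])
      show "(\<lambda>\<rho>. \<phi> (\<lambda>i. if i \<in> insert k J then t i (\<rho> i) else c i))
          \<in> (\<lambda>p. (fst p)(k := snd p)) ` (PiE J T \<times> T k) \<rightarrow> carrier H"
        using insert.prems k t by (auto intro!: closed simp: PiE_iff)
      \<comment> \<open>\<open>k\<close> lies outside \<open>J\<close>, where all members of
        \<open>PiE J T\<close> take the same default value, so overwriting at \<open>k\<close>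
        forgets nothing.\<close>
      show "inj_on (\<lambda>p. (fst p)(k := snd p)) (PiE J T \<times> T k)"
      proof (rule inj_onI)
        fix p q assume pq: "p \<in> PiE J T \<times> T k" "q \<in> PiE J T \<times> T k"
          and eq: "(fst p)(k := snd p) = (fst q)(k := snd q)"
        have "fst p i = fst q i" for i
        proof (cases "i = k")
          case True
          then show ?thesis using pq insert.hyps by (auto simp: PiE_iff extensional_def)
        next
          case False
          then show ?thesis using fun_cong[OF eq, of i] by simp
        qed
        then show "p = q"
          using fun_cong[OF eq, of k] by (auto simp: prod_eq_iff)
      qed
    qed
    also have "(\<lambda>p. (fst p)(k := snd p)) ` (PiE J T \<times> T k) = PiE (insert k J) T"
      by (subst PiE_insert_eq) (force simp: image_def)
    finally show ?case .
  qed
  \<comment> \<open>Any filler in the carrier would do, as no slot is left outside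
    \<open>I\<close>.\<close>
  define c where "c = (\<lambda>i::'i. \<one>\<^bsub>G\<^esub>)"
  have "\<phi> (\<lambda>i. finprod G (t i) (T i)) = \<phi> (\<lambda>i. if i \<in> I then finprod G (t i) (T i) else c i)"
    by (rule cong) auto
  also have "\<dots> = finprod H (\<lambda>\<rho>. \<phi> (\<lambda>i. if i \<in> I then t i (\<rho> i) else c i)) (PiE I T)"
    by (rule main) (auto simp: I c_def)
  also have "\<dots> = finprod H (\<lambda>\<rho>. \<phi> (\<lambda>i. t i (\<rho> i))) (PiE I T)"
    by (rule H.finprod_cong') (use t in \<open>auto intro!: closed cong simp: PiE_iff\<close>)
  finally show ?thesis .
qed

section \<open>Partitions, refinements and partitions of partitions\<close>

lemma partition_on_block:
  assumes "partition_on A P" "B \<in> P"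
  shows "B \<noteq> {}" "B \<subseteq> A"
  using assms by (auto simp: partition_on_def)

lemma partition_on_block_eqI:
  assumes "partition_on A P" "B \<in> P" "B' \<in> P" "x \<in> B" "x \<in> B'"
  shows "B = B'"
  using assms by (auto simp: partition_on_def disjoint_def)

lemma partition_on_pointwiseI:
  assumes "\<Union>P = A" "\<And>B. B \<in> P \<Longrightarrow> B \<noteq> {}"
    and "\<And>B B' z. \<lbrakk>B \<in> P; B' \<in> P; z \<in> B; z \<in> B'\<rbrakk> \<Longrightarrow> B = B'"
  shows "partition_on A P"
  using assms by (auto simp: partition_on_def disjoint_def)

lemma partition_on_image:
  assumes "partition_on A P" "inj_on f A"
  shows "partition_on (f ` A) ((`) f ` P)"
proof -
  have "(`) f ` P - {{}} = (`) f ` P" using partition_onD3[OF assms(1)] by auto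
  then show ?thesis using partition_on_inj_image[OF assms] by simp
qed

text \<open>A nonempty piece of \<open>\<rho> B\<close> lies inside one block of
  \<open>\<pi>\<close> only. So distinct blocks have disjoint sets of pieces, and the pieces of
  \<open>B\<close> are recovered from the common refinement as those contained in
  \<open>B\<close>.\<close>

lemma partition_on_flatten:
  assumes \<pi>: "partition_on S \<pi>" and \<rho>: "\<And>B. B \<in> \<pi> \<Longrightarrow> partition_on B (\<rho> B)"
  shows "partition_on S (\<Union>B\<in>\<pi>. \<rho> B)" (is ?A)
    and "partition_on (\<Union>B\<in>\<pi>. \<rho> B) (\<rho> ` \<pi>)" (is ?B)
    and "inj_on \<rho> \<pi>" (is ?C)
    and "B \<in> \<pi> \<Longrightarrow> {E \<in> \<Union>B\<in>\<pi>. \<rho> B. E \<subseteq> B} = \<rho> B"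
proof -
  have U: "\<Union> (\<rho> B) = B" if "B \<in> \<pi>" for B
    using \<rho>[OF that] by (auto simp: partition_on_def)
  have N: "E \<noteq> {}" "E \<subseteq> B" if "E \<in> \<rho> B" "B \<in> \<pi>" for E B
    using partition_on_block[OF \<rho>[OF that(2)] that(1)] by auto
  have B: "B = B'" if "E \<in> \<rho> B" "B \<in> \<pi>" "E \<subseteq> B'" "B' \<in> \<pi>" for E B B'
  proof -
    from N(1)[OF that(1,2)] obtain z where "z \<in> E" by blast
    then show ?thesis
      using partition_on_block_eqI[OF \<pi> that(2,4), of z] N[OF that(1,2)] that(3) by auto
  qed
  show ?A
  proof (rule partition_on_pointwiseI)
    have "\<Union> (\<Union>B\<in>\<pi>. \<rho> B) = (\<Union>B\<in>\<pi>. \<Union> (\<rho> B))" by blast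
    also have "\<dots> = S" using U \<pi> by (auto simp: partition_on_def)
    finally show "\<Union> (\<Union>B\<in>\<pi>. \<rho> B) = S" .
    show "E \<noteq> {}" if "E \<in> (\<Union>B\<in>\<pi>. \<rho> B)" for E
      using that N by auto
    show "E = E'" if "E \<in> (\<Union>B\<in>\<pi>. \<rho> B)" "E' \<in> (\<Union>B\<in>\<pi>. \<rho> B)" "z \<in> E" "z \<in> E'" for E E' z
    proof -
      from that obtain B B' where *: "B \<in> \<pi>" "E \<in> \<rho> B" "B' \<in> \<pi>" "E' \<in> \<rho> B'" by blast
      have "B = B'"
        using partition_on_block_eqI[OF \<pi> *(1,3), of z] N(2)[OF *(2,1)] N(2)[OF *(4,3)] that by blast
      then show ?thesis
        using partition_on_block_eqI[OF \<rho>[OF *(1)] *(2), of E' z] * that by auto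
    qed
  qed
  show ?C
    by (rule inj_onI) (metis U)
  show ?B
  proof (rule partition_on_pointwiseI)
    show "T \<noteq> {}" if "T \<in> \<rho> ` \<pi>" for T
      using that U partition_on_block[OF \<pi>] by fastforce
    show "T = T'" if "T \<in> \<rho> ` \<pi>" "T' \<in> \<rho> ` \<pi>" "E \<in> T" "E \<in> T'" for T T' E
    proof -
      from that obtain B1 B2 where *: "B1 \<in> \<pi>" "T = \<rho> B1" "B2 \<in> \<pi>" "T' = \<rho> B2" by blast
      then have "B1 = B2" using B[of E B1 B2] N(2)[of E B2] that by simp
      with * show ?thesis by simp
    qed
  qed simp
  show "{E \<in> \<Union>B\<in>\<pi>. \<rho> B. E \<subseteq> B} = \<rho> B" if "B \<in> \<pi>"
    using B N that by blast
qed

text \<open>The converse construction: the members of \<open>\<tau>\<close> are sets of blocks of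
  \<open>\<sigma>\<close>, and their unions are coarser blocks. Since the blocks of
  \<open>\<sigma>\<close> are disjoint, one that meets \<open>\<Union>T\<close> already belongs to
  \<open>T\<close>, so merging loses no information.\<close>

lemma partition_on_merge:
  assumes \<sigma>: "partition_on S \<sigma>" and \<tau>: "partition_on \<sigma> \<tau>"
  shows "partition_on S (Union ` \<tau>)" (is ?A)
    and "T \<in> \<tau> \<Longrightarrow> {E \<in> \<sigma>. E \<subseteq> \<Union>T} = T"
    and "T \<in> \<tau> \<Longrightarrow> partition_on (\<Union>T) T"
proof -
  have sub: "T \<subseteq> \<sigma>" "T \<noteq> {}" if "T \<in> \<tau>" for T
    using partition_on_block[OF \<tau> that] by auto
  have mem: "E \<in> T" if "T \<in> \<tau>" "E \<in> \<sigma>" "z \<in> E" "z \<in> \<Union>T" for T E z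
    using partition_on_block_eqI[OF \<sigma> that(2)] that sub[OF that(1)] by blast
  show ?A
  proof (rule partition_on_pointwiseI)
    show "\<Union> (Union ` \<tau>) = S"
      using \<sigma> \<tau> by (auto simp: partition_on_def)
    show "B \<noteq> {}" if B: "B \<in> Union ` \<tau>" for B
    proof -
      from B obtain T where T: "T \<in> \<tau>" "B = \<Union>T" by auto
      from sub(2)[OF T(1)] obtain E where "E \<in> T" by blast
      then show ?thesis using sub T partition_on_block[OF \<sigma>, of E] by auto
    qed
    show "B = B'" if B: "B \<in> Union ` \<tau>" "B' \<in> Union ` \<tau>" "z \<in> B" "z \<in> B'" for B B' z
    proof -
      from B obtain T T' where T: "T \<in> \<tau>" "B = \<Union>T" "T' \<in> \<tau>" "B' = \<Union>T'" by auto
      with B obtain E where z: "E \<in> T" "z \<in> E" by auto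
      then have "E \<in> T'" using mem[of T' E z] T B sub by auto
      then show ?thesis using partition_on_block_eqI[OF \<tau> T(1,3)] z T by auto
    qed
  qed
  show "{E \<in> \<sigma>. E \<subseteq> \<Union>T} = T" if "T \<in> \<tau>"
  proof -
    have "E \<in> T" if "E \<in> \<sigma>" "E \<subseteq> \<Union>T" for E
      using mem[OF \<open>T \<in> \<tau>\<close> that(1)] partition_on_block[OF \<sigma> that(1)] that(2) by blast
    then show ?thesis using sub[OF that] by auto
  qed
  show "partition_on (\<Union>T) T" if "T \<in> \<tau>"
    using sub[OF that] \<sigma> by (auto simp: partition_on_def disjoint_def)
qed

text \<open>A pair of partitions of \<open>S\<close>, one refining the other, is described on one
  side from the coarse partition by refinements of its blocks, on the other from the fine partition
  by a grouping of its blocks. These are the index sets of the double sums for (fg)h and f(gh). The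
  function in the inverse is restricted to the merged blocks because \<open>PiE\<close> contains
  extensional functions only.\<close>

lemma bij_betw_nested_partitions:
  "bij_betw (\<lambda>(\<pi>, \<rho>). (\<Union>B\<in>\<pi>. \<rho> B, \<rho> ` \<pi>))
     (SIGMA \<pi>:{\<pi>. partition_on S \<pi>}. PiE \<pi> (\<lambda>B. {\<rho>. partition_on B \<rho>}))
     (SIGMA \<sigma>:{\<sigma>. partition_on S \<sigma>}. {\<tau>. partition_on \<sigma> \<tau>})"
proof (rule bij_betw_byWitness[where
      f' = "\<lambda>(\<sigma>, \<tau>). (Union ` \<tau>, \<lambda>B\<in>Union ` \<tau>. {E \<in> \<sigma>. E \<subseteq> B})"])
  show "\<forall>p\<in>(SIGMA \<pi>:{\<pi>. partition_on S \<pi>}. PiE \<pi> (\<lambda>B. {\<rho>. partition_on B \<rho>})).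
      (case (case p of (\<pi>, \<rho>) \<Rightarrow> (\<Union>B\<in>\<pi>. \<rho> B, \<rho> ` \<pi>)) of
        (\<sigma>, \<tau>) \<Rightarrow> (Union ` \<tau>, \<lambda>B\<in>Union ` \<tau>. {E \<in> \<sigma>. E \<subseteq> B})) = p"
  proof (clarsimp, intro conjI)
    fix \<pi> \<rho> assume \<pi>: "partition_on S \<pi>" and \<rho>: "\<rho> \<in> PiE \<pi> (\<lambda>B. {\<rho>. partition_on B \<rho>})"
    then have \<rho>': "partition_on B (\<rho> B)" if "B \<in> \<pi>" for B using that by auto
    have "\<Union> (\<rho> B) = B" if "B \<in> \<pi>" for B
      using \<rho>'[OF that] by (auto simp: partition_on_def)
    then show eq: "Union ` \<rho> ` \<pi> = \<pi>" by (simp add: image_image)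
    show "(\<lambda>B\<in>Union ` \<rho> ` \<pi>. {E. (\<exists>x\<in>\<pi>. E \<in> \<rho> x) \<and> E \<subseteq> B}) = \<rho>"
    proof
      fix B
      show "(\<lambda>B\<in>Union ` \<rho> ` \<pi>. {E. (\<exists>x\<in>\<pi>. E \<in> \<rho> x) \<and> E \<subseteq> B}) B = \<rho> B"
        unfolding eq using partition_on_flatten(4)[of S \<pi> \<rho> B, OF \<pi> \<rho>'] \<rho>
        by (cases "B \<in> \<pi>") (auto simp: PiE_iff extensional_def)
    qed
  qed
  show "\<forall>p\<in>(SIGMA \<sigma>:{\<sigma>. partition_on S \<sigma>}. {\<tau>. partition_on \<sigma> \<tau>}).
      (case (case p of (\<sigma>, \<tau>) \<Rightarrow> (Union ` \<tau>, \<lambda>B\<in>Union ` \<tau>. {E \<in> \<sigma>. E \<subseteq> B})) of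
        (\<pi>, \<rho>) \<Rightarrow> (\<Union>B\<in>\<pi>. \<rho> B, \<rho> ` \<pi>)) = p"
  proof
    fix p assume "p \<in> (SIGMA \<sigma>:{\<sigma>. partition_on S \<sigma>}. {\<tau>. partition_on \<sigma> \<tau>})"
    then obtain \<sigma> \<tau> where p: "p = (\<sigma>, \<tau>)" and \<sigma>: "partition_on S \<sigma>" and \<tau>: "partition_on \<sigma> \<tau>"
      by auto
    have "(\<lambda>x. {E \<in> \<sigma>. E \<subseteq> \<Union> x}) ` \<tau> = \<tau>"
      using partition_on_merge(2)[OF \<sigma> \<tau>] by auto
    moreover have "(\<Union>x\<in>\<tau>. {E \<in> \<sigma>. E \<subseteq> \<Union> x}) = \<sigma>"
      using partition_on_merge(2)[OF \<sigma> \<tau>] \<tau> by (auto simp: partition_on_def)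
    moreover have "(\<lambda>B\<in>Union ` \<tau>. {E \<in> \<sigma>. E \<subseteq> B}) ` Union ` \<tau> =
        (\<lambda>B. {E \<in> \<sigma>. E \<subseteq> B}) ` Union ` \<tau>"
      by (rule image_restrict_eq)
    ultimately show "(case (case p of (\<sigma>, \<tau>) \<Rightarrow> (Union ` \<tau>, \<lambda>B\<in>Union ` \<tau>. {E \<in> \<sigma>. E \<subseteq> B})) of
        (\<pi>, \<rho>) \<Rightarrow> (\<Union>B\<in>\<pi>. \<rho> B, \<rho> ` \<pi>)) = p"
      by (simp only: p prod.case image_image)
  qed
  show "(\<lambda>(\<pi>, \<rho>). (\<Union>B\<in>\<pi>. \<rho> B, \<rho> ` \<pi>)) `
      (SIGMA \<pi>:{\<pi>. partition_on S \<pi>}. PiE \<pi> (\<lambda>B. {\<rho>. partition_on B \<rho>}))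
      \<subseteq> (SIGMA \<sigma>:{\<sigma>. partition_on S \<sigma>}. {\<tau>. partition_on \<sigma> \<tau>})"
    using partition_on_flatten(1,2) by (fastforce simp: PiE_iff)
  show "(\<lambda>(\<sigma>, \<tau>). (Union ` \<tau>, \<lambda>B\<in>Union ` \<tau>. {E \<in> \<sigma>. E \<subseteq> B})) `
      (SIGMA \<sigma>:{\<sigma>. partition_on S \<sigma>}. {\<tau>. partition_on \<sigma> \<tau>})
      \<subseteq> (SIGMA \<pi>:{\<pi>. partition_on S \<pi>}. PiE \<pi> (\<lambda>B. {\<rho>. partition_on B \<rho>}))"
    using partition_on_merge by (auto simp: PiE_iff partition_on_merge(2))
qed

section \<open>Lists as families on an initial segment, and enumerations of finite sets\<close>

lemma list_update_map_upt: "i < n \<Longrightarrow> (map a [0..<n])[i := u] = map (a(i := u)) [0..<n]"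
  by (rule nth_equalityI) (auto simp: nth_list_update)

lemma permute_list_map_upt:
  assumes "p permutes {..<n}"
  shows "permute_list p (map a [0..<n]) = map (a \<circ> p) [0..<n]"
proof -
  have "p i < n" if "i < n" for i
    using permutes_in_image[OF assms, of i] that by auto
  then show ?thesis by (auto simp: permute_list_def)
qed

lemma map_upt_0_Suc: "map f [0..<Suc n] = f 0 # map (\<lambda>i. f (Suc i)) [0..<n]"
  by (simp add: upt_conv_Cons map_Suc_upt[symmetric] del: upt_Suc)

lemma map_as_upt: "map a l = map (\<lambda>i. a (l ! i)) [0..<length l]"
  by (rule nth_equalityI) auto

lemma fun_upd_nth:
  assumes "distinct l" "k < length l" "i < length l"
  shows "(a(l ! k := u)) (l ! i) = ((\<lambda>j. a (l ! j))(k := u)) i"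
  using assms by (auto simp: nth_eq_iff_index_eq)

lemma (in linorder) sorted_key_list_of_set_enum:
  assumes "inj_on f S" "finite S"
  shows "distinct (sorted_key_list_of_set f S)" "set (sorted_key_list_of_set f S) = S"
proof -
  interpret folding_insort_key "(\<le>)" "(<)" S f
    by unfold_locales (rule assms(1))
  show "set (sorted_key_list_of_set f S) = S"
    using set_sorted_key_list_of_set[OF subset_refl assms(2)] .
  show "distinct (sorted_key_list_of_set f S)"
    using distinct_if_distinct_map[OF distinct_sorted_key_list_of_set[OF subset_refl]] .
qed

section \<open>Calculus in restriction categories\<close>

context restriction_category
begin

lemma Hom_Arr: "f \<in> Arr C \<Longrightarrow> f \<in> Hom C (Dom C f) (Cod C f)"
  by (simp add: Hom_def)

lemma Id_simps [simp]:
  assumes "X \<in> Obj C"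
  shows "Id C X \<in> Arr C" "Dom C (Id C X) = X" "Cod C (Id C X) = X"
  using Id_Hom[OF assms] by (auto simp: Hom_def)

lemma Comp_simps [simp]:
  assumes "f \<in> Arr C" "g \<in> Arr C" "Cod C f = Dom C g"
  shows "f \<Zsemi> g \<in> Arr C" "Dom C (f \<Zsemi> g) = Dom C f" "Cod C (f \<Zsemi> g) = Cod C g"
  using Comp_Hom[of f "Dom C f" "Cod C f" g "Cod C g"] assms by (auto simp: Hom_def)

lemma Rst_simps [simp]:
  assumes "f \<in> Arr C"
  shows "Rst C f \<in> Arr C" "Dom C (Rst C f) = Dom C f" "Cod C (Rst C f) = Dom C f"
  using Rst_Hom[OF Hom_Arr[OF assms]] by (auto simp: Hom_def)

lemma Obj_simps [simp]:
  assumes "f \<in> Arr C"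
  shows "Dom C f \<in> Obj C" "Cod C f \<in> Obj C"
  using assms Dom_Obj Cod_Obj by auto

lemma Id_left' [simp]: "\<lbrakk>f \<in> Arr C; Dom C f = X\<rbrakk> \<Longrightarrow> Id C X \<Zsemi> f = f"
  using Id_left Hom_Arr by blast

lemma Id_right' [simp]: "\<lbrakk>f \<in> Arr C; Cod C f = X\<rbrakk> \<Longrightarrow> f \<Zsemi> Id C X = f"
  using Id_right Hom_Arr by blast

lemma assoc:
  "\<lbrakk>f \<in> Arr C; g \<in> Arr C; h \<in> Arr C; Cod C f = Dom C g; Cod C g = Dom C h\<rbrakk>
    \<Longrightarrow> f \<Zsemi> g \<Zsemi> h = f \<Zsemi> (g \<Zsemi> h)"
  using Comp_assoc[of f "Dom C f" "Cod C f" g "Cod C g" h "Cod C h"] by (simp add: Hom_def)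

lemma Rst_left [simp]: "f \<in> Arr C \<Longrightarrow> Rst C f \<Zsemi> f = f"
  by (rule R1)

lemma Rst_left_Comp [simp]:
  assumes "f \<in> Arr C" "g \<in> Arr C" "Cod C f = Dom C g"
  shows "Rst C f \<Zsemi> (f \<Zsemi> g) = f \<Zsemi> g"
  using assms assoc[of "Rst C f" f g] by simp

lemma Rst_commute:
  "\<lbrakk>f \<in> Arr C; g \<in> Arr C; Dom C f = Dom C g\<rbrakk> \<Longrightarrow> Rst C f \<Zsemi> Rst C g = Rst C g \<Zsemi> Rst C f"
  using R2[of f "Dom C f" "Cod C f" g "Cod C g"] by (simp add: Hom_def)

lemma Rst_Rst_Comp [simp]:
  "\<lbrakk>f \<in> Arr C; g \<in> Arr C; Dom C f = Dom C g\<rbrakk> \<Longrightarrow> Rst C (Rst C f \<Zsemi> g) = Rst C f \<Zsemi> Rst C g"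
  using R3[of f "Dom C f" "Cod C f" g "Cod C g"] by (simp add: Hom_def)

lemma Comp_Rst:
  "\<lbrakk>f \<in> Arr C; g \<in> Arr C; Cod C f = Dom C g\<rbrakk> \<Longrightarrow> f \<Zsemi> Rst C g = Rst C (f \<Zsemi> g) \<Zsemi> f"
  using R4[of f "Dom C f" "Cod C f" g "Cod C g"] by (simp add: Hom_def)

lemma Rst_Id [simp]: "X \<in> Obj C \<Longrightarrow> Rst C (Id C X) = Id C X"
  using Rst_left[of "Id C X"] Id_right'[of "Rst C (Id C X)" X] by simp

lemma Rst_Rst [simp]: "f \<in> Arr C \<Longrightarrow> Rst C (Rst C f) = Rst C f"
  using Rst_Rst_Comp[of f "Id C (Dom C f)"] by simp

lemma Rst_idem [simp]: "f \<in> Arr C \<Longrightarrow> Rst C f \<Zsemi> Rst C f = Rst C f"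
  using Rst_Rst_Comp[of f f] by simp

lemma Rst_Comp_le:
  assumes "f \<in> Arr C" "g \<in> Arr C" "Cod C f = Dom C g"
  shows "Rst C f \<Zsemi> Rst C (f \<Zsemi> g) = Rst C (f \<Zsemi> g)" "Rst C (f \<Zsemi> g) \<Zsemi> Rst C f = Rst C (f \<Zsemi> g)"
proof -
  have "Rst C f \<Zsemi> Rst C (f \<Zsemi> g) = Rst C (Rst C f \<Zsemi> (f \<Zsemi> g))"
    using assms by (subst Rst_Rst_Comp) auto
  also have "Rst C f \<Zsemi> (f \<Zsemi> g) = f \<Zsemi> g"
    using assms by (subst assoc[symmetric]) auto
  finally show "Rst C f \<Zsemi> Rst C (f \<Zsemi> g) = Rst C (f \<Zsemi> g)" .
  then show "Rst C (f \<Zsemi> g) \<Zsemi> Rst C f = Rst C (f \<Zsemi> g)"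
    using assms by (subst Rst_commute) auto
qed

lemma Rst_Comp_Rst:
  assumes "f \<in> Arr C" "g \<in> Arr C" "Cod C f = Dom C g"
  shows "Rst C (f \<Zsemi> Rst C g) = Rst C (f \<Zsemi> g)"
  using assms by (subst Comp_Rst) (auto simp: Rst_Comp_le)

lemma Rst_Comp_total:
  assumes "f \<in> Arr C" "total C g" "Cod C f = Dom C g"
  shows "Rst C (f \<Zsemi> g) = Rst C f"
  using assms Rst_Comp_Rst[of f g] by (simp add: total_def)

text \<open>
  Maps of a common restriction.  Working with a family of maps of the same restriction makes all
  correction factors in the equations for pairings disappear.
\<close>

definition pt :: "'o \<Rightarrow> 'm \<Rightarrow> 'o \<Rightarrow> 'm set" where
  "pt Z e A = {a \<in> Hom C Z A. Rst C a = e}"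

lemma ptI: "\<lbrakk>a \<in> Arr C; Dom C a = Z; Cod C a = A; Rst C a = e\<rbrakk> \<Longrightarrow> a \<in> pt Z e A"
  by (simp add: pt_def Hom_def)

lemma pt_simps:
  assumes "a \<in> pt Z e A"
  shows "a \<in> Arr C" "Dom C a = Z" "Cod C a = A" "Rst C a = e"
  using assms by (auto simp: pt_def Hom_def)

lemma pt_rst:
  assumes "a \<in> pt Z e A"
  shows "e \<in> Arr C" "Dom C e = Z" "Cod C e = Z" "Rst C e = e" "e \<Zsemi> e = e" "e \<Zsemi> a = a"
    "Z \<in> Obj C" "A \<in> Obj C"
  using pt_simps[OF assms] by auto

lemma pt_Comp:
  assumes "a \<in> pt Z e A" "g \<in> Hom C A B"
  shows "a \<Zsemi> g \<in> pt Z (Rst C (a \<Zsemi> g)) B"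
  using assms by (auto simp: pt_def Hom_def)

lemma pt_Comp_total:
  assumes "a \<in> pt Z e A" "g \<in> Hom C A B" "total C g"
  shows "a \<Zsemi> g \<in> pt Z e B"
  using assms by (auto simp: pt_def Hom_def Rst_Comp_total)

lemma pt_pull:
  assumes "a \<in> pt Z e A" "w \<in> Hom C W Z"
  shows "w \<Zsemi> a \<in> pt W (Rst C (w \<Zsemi> e)) A"
  using assms Rst_Comp_Rst[of w a] by (auto simp: pt_def Hom_def)

text \<open>The restriction idempotents of \<open>Z\<close>, to be read as its subdomains:
  \<open>d \<Zsemi> e = d\<close> says that \<open>d\<close> is contained in \<open>e\<close>, and
  composition is intersection.\<close>

definition rid :: "'o \<Rightarrow> 'm \<Rightarrow> bool" where
  "rid Z e \<longleftrightarrow> e \<in> Arr C \<and> Dom C e = Z \<and> Cod C e = Z \<and> Rst C e = e"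

lemma rid_Rst: "f \<in> Arr C \<Longrightarrow> rid (Dom C f) (Rst C f)"
  by (simp add: rid_def)

lemma rid_Id: "Z \<in> Obj C \<Longrightarrow> rid Z (Id C Z)"
  by (simp add: rid_def)

lemma pt_rid: "a \<in> pt Z e A \<Longrightarrow> rid Z e"
  using pt_simps pt_rst by (auto simp: rid_def)

lemma rid_idem: "rid Z e \<Longrightarrow> e \<Zsemi> e = e"
  using Rst_idem[of e] by (simp add: rid_def)

lemma rid_Hom: "rid Z e \<Longrightarrow> e \<in> Hom C Z Z"
  by (simp add: rid_def Hom_def)

lemma rid_meet_iff:
  assumes "rid Z d" "f \<in> Arr C" "g \<in> Arr C" "Dom C f = Z" "Dom C g = Z"
  shows "d \<Zsemi> (Rst C f \<Zsemi> Rst C g) = d \<longleftrightarrow> d \<Zsemi> Rst C f = d \<and> d \<Zsemi> Rst C g = d"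
proof
  assume *: "d \<Zsemi> (Rst C f \<Zsemi> Rst C g) = d"
  have d: "d \<in> Arr C" "Cod C d = Z" using assms by (auto simp: rid_def)
  have gf: "Rst C g \<Zsemi> Rst C f = Rst C f \<Zsemi> Rst C g"
    using assms by (intro Rst_commute) auto
  have fgf: "Rst C f \<Zsemi> Rst C g \<Zsemi> Rst C f = Rst C f \<Zsemi> Rst C g"
    using assms gf assoc[of "Rst C f" "Rst C g" "Rst C f"] assoc[of "Rst C f" "Rst C f" "Rst C g"] by simp
  have "d \<Zsemi> Rst C f = d \<Zsemi> (Rst C f \<Zsemi> Rst C g) \<Zsemi> Rst C f" using * by simp
  also have "\<dots> = d \<Zsemi> (Rst C f \<Zsemi> Rst C g \<Zsemi> Rst C f)"
    using assms d by (subst assoc) auto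
  finally have 1: "d \<Zsemi> Rst C f = d" using * fgf by simp
  have "d \<Zsemi> Rst C g = d"
    using assms d * assoc[of d "Rst C f \<Zsemi> Rst C g" "Rst C g"] assoc[of "Rst C f" "Rst C g" "Rst C g"] by simp
  then show "d \<Zsemi> Rst C f = d \<and> d \<Zsemi> Rst C g = d" using 1 by blast
next
  assume "d \<Zsemi> Rst C f = d \<and> d \<Zsemi> Rst C g = d"
  then show "d \<Zsemi> (Rst C f \<Zsemi> Rst C g) = d"
    using assms assoc[of d "Rst C f" "Rst C g"] by (simp add: rid_def)
qed

lemma restrict_absorb:
  assumes "rid Z d" "f \<in> Arr C" "Dom C f = Z" "Rst C f \<Zsemi> d = Rst C f"
  shows "d \<Zsemi> f = f"
proof -
  have "d \<Zsemi> f = d \<Zsemi> Rst C f \<Zsemi> f"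
    using assms by (simp add: assoc rid_def)
  also have "d \<Zsemi> Rst C f = Rst C f \<Zsemi> d"
    using assms Rst_commute[of d f] by (simp add: rid_def)
  finally show ?thesis using assms by simp
qed

lemma rid_pt:
  assumes "rid Z d" "a \<in> Arr C" "Dom C a = Z" "d \<Zsemi> Rst C a = d"
  shows "d \<Zsemi> a \<in> pt Z d (Cod C a)"
  using assms Rst_Rst_Comp[of d a] by (auto intro!: ptI simp: rid_def)

end

section \<open>Pairings, powers and tuples of partial maps\<close>

context cartesian_restriction_category
begin

lemma Prod_simps [simp]:
  assumes "X \<in> Obj C" "Y \<in> Obj C"
  shows "Prod C X Y \<in> Obj C" "prj0 C X Y \<in> Arr C" "Dom C (prj0 C X Y) = Prod C X Y"
    "Cod C (prj0 C X Y) = X" "prj1 C X Y \<in> Arr C" "Dom C (prj1 C X Y) = Prod C X Y"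
    "Cod C (prj1 C X Y) = Y" "Rst C (prj0 C X Y) = Id C (Prod C X Y)"
    "Rst C (prj1 C X Y) = Id C (Prod C X Y)"
  using Prod_Obj[OF assms] prj0[OF assms] prj1[OF assms] by (auto simp: Hom_def total_def)

lemma prj_total:
  assumes "X \<in> Obj C" "Y \<in> Obj C"
  shows "total C (prj0 C X Y)" "total C (prj1 C X Y)"
  using assms by (auto simp: total_def)

lemma bang_simps [simp]:
  assumes "X \<in> Obj C"
  shows "bang C X \<in> Arr C" "Dom C (bang C X) = X" "Cod C (bang C X) = One C"
    "Rst C (bang C X) = Id C X"
  using theI'[OF bang_ex1[OF assms]] unfolding bang_def[symmetric]
  by (auto simp: Hom_def total_def)

lemma to_One_eqI:
  assumes "f \<in> Hom C X (One C)" "g \<in> Hom C X (One C)" "Rst C f = Rst C g"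
  shows "f = g"
  using to_One[OF assms(1)] to_One[OF assms(2)] assms(3) by simp

lemma pair_is_pairing:
  assumes "f \<in> Arr C" "g \<in> Arr C" "Dom C f = Dom C g"
  shows "is_pairing C f g (pair C f g)"
proof -
  have "\<exists>!h. is_pairing C f g h"
    using assms by (intro pair_ex1[of f "Dom C f" "Cod C f" g "Cod C g"]) (auto simp: Hom_def)
  then show ?thesis unfolding pair_def by (rule theI')
qed

lemma pair_simps [simp]:
  assumes "f \<in> Arr C" "g \<in> Arr C" "Dom C f = Dom C g"
  shows "pair C f g \<in> Arr C" "Dom C (pair C f g) = Dom C g"
    "Cod C (pair C f g) = Prod C (Cod C f) (Cod C g)"
  using pair_is_pairing[OF assms] assms by (auto simp: is_pairing_def Hom_def)

lemma pair_prj: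
  assumes "f \<in> Arr C" "g \<in> Arr C" "Dom C f = Dom C g" "Cod C f = X" "Cod C g = Y"
  shows "pair C f g \<Zsemi> prj0 C X Y = Rst C g \<Zsemi> f" "pair C f g \<Zsemi> prj1 C X Y = Rst C f \<Zsemi> g"
  using pair_is_pairing[OF assms(1-3)] assms(4,5) by (auto simp: is_pairing_def)

lemma pair_unique:
  assumes "f \<in> Arr C" "g \<in> Arr C" "Dom C f = Dom C g" "is_pairing C f g h"
  shows "h = pair C f g"
proof -
  have "\<exists>!h. is_pairing C f g h"
    using assms by (intro pair_ex1[of f "Dom C f" "Cod C f" g "Cod C g"]) (auto simp: Hom_def)
  then show ?thesis using assms pair_is_pairing by blast
qed

text \<open>The projections are total, so both components of \<open>h\<close> have the restriction
  of \<open>h\<close>, and the correction factors in the pairing equations are absorbed. Partial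
  maps into a product are therefore still determined by their components.\<close>

lemma Prod_eta:
  assumes "h \<in> Hom C Z (Prod C X Y)" "X \<in> Obj C" "Y \<in> Obj C"
  shows "pair C (h \<Zsemi> prj0 C X Y) (h \<Zsemi> prj1 C X Y) = h"
proof (rule pair_unique[symmetric])
  show "is_pairing C (h \<Zsemi> prj0 C X Y) (h \<Zsemi> prj1 C X Y) h"
    using assms by (simp add: is_pairing_def Hom_def Rst_Comp_total prj_total)
qed (use assms in \<open>auto simp: Hom_def\<close>)

lemma Prod_eqI:
  assumes "h \<in> Hom C Z (Prod C X Y)" "k \<in> Hom C Z (Prod C X Y)" "X \<in> Obj C" "Y \<in> Obj C"
    "h \<Zsemi> prj0 C X Y = k \<Zsemi> prj0 C X Y" "h \<Zsemi> prj1 C X Y = k \<Zsemi> prj1 C X Y"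
  shows "h = k"
  using Prod_eta[OF assms(1,3,4)] Prod_eta[OF assms(2,3,4)] unfolding assms(5,6) by (rule trans[OF sym])

lemma Rst_pair [simp]:
  assumes "f \<in> Arr C" "g \<in> Arr C" "Dom C f = Dom C g"
  shows "Rst C (pair C f g) = Rst C f \<Zsemi> Rst C g"
proof -
  have "Rst C (pair C f g) = Rst C (pair C f g \<Zsemi> prj0 C (Cod C f) (Cod C g))"
    using assms by (subst Rst_Comp_total) (auto simp: prj_total)
  also have "\<dots> = Rst C g \<Zsemi> Rst C f"
    using assms by (subst pair_prj) auto
  also have "\<dots> = Rst C f \<Zsemi> Rst C g"
    using assms by (intro Rst_commute) auto
  finally show ?thesis .
qed

text \<open>R4 moves \<open>w\<close> past the correction factor \<open>Rst C g\<close> and turns it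
  into \<open>Rst C (w \<Zsemi> g)\<close>, which is the correction factor of the pairing on the
  right.\<close>

lemma Comp_pair:
  assumes "w \<in> Arr C" "f \<in> Arr C" "g \<in> Arr C" "Dom C f = Dom C g" "Cod C w = Dom C g"
  shows "w \<Zsemi> pair C f g = pair C (w \<Zsemi> f) (w \<Zsemi> g)"
proof (rule pair_unique)
  have *: "w \<Zsemi> (Rst C g \<Zsemi> f) = Rst C (w \<Zsemi> g) \<Zsemi> (w \<Zsemi> f)"
    if "f \<in> Arr C" "g \<in> Arr C" "Dom C f = Dom C g" "Cod C w = Dom C g" for f g
    using that assms(1) Comp_Rst[of w g] assoc[of w "Rst C g" f] assoc[of "Rst C (w \<Zsemi> g)" w f]
    by simp
  have "w \<Zsemi> pair C f g \<Zsemi> prj0 C (Cod C f) (Cod C g) = Rst C (w \<Zsemi> g) \<Zsemi> (w \<Zsemi> f)"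
    using assms by (subst assoc) (auto simp: pair_prj *)
  moreover have "w \<Zsemi> pair C f g \<Zsemi> prj1 C (Cod C f) (Cod C g) = Rst C (w \<Zsemi> f) \<Zsemi> (w \<Zsemi> g)"
    using assms by (subst assoc) (auto simp: pair_prj *)
  ultimately show "is_pairing C (w \<Zsemi> f) (w \<Zsemi> g) (w \<Zsemi> pair C f g)"
    using assms by (simp add: is_pairing_def Hom_def)
qed (use assms in auto)

lemma pair_pt:
  assumes "f \<in> pt Z e X" "g \<in> pt Z e Y"
  shows "pair C f g \<in> pt Z e (Prod C X Y)"
    "pair C f g \<Zsemi> prj0 C X Y = f" "pair C f g \<Zsemi> prj1 C X Y = g"
  using pt_simps[OF assms(1)] pt_simps[OF assms(2)] pt_rst[OF assms(1)] pt_rst[OF assms(2)]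
  by (auto intro!: ptI simp: pair_prj)

lemma npow_Obj [simp]: "\<lbrakk>A \<in> Obj C; X \<in> Obj C\<rbrakk> \<Longrightarrow> npow C A X n \<in> Obj C"
  by (induction n) auto

lemma proj_simps [simp]:
  assumes "A \<in> Obj C" "X \<in> Obj C" "i \<le> n"
  shows "proj C A X n i \<in> Arr C" "Dom C (proj C A X n i) = npow C A X n"
    "Cod C (proj C A X n i) = (if i < n then A else X)"
    "Rst C (proj C A X n i) = Id C (npow C A X n)"
proof -
  have "proj C A X n i \<in> Arr C \<and> Dom C (proj C A X n i) = npow C A X n \<and>
    Cod C (proj C A X n i) = (if i < n then A else X) \<and>
    Rst C (proj C A X n i) = Id C (npow C A X n)"
    using assms(3)
  proof (induction n arbitrary: i)
    case 0
    then show ?case using assms by simp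
  next
    case (Suc n)
    then show ?case
      using assms Rst_Comp_Rst[of "prj1 C A (npow C A X n)" "proj C A X n (i - 1)"]
      by (cases i) auto
  qed
  then show "proj C A X n i \<in> Arr C" "Dom C (proj C A X n i) = npow C A X n"
    "Cod C (proj C A X n i) = (if i < n then A else X)"
    "Rst C (proj C A X n i) = Id C (npow C A X n)" by auto
qed

lemma tuple_simps:
  assumes "set as \<subseteq> Hom C Z A" "x \<in> Hom C Z X"
  shows "tuple C as x \<in> Arr C" "Dom C (tuple C as x) = Z" "Cod C (tuple C as x) = npow C A X (length as)"
  using assms by (induction as) (auto simp: Hom_def)

lemma Comp_tuple:
  assumes "w \<in> Hom C W Z" "set as \<subseteq> Hom C Z A" "x \<in> Hom C Z X"
  shows "w \<Zsemi> tuple C as x = tuple C (map (\<lambda>a. w \<Zsemi> a) as) (w \<Zsemi> x)"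
  using assms(2)
proof (induction as)
  case (Cons a as)
  have "w \<in> Arr C" "Cod C w = Z" using assms(1) by (auto simp: Hom_def)
  moreover have "a \<in> Arr C" "Dom C a = Z" using Cons.prems by (auto simp: Hom_def)
  ultimately show ?case
    using Cons tuple_simps[of as Z A x X] assms(3) by (simp add: Comp_pair)
qed simp

text \<open>The restriction of a tuple is the meet of the restrictions of its entries. Testing it
  against subdomains \<open>d\<close> gives a form that is insensitive to the order of the entries
  and to replacing one of them.\<close>

lemma tuple_le_iff:
  assumes "rid Z d" "set as \<subseteq> Hom C Z A" "x \<in> Hom C Z X"
  shows "d \<Zsemi> Rst C (tuple C as x) = d \<longleftrightarrow> (\<forall>a\<in>set as. d \<Zsemi> Rst C a = d) \<and> d \<Zsemi> Rst C x = d"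
  using assms(2)
proof (induction as)
  case (Cons a as)
  have a: "a \<in> Arr C" "Dom C a = Z" using Cons.prems by (auto simp: Hom_def)
  have t: "tuple C as x \<in> Arr C" "Dom C (tuple C as x) = Z"
    using tuple_simps[of as Z A x X] Cons.prems assms(3) by auto
  have "d \<Zsemi> Rst C (tuple C (a # as) x) = d \<longleftrightarrow> d \<Zsemi> (Rst C a \<Zsemi> Rst C (tuple C as x)) = d"
    using a t by simp
  also have "\<dots> \<longleftrightarrow> d \<Zsemi> Rst C a = d \<and> d \<Zsemi> Rst C (tuple C as x) = d"
    by (rule rid_meet_iff[OF assms(1) a(1) t(1) a(2) t(2)])
  finally show ?case using Cons by auto
qed simp

lemma tuple_le:
  assumes "set as \<subseteq> Hom C Z A" "x \<in> Hom C Z X"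
  shows "a \<in> set as \<Longrightarrow> Rst C (tuple C as x) \<Zsemi> Rst C a = Rst C (tuple C as x)"
    and "Rst C (tuple C as x) \<Zsemi> Rst C x = Rst C (tuple C as x)"
proof -
  have "rid Z (Rst C (tuple C as x))"
    using rid_Rst[of "tuple C as x"] tuple_simps[OF assms] by simp
  from tuple_le_iff[OF this assms]
  show "a \<in> set as \<Longrightarrow> Rst C (tuple C as x) \<Zsemi> Rst C a = Rst C (tuple C as x)"
    and "Rst C (tuple C as x) \<Zsemi> Rst C x = Rst C (tuple C as x)"
    using tuple_simps[OF assms] by auto
qed

lemma tuple_pt:
  assumes "set as \<subseteq> pt Z e A" "x \<in> pt Z e X"
  shows "tuple C as x \<in> pt Z e (npow C A X (length as))"
  using assms by (induction as) (auto intro: pair_pt)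

lemma tuple_proj:
  assumes "set as \<subseteq> pt Z e A" "x \<in> pt Z e X" "i \<le> length as" "A \<in> Obj C"
  shows "tuple C as x \<Zsemi> proj C A X (length as) i = (if i < length as then as ! i else x)"
  using assms(1,3)
proof (induction as arbitrary: i)
  case Nil
  then show ?case using assms(2) pt_simps[OF assms(2)] by simp
next
  case (Cons a as)
  have X: "X \<in> Obj C" using pt_rst[OF assms(2)] by simp
  have t: "tuple C as x \<in> pt Z e (npow C A X (length as))" and a: "a \<in> pt Z e A"
    using Cons.prems assms tuple_pt by auto
  note p = pair_pt[OF a t]
  show ?case
  proof (cases i)
    case 0
    then show ?thesis using p by simp
  next
    case (Suc j)
    have "pair C a (tuple C as x) \<Zsemi> (prj1 C A (npow C A X (length as)) \<Zsemi> proj C A X (length as) j)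
      = tuple C as x \<Zsemi> proj C A X (length as) j"
      using p pt_simps[OF p(1)] assms(4) X Cons.prems Suc by (subst assoc[symmetric]) auto
    then show ?thesis using Suc Cons by simp
  qed
qed

lemma tuple_eta:
  assumes "h \<in> Hom C Z (npow C A X n)" "A \<in> Obj C" "X \<in> Obj C"
  shows "tuple C (map (\<lambda>i. h \<Zsemi> proj C A X n i) [0..<n]) (h \<Zsemi> proj C A X n n) = h"
  using assms(1)
proof (induction n arbitrary: h)
  case 0
  then show ?case by (simp add: Hom_def)
next
  case (Suc n)
  let ?P = "npow C A X n"
  have h: "h \<in> Hom C Z (Prod C A ?P)" "h \<in> Arr C" "Cod C h = Prod C A ?P" "Dom C h = Z"
    using Suc.prems by (auto simp: Hom_def)
  have 1: "h \<Zsemi> (prj1 C A ?P \<Zsemi> proj C A X n i) = h \<Zsemi> prj1 C A ?P \<Zsemi> proj C A X n i" if "i \<le> n" for i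
    using h assms that by (subst assoc) auto
  have "tuple C (map (\<lambda>i. h \<Zsemi> prj1 C A ?P \<Zsemi> proj C A X n i) [0..<n]) (h \<Zsemi> prj1 C A ?P \<Zsemi> proj C A X n n)
     = h \<Zsemi> prj1 C A ?P"
    by (rule Suc.IH) (use h assms in \<open>auto simp: Hom_def\<close>)
  moreover have "map (\<lambda>i. h \<Zsemi> (prj1 C A ?P \<Zsemi> proj C A X n i)) [0..<n] =
      map (\<lambda>i. h \<Zsemi> prj1 C A ?P \<Zsemi> proj C A X n i) [0..<n]"
    using 1 by auto
  ultimately have "tuple C (map (\<lambda>i. h \<Zsemi> (prj1 C A ?P \<Zsemi> proj C A X n i)) [0..<n])
      (h \<Zsemi> (prj1 C A ?P \<Zsemi> proj C A X n n)) = h \<Zsemi> prj1 C A ?P"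
    by (simp only: 1[OF order.refl])
  then show ?case
    unfolding map_upt_0_Suc using Prod_eta[OF h(1)] assms by simp
qed

lemma tuple_projs:
  assumes "A \<in> Obj C" "X \<in> Obj C"
  shows "tuple C (map (proj C A X n) [0..<n]) (proj C A X n n) = Id C (npow C A X n)"
proof -
  have "map (\<lambda>i. Id C (npow C A X n) \<Zsemi> proj C A X n i) [0..<n] = map (proj C A X n) [0..<n]"
    using assms by auto
  moreover have "Id C (npow C A X n) \<Zsemi> proj C A X n n = proj C A X n n"
    using assms by auto
  ultimately show ?thesis
    using tuple_eta[of "Id C (npow C A X n)" "npow C A X n" A X n] assms by (simp only: Id_Hom npow_Obj)
qed

subsection \<open>Sums of maps\<close>

abbreviation tcm :: "('o, 'm) cmon \<Rightarrow> bool" where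
  "tcm \<equiv> total_comm_monoid C"

abbreviation add :: "('o, 'm) cmon \<Rightarrow> 'm \<Rightarrow> 'm \<Rightarrow> 'm" where
  "add \<equiv> add_maps C"

abbreviation zero :: "('o, 'm) cmon \<Rightarrow> 'o \<Rightarrow> 'm" where
  "zero \<equiv> zero_map C"

lemma tcm_simps [simp]:
  assumes "tcm M"
  shows "cobj M \<in> Obj C" "cadd M \<in> Arr C" "Dom C (cadd M) = Prod C (cobj M) (cobj M)"
    "Cod C (cadd M) = cobj M" "total C (cadd M)"
    "czero M \<in> Arr C" "Dom C (czero M) = One C" "Cod C (czero M) = cobj M" "total C (czero M)"
  using assms by (auto simp: total_comm_monoid_def Let_def Hom_def)

lemma add_simps [simp]:
  assumes "tcm M" "u \<in> Hom C Z (cobj M)" "v \<in> Hom C Z (cobj M)"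
  shows "add M u v \<in> Arr C" "Dom C (add M u v) = Z" "Cod C (add M u v) = cobj M"
    "Rst C (add M u v) = Rst C u \<Zsemi> Rst C v"
  using assms by (auto simp: add_maps_def Hom_def Rst_Comp_total)

lemma add_Hom: "\<lbrakk>tcm M; u \<in> Hom C Z (cobj M); v \<in> Hom C Z (cobj M)\<rbrakk> \<Longrightarrow> add M u v \<in> Hom C Z (cobj M)"
  by (simp add: Hom_def[of C Z "cobj M"] add_simps[of M u Z v])

lemma zero_simps [simp]:
  assumes "tcm M" "Z \<in> Obj C"
  shows "zero M Z \<in> Arr C" "Dom C (zero M Z) = Z" "Cod C (zero M Z) = cobj M"
    "Rst C (zero M Z) = Id C Z"
  using assms One_Obj by (auto simp: zero_map_def Rst_Comp_total)

lemma zero_Hom: "\<lbrakk>tcm M; Z \<in> Obj C\<rbrakk> \<Longrightarrow> zero M Z \<in> Hom C Z (cobj M)"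
  by (simp add: Hom_def)

lemma Comp_add:
  assumes "tcm M" "w \<in> Hom C W Z" "u \<in> Hom C Z (cobj M)" "v \<in> Hom C Z (cobj M)"
  shows "w \<Zsemi> add M u v = add M (w \<Zsemi> u) (w \<Zsemi> v)"
proof -
  have "w \<Zsemi> add M u v = w \<Zsemi> pair C u v \<Zsemi> cadd M"
    unfolding add_maps_def using assms by (subst assoc) (auto simp: Hom_def)
  then show ?thesis
    unfolding add_maps_def using assms by (subst (asm) Comp_pair) (auto simp: Hom_def)
qed

text \<open>A map to the terminal object is determined by its restriction, so \<open>w\<close>
  followed by the total map to it is the total map from \<open>W\<close> cut down to the domain of
  \<open>w\<close>. This is where restricted zeros come from.\<close>

lemma Comp_zero:
  assumes "tcm M" "w \<in> Hom C W Z"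
  shows "w \<Zsemi> zero M Z = Rst C w \<Zsemi> zero M W"
proof -
  have w: "w \<in> Arr C" "Dom C w = W" "Cod C w = Z" "W \<in> Obj C" "Z \<in> Obj C"
    using assms(2) by (auto simp: Hom_def)
  have "w \<Zsemi> bang C Z = Rst C w \<Zsemi> bang C W"
    by (rule to_One_eqI[where X = W]) (use w in \<open>auto simp: Hom_def Rst_Comp_total total_def\<close>)
  then show ?thesis
    unfolding zero_map_def using w assms(1) One_Obj by (simp add: assoc[symmetric])
qed

abbreviation mpt :: "'o \<Rightarrow> 'm \<Rightarrow> ('o, 'm) cmon \<Rightarrow> 'm set" where
  "mpt Z e M \<equiv> pt Z e (cobj M)"

lemma add_pt:
  assumes "tcm M" "u \<in> mpt Z e M" "v \<in> mpt Z e M"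
  shows "add M u v \<in> mpt Z e M"
  using add_Hom[of M u Z v] add_simps(4)[of M u Z v] assms pt_rst(5)[OF assms(2)] by (auto simp: pt_def)

lemma rid_zero_pt:
  assumes "tcm M" "rid Z e"
  shows "e \<Zsemi> zero M Z \<in> mpt Z e M"
proof -
  have "Z \<in> Obj C" using assms(2) by (auto simp: rid_def)
  then show ?thesis using rid_pt[OF assms(2), of "zero M Z"] assms by (simp add: rid_def)
qed

text \<open>The monoid laws are given at the projections; precomposing with the tuple of
  \<open>u\<close>, \<open>v\<close>, \<open>w\<close> carries them to arbitrary maps. The common
  restriction \<open>e\<close> ensures that the components of this tuple are exactly
  \<open>u\<close>, \<open>v\<close> and \<open>w\<close>.\<close>

lemma
  assumes M: "tcm M"
  shows add_assoc_pt: "\<lbrakk>u \<in> mpt Z e M; v \<in> mpt Z e M; w \<in> mpt Z e M\<rbrakk>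
      \<Longrightarrow> add M (add M u v) w = add M u (add M v w)"
    and add_zero_pt: "u \<in> mpt Z e M \<Longrightarrow> add M (e \<Zsemi> zero M Z) u = u"
    and add_commute_pt: "\<lbrakk>u \<in> mpt Z e M; v \<in> mpt Z e M\<rbrakk> \<Longrightarrow> add M u v = add M v u"
proof -
  define A where "A = cobj M"
  define AA where "AA = Prod C A A"
  note A = A_def[symmetric] AA_def[symmetric]
  have O: "A \<in> Obj C" "AA \<in> Obj C" using M by (auto simp: A_def AA_def)
  let ?p = "prj0 C A A" and ?q = "prj1 C A A"
  let ?a = "prj0 C AA A \<Zsemi> ?p" and ?b = "prj0 C AA A \<Zsemi> ?q" and ?c = "prj1 C AA A"
  have pq: "?p \<in> Hom C AA A" "?q \<in> Hom C AA A"
    using O AA_def by (auto simp: Hom_def)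
  have abc: "?a \<in> Hom C (Prod C AA A) A" "?b \<in> Hom C (Prod C AA A) A" "?c \<in> Hom C (Prod C AA A) A"
    using O AA_def by (auto simp: Hom_def)
  have ax: "add M (add M ?a ?b) ?c = add M ?a (add M ?b ?c)"
      "add M (zero M A) (Id C A) = Id C A" "add M ?p ?q = add M ?q ?p"
    using M unfolding total_comm_monoid_def Let_def A by auto
  note ca = Comp_add[OF M, unfolded A] and ha = add_Hom[OF M, unfolded A]
  {
    assume u: "u \<in> mpt Z e M" and v: "v \<in> mpt Z e M"
    note u = u[unfolded A] and v = v[unfolded A]
    note p = pair_pt[OF u v, unfolded A]
    have "pair C u v \<in> Hom C Z AA" using p by (auto simp: pt_def)
    note ca[OF this pq] and ca[OF this pq(2) pq(1)]
    then show "add M u v = add M v u" using ax p by simp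
    assume w: "w \<in> mpt Z e M"
    note w = w[unfolded A]
    note q = pair_pt[OF p(1) w]
    let ?t = "pair C (pair C u v) w"
    have t: "?t \<in> Hom C Z (Prod C AA A)" "?t \<in> Arr C" "Cod C ?t = Prod C AA A"
      using q by (auto simp: pt_def Hom_def)
    have abc': "?t \<Zsemi> ?a = u" "?t \<Zsemi> ?b = v" "?t \<Zsemi> ?c = w"
      using q p O t by (auto simp: assoc[symmetric] AA_def[symmetric])
    have "?t \<Zsemi> add M (add M ?a ?b) ?c = add M (add M u v) w"
      using ca[OF t(1) ha[OF abc(1,2)] abc(3)] ca[OF t(1) abc(1,2)] abc' by simp
    moreover have "?t \<Zsemi> add M ?a (add M ?b ?c) = add M u (add M v w)"
      using ca[OF t(1) abc(1) ha[OF abc(2,3)]] ca[OF t(1) abc(2,3)] abc' by simp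
    ultimately show "add M (add M u v) w = add M u (add M v w)" using ax by simp
  }
  assume u: "u \<in> mpt Z e M"
  note u = u[unfolded A]
  have u': "u \<in> Hom C Z A" "Cod C u = A" "u \<in> Arr C" "Rst C u = e" using u by (auto simp: pt_def Hom_def)
  have "u \<Zsemi> add M (zero M A) (Id C A) = add M (u \<Zsemi> zero M A) (u \<Zsemi> Id C A)"
    by (rule ca[OF u'(1)]) (use O zero_Hom[OF M, unfolded A] Id_Hom in auto)
  then show "add M (e \<Zsemi> zero M Z) u = u"
    using ax Comp_zero[OF M u'(1)] u' by simp
qed

text \<open>The unit is zero cut down to \<open>e\<close>, so that it has restriction
  \<open>e\<close> like every other element. It is also exactly what a multiadditive map returns on
  a zero argument.\<close>

definition pt_monoid :: "'o \<Rightarrow> 'm \<Rightarrow> ('o, 'm) cmon \<Rightarrow> 'm monoid" where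
  "pt_monoid Z e M =
     \<lparr>carrier = mpt Z e M, monoid.mult = add_maps C M, one = e \<Zsemi> zero_map C M Z\<rparr>"

lemma pt_monoid_simps [simp]:
  "carrier (pt_monoid Z e M) = mpt Z e M"
  "monoid.mult (pt_monoid Z e M) = add_maps C M"
  "one (pt_monoid Z e M) = e \<Zsemi> zero_map C M Z"
  by (auto simp: pt_monoid_def)

lemma comm_monoid_pt:
  assumes "tcm M" "rid Z e"
  shows "comm_monoid (pt_monoid Z e M)"
  by (rule comm_monoidI) (use assms in \<open>auto simp: add_pt rid_zero_pt add_assoc_pt add_zero_pt intro: add_commute_pt\<close>)

text \<open>The sums in the definition of composition are taken in this monoid. Both sides of each
  law have the same restriction, so they may be compared after restricting all maps to that domain,
  where the laws for maps of a common restriction apply.\<close>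

lemma comm_monoid_hom:
  assumes M: "tcm M" and Z: "Z \<in> Obj C"
  shows "comm_monoid (hom_monoid C Z M)"
proof (rule comm_monoidI)
  let ?H = "hom_monoid C Z M"
  have eqI: "s = t" if "s \<in> Arr C" "t \<in> Arr C" "Rst C s = d" "Rst C t = d" "d \<Zsemi> s = d \<Zsemi> t" for s t d
    using that Rst_left by metis
  have pt: "d \<Zsemi> u \<in> mpt Z d M" if "rid Z d" "u \<in> Hom C Z (cobj M)" "d \<Zsemi> Rst C u = d" for d u
    using rid_pt[of Z d u] that by (auto simp: Hom_def)
  note ha = add_Hom[OF M] and ca = Comp_add[OF M]
  fix u v assume "u \<in> carrier (?H)" "v \<in> carrier (?H)"
  then have u: "u \<in> Hom C Z (cobj M)" and v: "v \<in> Hom C Z (cobj M)"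
    by (auto simp: hom_monoid_def)
  then have uv: "u \<in> Arr C" "Dom C u = Z" "v \<in> Arr C" "Dom C v = Z"
    by (auto simp: Hom_def)
  show "u \<otimes>\<^bsub>?H\<^esub> v \<in> carrier (?H)"
    using ha u v by (simp add: hom_monoid_def)
  let ?d = "Rst C u \<Zsemi> Rst C v"
  have comm: "Rst C v \<Zsemi> Rst C u = ?d" using uv by (intro Rst_commute) auto
  have d: "rid Z ?d" using uv by (simp add: rid_def)
  have dd: "?d \<Zsemi> (Rst C u \<Zsemi> Rst C v) = ?d" using Rst_idem[of "Rst C u \<Zsemi> v"] uv by simp
  then have le: "?d \<Zsemi> Rst C u = ?d" "?d \<Zsemi> Rst C v = ?d"
    using rid_meet_iff[OF d uv(1,3,2,4)] by auto
  show "u \<otimes>\<^bsub>?H\<^esub> v = v \<otimes>\<^bsub>?H\<^esub> u"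
    unfolding hom_monoid_def monoid.simps
  proof (rule eqI)
    show "?d \<Zsemi> add M u v = ?d \<Zsemi> add M v u"
      using ca[OF rid_Hom[OF d] u v] ca[OF rid_Hom[OF d] v u]
        add_commute_pt[OF M pt[OF d u le(1)] pt[OF d v le(2)]] by simp
  qed (use ha u v M comm add_simps(4)[OF M] in \<open>auto simp: Hom_def\<close>)
  show "\<one>\<^bsub>?H\<^esub> \<otimes>\<^bsub>?H\<^esub> u = u"
    unfolding hom_monoid_def monoid.simps
  proof (rule eqI)
    have r: "rid Z (Rst C u)" using uv by (simp add: rid_def)
    have "Rst C u \<Zsemi> add M (zero M Z) u = add M (Rst C u \<Zsemi> zero M Z) (Rst C u \<Zsemi> u)"
      by (rule ca[OF rid_Hom[OF r]]) (use zero_Hom[OF M Z] u in auto)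
    also have "\<dots> = Rst C u \<Zsemi> u"
      using add_zero_pt[OF M, of u Z "Rst C u"] u uv by (simp add: pt_def)
    finally show "Rst C u \<Zsemi> add M (zero M Z) u = Rst C u \<Zsemi> u" .
  qed (use ha u uv Z M zero_Hom[OF M Z] in \<open>auto simp: Hom_def add_simps[OF M zero_Hom[OF M Z] u]\<close>)
  fix w assume "w \<in> carrier (?H)"
  then have w: "w \<in> Hom C Z (cobj M)" and w': "w \<in> Arr C" "Dom C w = Z"
    by (auto simp: hom_monoid_def Hom_def)
  let ?e = "?d \<Zsemi> Rst C w"
  have e: "rid Z ?e" using uv w' Rst_Rst_Comp[of "Rst C u \<Zsemi> v" "Rst C w"] by (simp add: rid_def)
  have "?e \<Zsemi> (Rst C (Rst C u \<Zsemi> v) \<Zsemi> Rst C w) = ?e"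
    using rid_idem[OF e] uv w' by simp
  then have "?e \<Zsemi> Rst C (Rst C u \<Zsemi> v) = ?e \<and> ?e \<Zsemi> Rst C w = ?e"
    using rid_meet_iff[OF e, of "Rst C u \<Zsemi> v" w] uv w' by simp
  then have le': "?e \<Zsemi> Rst C u = ?e" "?e \<Zsemi> Rst C v = ?e" "?e \<Zsemi> Rst C w = ?e"
    using rid_meet_iff[OF e uv(1,3,2,4)] uv by auto
  note p = pt[OF e u le'(1)] pt[OF e v le'(2)] pt[OF e w le'(3)]
  note c = ca[OF rid_Hom[OF e]]
  show "u \<otimes>\<^bsub>?H\<^esub> v \<otimes>\<^bsub>?H\<^esub> w = u \<otimes>\<^bsub>?H\<^esub> (v \<otimes>\<^bsub>?H\<^esub> w)"
    unfolding hom_monoid_def monoid.simps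
  proof (rule eqI)
    show "?e \<Zsemi> add M (add M u v) w = ?e \<Zsemi> add M u (add M v w)"
      using c[OF ha[OF u v] w] c[OF u ha[OF v w]] c[OF u v] c[OF v w] add_assoc_pt[OF M p] by simp
    show "Rst C (add M (add M u v) w) = ?e"
      using add_simps(4)[OF M ha[OF u v] w] add_simps(4)[OF M u v] by simp
    show "Rst C (add M u (add M v w)) = ?e"
      using add_simps(4)[OF M u ha[OF v w]] add_simps(4)[OF M v w] uv w' by (simp add: assoc)
  qed (use ha[OF ha[OF u v] w] ha[OF u ha[OF v w]] in \<open>auto simp: Hom_def\<close>)
qed (use zero_Hom[OF M Z] in \<open>auto simp: hom_monoid_def\<close>)

text \<open>
  The units of the two monoids differ, so the sums agree only over nonempty index sets.
\<close>

lemma finprod_hom_monoid_eq: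
  assumes M: "tcm M" and e: "rid Z e"
    and "finite A" "A \<noteq> {}" "F \<in> A \<rightarrow> mpt Z e M"
  shows "finprod (hom_monoid C Z M) F A = finprod (pt_monoid Z e M) F A"
proof -
  have Z: "Z \<in> Obj C" using e by (auto simp: rid_def)
  interpret H: comm_monoid "hom_monoid C Z M" by (rule comm_monoid_hom[OF M Z])
  interpret P: comm_monoid "pt_monoid Z e M" by (rule comm_monoid_pt[OF M e])
  have sub: "mpt Z e M \<subseteq> carrier (hom_monoid C Z M)"
    by (auto simp: hom_monoid_def pt_def)
  show ?thesis
    using assms(3-5)
  proof (induction rule: finite_ne_induct)
    case (singleton i)
    then have "F i \<in> mpt Z e M" by auto
    moreover from this have "F i \<in> carrier (hom_monoid C Z M)" using sub by auto
    moreover have "F i \<in> carrier (pt_monoid Z e M)" using calculation by simp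
    ultimately show ?case
      using H.finprod_insert[of "{}" i F] P.finprod_insert[of "{}" i F] P.r_one[of "F i"]
        H.r_one[of "F i"] by simp
  next
    case (insert i A)
    have "F i \<in> mpt Z e M" "F \<in> A \<rightarrow> mpt Z e M" using insert.prems by auto
    moreover have "F i \<in> carrier (hom_monoid C Z M)" "F \<in> A \<rightarrow> carrier (hom_monoid C Z M)"
      using calculation sub by auto
    ultimately show ?case
      using H.finprod_insert[of A i F] P.finprod_insert[of A i F] insert
      by (simp add: hom_monoid_def)
  qed
qed

text \<open>Precomposition is a homomorphism between the two monoids. That units go to units follows
  from \<open>Comp_zero\<close>, and this also settles infinite \<open>A\<close>, where
  \<open>finprod\<close> returns the unit.\<close>

lemma Comp_finprod:
  assumes M: "tcm M" and e: "rid Z e" and w: "w \<in> Hom C W Z"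
    and F: "F \<in> A \<rightarrow> mpt Z e M"
  shows "w \<Zsemi> finprod (pt_monoid Z e M) F A = finprod (pt_monoid W (Rst C (w \<Zsemi> e)) M) (\<lambda>i. w \<Zsemi> F i) A"
proof -
  have w': "w \<in> Arr C" "Dom C w = W" "Cod C w = Z" using w by (auto simp: Hom_def)
  have e': "e \<in> Arr C" "Dom C e = Z" "Cod C e = Z" using e by (auto simp: rid_def)
  have r: "rid W (Rst C (w \<Zsemi> e))" using w' e' by (simp add: rid_def)
  interpret P: comm_monoid "pt_monoid Z e M" by (rule comm_monoid_pt[OF M e])
  interpret Q: comm_monoid "pt_monoid W (Rst C (w \<Zsemi> e)) M" by (rule comm_monoid_pt[OF M r])
  have pt: "w \<Zsemi> F i \<in> mpt W (Rst C (w \<Zsemi> e)) M" if "i \<in> A" for i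
    using pt_pull[OF _ w] F that by blast
  have Zo: "Z \<in> Obj C" using e by (auto simp: rid_def)
  have one: "w \<Zsemi> (e \<Zsemi> zero M Z) = Rst C (w \<Zsemi> e) \<Zsemi> zero M W"
    using Comp_zero[OF M, of "w \<Zsemi> e" W Z] w' e' M Zo by (simp add: Hom_def assoc)
  show ?thesis
    using F pt
  proof (induction A rule: infinite_finite_induct)
    case (insert i A)
    then have "F i \<in> carrier (pt_monoid Z e M)" "F \<in> A \<rightarrow> carrier (pt_monoid Z e M)" by auto
    moreover have "w \<Zsemi> F i \<in> carrier (pt_monoid W (Rst C (w \<Zsemi> e)) M)"
      "(\<lambda>i. w \<Zsemi> F i) \<in> A \<rightarrow> carrier (pt_monoid W (Rst C (w \<Zsemi> e)) M)" using insert.prems by auto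
    moreover have "F i \<in> Hom C Z (cobj M)" "finprod (pt_monoid Z e M) F A \<in> Hom C Z (cobj M)"
      using calculation P.finprod_closed[of F A] by (auto simp: pt_def)
    ultimately show ?case
      using insert P.finprod_insert[of A i F] Q.finprod_insert[of A i "\<lambda>i. w \<Zsemi> F i"]
        Comp_add[OF M w] by simp
  qed (use one in auto)
qed

subsection \<open>Maps of the Faa di Bruno category evaluated at generalised elements\<close>

text \<open>Families on an initial segment replace lists, so that substitution becomes function
  update and permuting becomes composition.\<close>

definition tp :: "(nat \<Rightarrow> 'm) \<Rightarrow> nat \<Rightarrow> 'm \<Rightarrow> 'm" where
  "tp a n x = tuple C (map a [0..<n]) x"

text \<open>The working form of \<open>faa_Hom\<close>: additivity and symmetry are tested on points
  of one common restriction \<open>e\<close> only. The zero clause names the restriction of the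
  value outright, namely that of \<open>x \<Zsemi> f 0\<close>, so a zero argument yields the unit
  of the corresponding \<open>pt_monoid\<close>.\<close>

definition faa_map :: "('o, 'm) cmon \<Rightarrow> 'o \<Rightarrow> ('o, 'm) cmon \<Rightarrow> 'o \<Rightarrow> (nat \<Rightarrow> 'm) \<Rightarrow> bool" where
  "faa_map M X N Y f \<longleftrightarrow> tcm M \<and> tcm N \<and> f 0 \<in> Hom C X Y \<and>
     (\<forall>n\<ge>1. f n \<in> Hom C (npow C (cobj M) X n) (cobj N) \<and>
        Rst C (f n) = Rst C (proj C (cobj M) X n n \<Zsemi> f 0) \<and>
        (\<forall>Z e x a. x \<in> pt Z e X \<longrightarrow> a \<in> {..<n} \<rightarrow> mpt Z e M \<longrightarrow>
          (\<forall>i<n. \<forall>u\<in>mpt Z e M. \<forall>v\<in>mpt Z e M.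
             tp (a(i := add M u v)) n x \<Zsemi> f n = add N (tp (a(i := u)) n x \<Zsemi> f n) (tp (a(i := v)) n x \<Zsemi> f n)) \<and>
          (\<forall>i<n. tp (a(i := e \<Zsemi> zero M Z)) n x \<Zsemi> f n = Rst C (x \<Zsemi> f 0) \<Zsemi> zero N Z) \<and>
          (\<forall>p. p permutes {..<n} \<longrightarrow> tp (a \<circ> p) n x \<Zsemi> f n = tp a n x \<Zsemi> f n)))"

lemma faa_map_simps:
  assumes "faa_map M X N Y f"
  shows "tcm M" "tcm N" "f 0 \<in> Hom C X Y" "f 0 \<in> Arr C" "Dom C (f 0) = X" "Cod C (f 0) = Y"
    "X \<in> Obj C" "Y \<in> Obj C" "cobj M \<in> Obj C" "cobj N \<in> Obj C"
  using assms by (auto simp: faa_map_def Hom_def)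

lemma faa_map_comp_simps:
  assumes "faa_map M X N Y f" "n \<ge> 1"
  shows "f n \<in> Hom C (npow C (cobj M) X n) (cobj N)" "f n \<in> Arr C"
    "Dom C (f n) = npow C (cobj M) X n" "Cod C (f n) = cobj N"
    "Rst C (f n) = Rst C (proj C (cobj M) X n n \<Zsemi> f 0)"
  using assms by (auto simp: faa_map_def Hom_def)

text \<open>Both sides are the identity cut down to the domain \<open>?e\<close> of
  \<open>?p \<Zsemi> h\<close>. By R4 the last entry is \<open>?e \<Zsemi> ?p\<close>, so the tuple
  is defined only inside \<open>?e\<close>; restricting it to \<open>?e\<close> changes nothing and
  turns it into the restricted tuple of projections.\<close>

lemma tuple_restricted:
  assumes "A \<in> Obj C" "X \<in> Obj C" "h \<in> Hom C X Y"
  shows "tuple C (map (proj C A X n) [0..<n]) (proj C A X n n \<Zsemi> Rst C h) = Rst C (proj C A X n n \<Zsemi> h)"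
proof -
  let ?P = "npow C A X n" and ?p = "proj C A X n n"
  let ?e = "Rst C (?p \<Zsemi> h)" and ?t = "tuple C (map (proj C A X n) [0..<n])"
  have h: "h \<in> Arr C" "Dom C h = X" using assms by (auto simp: Hom_def)
  have p: "?p \<in> Arr C" "Dom C ?p = ?P" "Cod C ?p = X" using assms by auto
  have e: "rid ?P ?e" using h p by (simp add: rid_def)
  have e': "?e \<in> Arr C" "Dom C ?e = ?P" "Cod C ?e = ?P" using h p by auto
  have sub: "set (map (proj C A X n) [0..<n]) \<subseteq> Hom C ?P A"
    using assms by (auto simp: Hom_def)
  have ph: "?p \<Zsemi> Rst C h = ?e \<Zsemi> ?p" using Comp_Rst[OF p(1) h(1)] h p by simp
  have eph: "?e \<Zsemi> ?p \<in> Hom C ?P X" using e' p by (auto simp: Hom_def)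
  have "?e \<Zsemi> ?t ?p = ?e" using tuple_projs[OF assms(1,2)] e' by simp
  then have *: "tuple C (map (\<lambda>a. ?e \<Zsemi> a) (map (proj C A X n) [0..<n])) (?e \<Zsemi> ?p) = ?e"
    using Comp_tuple[OF rid_Hom[OF e] sub, of ?p X] p by (simp add: Hom_def)
  have "?e \<Zsemi> (?e \<Zsemi> ?p) = ?e \<Zsemi> ?p" using e' p h assoc[of ?e ?e ?p] by simp
  then have "?e \<Zsemi> ?t (?e \<Zsemi> ?p) = ?e"
    using Comp_tuple[OF rid_Hom[OF e] sub eph] * by simp
  moreover have "?e \<Zsemi> ?t (?e \<Zsemi> ?p) = ?t (?e \<Zsemi> ?p)"
  proof (rule restrict_absorb[OF e])
    show "?t (?e \<Zsemi> ?p) \<in> Arr C" "Dom C (?t (?e \<Zsemi> ?p)) = ?P"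
      using tuple_simps[OF sub eph] by auto
    have "Rst C (?e \<Zsemi> ?p) = ?e" using Rst_Rst_Comp[of "?p \<Zsemi> h" ?p] Rst_Comp_le[of ?p h] h p assms by simp
    then show "Rst C (?t (?e \<Zsemi> ?p)) \<Zsemi> ?e = Rst C (?t (?e \<Zsemi> ?p))"
      using tuple_le(2)[OF sub eph] by simp
  qed
  ultimately show ?thesis using ph by simp
qed

text \<open>The domain of \<open>k\<close> depends on the last coordinate alone, and projecting the
  tuple to that coordinate returns \<open>x\<close>. So the entries of \<open>as\<close> have no
  influence on where the value is defined.\<close>

lemma tuple_Comp_proj_Comp:
  assumes "set as \<subseteq> pt Z e A" "x \<in> pt Z e X" "A \<in> Obj C" "h \<in> Hom C X Y"
    and "k \<in> Hom C (npow C A X (length as)) B"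
    and "Rst C k = Rst C (proj C A X (length as) (length as) \<Zsemi> h)"
  shows "Rst C (tuple C as x \<Zsemi> k) = Rst C (x \<Zsemi> h)"
proof -
  let ?n = "length as" and ?t = "tuple C as x"
  let ?p = "proj C A X ?n ?n"
  have X: "X \<in> Obj C" using pt_rst[OF assms(2)] by simp
  note t = pt_simps[OF tuple_pt[OF assms(1,2)]]
  have h: "h \<in> Arr C" "Dom C h = X" and k: "k \<in> Arr C" "Dom C k = npow C A X ?n"
    using assms by (auto simp: Hom_def)
  have p: "?p \<in> Arr C" "Dom C ?p = npow C A X ?n" "Cod C ?p = X" using assms(3) X by auto
  have "Rst C (?t \<Zsemi> k) = Rst C (?t \<Zsemi> Rst C (?p \<Zsemi> h))"
    using Rst_Comp_Rst[OF t(1) k(1)] t k assms(6) by simp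
  also have "\<dots> = Rst C (?t \<Zsemi> ?p \<Zsemi> h)"
    using Rst_Comp_Rst[of ?t "?p \<Zsemi> h"] t p h by (simp add: assoc)
  also have "?t \<Zsemi> ?p = x"
    using tuple_proj[OF assms(1,2), of ?n] assms(3) by simp
  finally show ?thesis .
qed

text \<open>If \<open>d\<close> is contained in the domain of the tuple, every entry is defined on
  all of \<open>d\<close>; restricted to \<open>d\<close>, the entries become points of the common
  restriction \<open>d\<close>.\<close>

lemma tuple_normalise:
  assumes "set as \<subseteq> Hom C Z A" "x \<in> Hom C Z X" "rid Z d"
    "d \<Zsemi> Rst C (tuple C as x) = d"
  shows "set (map (\<lambda>a. d \<Zsemi> a) as) \<subseteq> pt Z d A" "d \<Zsemi> x \<in> pt Z d X"
    "d \<Zsemi> tuple C as x = tuple C (map (\<lambda>a. d \<Zsemi> a) as) (d \<Zsemi> x)"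
proof -
  have le: "\<forall>a\<in>set as. d \<Zsemi> Rst C a = d" "d \<Zsemi> Rst C x = d"
    using tuple_le_iff[OF assms(3,1,2)] assms(4) by auto
  show "set (map (\<lambda>a. d \<Zsemi> a) as) \<subseteq> pt Z d A"
    using rid_pt[OF assms(3)] le assms(1) by (auto simp: Hom_def)
  show "d \<Zsemi> x \<in> pt Z d X"
    using rid_pt[OF assms(3)] le assms(2) by (auto simp: Hom_def)
  show "d \<Zsemi> tuple C as x = tuple C (map (\<lambda>a. d \<Zsemi> a) as) (d \<Zsemi> x)"
    by (rule Comp_tuple[OF rid_Hom[OF assms(3)] assms(1,2)])
qed

text \<open>
  Additivity and symmetry, stated in \<open>faa_Hom\<close> for arbitrary partial maps, only have to be tested on
  maps of a common restriction: restrict everything to the domain of definition of the tuple.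
\<close>

lemma faa_map_imp_additive:
  assumes f: "faa_map M X N Y f" and n: "n \<ge> 1"
  shows "additive C M X N n (f n)"
  unfolding additive_def
proof (intro allI impI ballI conjI)
  note s = faa_map_simps[OF f] faa_map_comp_simps[OF f n]
  fix i Z as x assume i: "i < n" and Z: "Z \<in> Obj C"
    and "length as = n \<and> set as \<subseteq> Hom C Z (cobj M) \<and> x \<in> Hom C Z X"
  then have as: "length as = n" "set as \<subseteq> Hom C Z (cobj M)" and x: "x \<in> Hom C Z X" by auto
  have upd: "set (as[i := u]) \<subseteq> Hom C Z (cobj M)" "length (as[i := u]) = n"
    if "u \<in> Hom C Z (cobj M)" for u
    using as that set_update_subset_insert[of as i u] by auto
  have mem: "u \<in> set (as[i := u])" for u
    using i as by (simp add: set_update_memI)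
  have ok: "x' \<in> pt Z e X \<Longrightarrow> a \<in> {..<n} \<rightarrow> mpt Z e M \<Longrightarrow>
      (\<forall>u\<in>mpt Z e M. \<forall>v\<in>mpt Z e M.
             tp (a(i := add M u v)) n x' \<Zsemi> f n = add N (tp (a(i := u)) n x' \<Zsemi> f n) (tp (a(i := v)) n x' \<Zsemi> f n)) \<and>
      tp (a(i := e \<Zsemi> zero M Z)) n x' \<Zsemi> f n = Rst C (x' \<Zsemi> f 0) \<Zsemi> zero N Z" for a x' e
    using f n i unfolding faa_map_def by blast
  have tupd: "tuple C (map (\<lambda>a. d \<Zsemi> a) (as[i := u])) (d \<Zsemi> x) = tp ((\<lambda>j. d \<Zsemi> as ! j)(i := d \<Zsemi> u)) n (d \<Zsemi> x)" for d u
  proof -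
    have "map (\<lambda>a. d \<Zsemi> a) (as[i := u]) = map ((\<lambda>j. d \<Zsemi> as ! j)(i := d \<Zsemi> u)) [0..<n]"
      using as i by (intro nth_equalityI) (auto simp: nth_list_update)
    then show ?thesis by (simp add: tp_def)
  qed
  have dpt: "(\<lambda>j. d \<Zsemi> as ! j)(i := d \<Zsemi> u) \<in> {..<n} \<rightarrow> mpt Z d M \<and> d \<Zsemi> x \<in> pt Z d X
      \<and> d \<Zsemi> u \<in> mpt Z d M \<and> d \<Zsemi> tuple C (as[i := u]) x = tp ((\<lambda>j. d \<Zsemi> as ! j)(i := d \<Zsemi> u)) n (d \<Zsemi> x)"
    if "rid Z d" "u \<in> Hom C Z (cobj M)" "d \<Zsemi> Rst C (tuple C (as[i := u]) x) = d" for d u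
  proof -
    note nrm = tuple_normalise[OF upd(1)[OF that(2)] x that(1,3)]
    have u': "d \<Zsemi> u \<in> mpt Z d M" using nrm(1) mem[of u] by auto
    have "d \<Zsemi> as ! j \<in> mpt Z d M" if "j < n" "j \<noteq> i" for j
    proof -
      have "as ! j \<in> set (as[i := u])"
        using that as(1) nth_mem[of j "as[i := u]"] by simp
      then show ?thesis using nrm(1) by auto
    qed
    with nrm u' tupd[of d u] show ?thesis by auto
  qed
  {
    fix a b assume a: "a \<in> Hom C Z (cobj M)" and b: "b \<in> Hom C Z (cobj M)"
    note ab = add_Hom[OF s(1) a b]
    let ?ta = "tuple C (as[i := a]) x" and ?tb = "tuple C (as[i := b]) x"
    let ?t = "tuple C (as[i := add M a b]) x"
    note ta = tuple_simps[OF upd(1)[OF a] x, unfolded upd(2)[OF a]]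
      and tb = tuple_simps[OF upd(1)[OF b] x, unfolded upd(2)[OF b]]
      and t = tuple_simps[OF upd(1)[OF ab] x, unfolded upd(2)[OF ab]]
    have a': "a \<in> Arr C" "Dom C a = Z" and b': "b \<in> Arr C" "Dom C b = Z"
      using a b by (auto simp: Hom_def)
    have Rab: "Rst C (add M a b) = Rst C a \<Zsemi> Rst C b" by (rule add_simps(4)[OF s(1) a b])
    \<comment> \<open>The tuple containing \<open>a + b\<close> is defined exactly where the tuples
      containing \<open>a\<close> and \<open>b\<close> both are, because the restriction of a sum is
      the meet of the two restrictions.\<close>
    have le: "d \<Zsemi> Rst C ?t = d \<longleftrightarrow> d \<Zsemi> Rst C ?ta = d \<and> d \<Zsemi> Rst C ?tb = d" if d: "rid Z d" for d
    proof -
      have "d \<Zsemi> Rst C (tuple C (as[i := u]) x) = d \<longleftrightarrow>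
          (\<forall>j<n. j \<noteq> i \<longrightarrow> d \<Zsemi> Rst C (as ! j) = d) \<and> d \<Zsemi> Rst C u = d \<and> d \<Zsemi> Rst C x = d"
        if u: "u \<in> Hom C Z (cobj M)" for u
      proof -
        have "(\<forall>c\<in>set (as[i := u]). d \<Zsemi> Rst C c = d) \<longleftrightarrow> (\<forall>j<n. d \<Zsemi> Rst C (as[i := u] ! j) = d)"
          using as(1) by (simp add: all_set_conv_all_nth)
        also have "\<dots> \<longleftrightarrow> (\<forall>j<n. j \<noteq> i \<longrightarrow> d \<Zsemi> Rst C (as ! j) = d) \<and> d \<Zsemi> Rst C u = d"
          using as(1) i by (auto simp: nth_list_update)
        finally show ?thesis using tuple_le_iff[OF d upd(1)[OF u] x] by auto
      qed
      then show ?thesis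
        using a b ab rid_meet_iff[OF d a'(1) b'(1) a'(2) b'(2)] unfolding Rab[symmetric] by auto
    qed
    let ?d = "Rst C ?t"
    have d: "rid Z ?d" using rid_Rst[OF t(1)] t by simp
    have dt: "?d \<Zsemi> ?t = ?t" using t by simp
    have dd: "?d \<Zsemi> ?d = ?d" using t by simp
    with le[OF d] have dab: "?d \<Zsemi> Rst C ?ta = ?d" "?d \<Zsemi> Rst C ?tb = ?d" by auto
    let ?da = "\<lambda>j. ?d \<Zsemi> as ! j" and ?dx = "?d \<Zsemi> x"
    note pab = dpt[OF d ab dd] and pa = dpt[OF d a dab(1)] and pb = dpt[OF d b dab(2)]
    have tf: "?ta \<Zsemi> f n \<in> Hom C Z (cobj N)" "?tb \<Zsemi> f n \<in> Hom C Z (cobj N)"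
      using ta tb s by (auto simp: Hom_def)
    have dtf: "?d \<Zsemi> (?ta \<Zsemi> f n) = (?d \<Zsemi> ?ta) \<Zsemi> f n" "?d \<Zsemi> (?tb \<Zsemi> f n) = (?d \<Zsemi> ?tb) \<Zsemi> f n"
      using ta tb s t by (auto simp: assoc)
    have dadd: "?d \<Zsemi> add M a b = add M (?d \<Zsemi> a) (?d \<Zsemi> b)"
      by (rule Comp_add[OF s(1) rid_Hom[OF d] a b])
    have "?t \<Zsemi> f n = (?d \<Zsemi> ?t) \<Zsemi> f n" using dt by simp
    also have "\<dots> = tp (?da(i := add M (?d \<Zsemi> a) (?d \<Zsemi> b))) n (?dx) \<Zsemi> f n"
      using pab dadd by simp
    \<comment> \<open>Slot \<open>i\<close> is overwritten first by a point, because the old entry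
      \<open>as ! i\<close> need not be defined on \<open>?d\<close>, while the clause of
      \<open>faa_map\<close> asks for a family of points.\<close>
    also have "\<dots> = tp (?da(i := ?d \<Zsemi> a, i := add M (?d \<Zsemi> a) (?d \<Zsemi> b))) n (?dx) \<Zsemi> f n"
      by simp
    also have "\<dots> = add N (tp (?da(i := ?d \<Zsemi> a, i := ?d \<Zsemi> a)) n (?dx) \<Zsemi> f n)
        (tp (?da(i := ?d \<Zsemi> a, i := ?d \<Zsemi> b)) n (?dx) \<Zsemi> f n)"
      using ok[of "?dx" ?d "?da(i := ?d \<Zsemi> a)"] pa pb by blast
    also have "\<dots> = add N (?d \<Zsemi> (?ta \<Zsemi> f n)) (?d \<Zsemi> (?tb \<Zsemi> f n))"
      using pa pb dtf by simp
    also have "\<dots> = ?d \<Zsemi> add N (?ta \<Zsemi> f n) (?tb \<Zsemi> f n)"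
      by (rule Comp_add[OF s(2) rid_Hom[OF d] tf, symmetric])
    also have "\<dots> = add N (?ta \<Zsemi> f n) (?tb \<Zsemi> f n)"
    \<comment> \<open>The sum is defined only where both summands are, hence only where both tuples
      are, and by \<open>le\<close> this lies inside \<open>?d\<close>.\<close>
    proof (rule restrict_absorb[OF d])
      let ?r = "Rst C (add N (?ta \<Zsemi> f n) (?tb \<Zsemi> f n))"
      show S: "add N (?ta \<Zsemi> f n) (?tb \<Zsemi> f n) \<in> Arr C" "Dom C (add N (?ta \<Zsemi> f n) (?tb \<Zsemi> f n)) = Z"
        using add_simps[OF s(2) tf] by auto
      have r: "rid Z ?r" using rid_Rst[OF S(1)] S by simp
      have "?r \<Zsemi> (Rst C (?ta \<Zsemi> f n) \<Zsemi> Rst C (?tb \<Zsemi> f n)) = ?r"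
        by (simp only: add_simps(4)[OF s(2) tf, symmetric] rid_idem[OF r])
      then have *: "?r \<Zsemi> Rst C (?ta \<Zsemi> f n) = ?r" "?r \<Zsemi> Rst C (?tb \<Zsemi> f n) = ?r"
        using rid_meet_iff[OF r, of "?ta \<Zsemi> f n" "?tb \<Zsemi> f n"] ta tb s by auto
      have le1: "?r \<Zsemi> Rst C k = ?r" if "?r \<Zsemi> Rst C (k \<Zsemi> g) = ?r" "k \<in> Arr C" "g \<in> Arr C" "Cod C k = Dom C g" "Dom C k = Z" for k g
      proof -
        have "?r \<Zsemi> Rst C k = ?r \<Zsemi> Rst C (k \<Zsemi> g) \<Zsemi> Rst C k" using that(1) by simp
        also have "\<dots> = ?r \<Zsemi> Rst C (k \<Zsemi> g)"
          using that r Rst_Comp_le(2)[of k g] by (subst assoc) (auto simp: rid_def)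
        finally show ?thesis using that by simp
      qed
      have "?r \<Zsemi> Rst C ?ta = ?r" "?r \<Zsemi> Rst C ?tb = ?r"
        using le1[OF *(1)] le1[OF *(2)] ta tb s by auto
      then show "?r \<Zsemi> ?d = ?r" using le[OF r] by simp
    qed
    finally show "?t \<Zsemi> f n = add N (?ta \<Zsemi> f n) (?tb \<Zsemi> f n)" .
  next
    have z: "zero M Z \<in> Hom C Z (cobj M)" by (rule zero_Hom[OF s(1) Z])
    let ?t = "tuple C (as[i := zero M Z]) x"
    let ?d = "Rst C ?t"
    note t = tuple_simps[OF upd(1)[OF z] x, unfolded upd(2)[OF z]]
    have d: "rid Z ?d" using rid_Rst[OF t(1)] t by simp
    note p = dpt[OF d z Rst_idem[OF t(1)]]
    have x': "x \<in> Arr C" "Dom C x = Z" "Cod C x = X" using x by (auto simp: Hom_def)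
    have "?t \<Zsemi> f n = (?d \<Zsemi> ?t) \<Zsemi> f n" using t by simp
    also have "\<dots> = tp ((\<lambda>j. ?d \<Zsemi> as ! j)(i := ?d \<Zsemi> zero M Z, i := ?d \<Zsemi> zero M Z)) n (?d \<Zsemi> x) \<Zsemi> f n"
      using p by simp
    also have "\<dots> = Rst C (?d \<Zsemi> x \<Zsemi> f 0) \<Zsemi> zero N Z"
      using ok[of "?d \<Zsemi> x" ?d "(\<lambda>j. ?d \<Zsemi> as ! j)(i := ?d \<Zsemi> zero M Z)"] p by blast
    finally have tf: "?t \<Zsemi> f n = Rst C (?d \<Zsemi> x \<Zsemi> f 0) \<Zsemi> zero N Z" .
    have "Rst C (?t \<Zsemi> f n) = Rst C (?d \<Zsemi> x \<Zsemi> f 0)"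
      unfolding tf using t x' s Z by (subst Rst_Rst_Comp) auto
    then show "?t \<Zsemi> f n = Rst C (?t \<Zsemi> f n) \<Zsemi> zero N Z" using tf by simp
  }
qed

text \<open>Both tuples have the same set of entries and hence the same domain \<open>?d\<close>.
  Restricted to it, the entries are points of a common restriction and the symmetry clause of
  \<open>faa_map\<close> applies.\<close>

lemma faa_map_imp_symmetric:
  assumes f: "faa_map M X N Y f" and n: "n \<ge> 1"
  shows "symmetric C M X n (f n)"
  unfolding symmetric_def
proof (intro allI impI ballI)
  fix p Z as x assume p: "p permutes {..<n}" and Z: "Z \<in> Obj C"
    and "length as = n \<and> set as \<subseteq> Hom C Z (cobj M) \<and> x \<in> Hom C Z X"
  then have as: "length as = n" "set as \<subseteq> Hom C Z (cobj M)" and x: "x \<in> Hom C Z X" by auto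
  have p': "p permutes {..<length as}" using p as by simp
  have set: "set (permute_list p as) = set as" by (rule set_permute_list[OF p'])
  then have sub: "set (permute_list p as) \<subseteq> Hom C Z (cobj M)" "length (permute_list p as) = n"
    using as by auto
  let ?t = "tuple C as x" and ?u = "tuple C (permute_list p as) x"
  let ?d = "Rst C ?t"
  note t = tuple_simps[OF as(2) x, unfolded as(1)] and u = tuple_simps[OF sub(1) x, unfolded sub(2)]
  have d: "rid Z ?d" and r: "rid Z (Rst C ?u)" using rid_Rst t u by metis+
  have du: "?d \<Zsemi> Rst C ?u = ?d"
    using tuple_le_iff[OF d sub(1) x] tuple_le_iff[OF d as(2) x] set t by simp
  have ud: "Rst C ?u \<Zsemi> ?d = Rst C ?u"
    using tuple_le_iff[OF r sub(1) x] tuple_le_iff[OF r as(2) x] set u by simp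
  note nrm = tuple_normalise[OF as(2) x d Rst_idem[OF t(1)]]
  have a: "map (\<lambda>a. ?d \<Zsemi> a) as = map (\<lambda>j. ?d \<Zsemi> as ! j) [0..<n]"
    using map_as_upt[of "\<lambda>a. ?d \<Zsemi> a" as] as by simp
  have "?u = ?d \<Zsemi> ?u" using restrict_absorb[OF d u(1,2) ud] by simp
  also have "\<dots> = tuple C (map (\<lambda>a. ?d \<Zsemi> a) (permute_list p as)) (?d \<Zsemi> x)"
    by (rule tuple_normalise(3)[OF sub(1) x d du])
  also have "map (\<lambda>a. ?d \<Zsemi> a) (permute_list p as) = map ((\<lambda>j. ?d \<Zsemi> as ! j) \<circ> p) [0..<n]"
    unfolding permute_list_map[OF p', symmetric] a by (rule permute_list_map_upt[OF p])
  finally have "?u \<Zsemi> f n = tp ((\<lambda>j. ?d \<Zsemi> as ! j) \<circ> p) n (?d \<Zsemi> x) \<Zsemi> f n"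
    by (simp add: tp_def)
  also have "\<dots> = tp (\<lambda>j. ?d \<Zsemi> as ! j) n (?d \<Zsemi> x) \<Zsemi> f n"
  proof -
    have "(\<lambda>j. ?d \<Zsemi> as ! j) \<in> {..<n} \<rightarrow> mpt Z ?d M" using nrm(1) as by auto
    then show ?thesis using f n p nrm(2) unfolding faa_map_def by blast
  qed
  also have "tp (\<lambda>j. ?d \<Zsemi> as ! j) n (?d \<Zsemi> x) = ?d \<Zsemi> ?t"
    using nrm(3) a by (simp add: tp_def)
  finally show "?u \<Zsemi> f n = ?t \<Zsemi> f n" using t by simp
qed

lemma faa_Hom_iff:
  assumes "total_comm_monoid C M" "total_comm_monoid C N"
  shows "f \<in> faa_Hom C (M, X) (N, Y) \<longleftrightarrow> faa_map M X N Y f"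
proof
  assume f: "faa_map M X N Y f"
  note s = faa_map_simps[OF f]
  have "Rst C (f n) = tuple C (map (proj C (cobj M) X n) [0..<n]) (proj C (cobj M) X n n \<Zsemi> Rst C (f 0))"
    if "n \<ge> 1" for n
    using faa_map_comp_simps(5)[OF f that] tuple_restricted[OF s(9,7,3)] by simp
  then show "f \<in> faa_Hom C (M, X) (N, Y)"
    using s(3) faa_map_comp_simps(1,5)[OF f] faa_map_imp_additive[OF f] faa_map_imp_symmetric[OF f]
    unfolding faa_Hom_def Let_def by simp
next
  assume "f \<in> faa_Hom C (M, X) (N, Y)"
  then have f0: "f 0 \<in> Hom C X Y" and f: "\<And>n. n \<ge> 1 \<Longrightarrow> f n \<in> Hom C (npow C (cobj M) X n) (cobj N) \<and>
             Rst C (f n) = Rst C (proj C (cobj M) X n n \<Zsemi> f 0) \<and>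
             additive C M X N n (f n) \<and> symmetric C M X n (f n)"
    unfolding faa_Hom_def Let_def by auto
  note O = tcm_simps(1)[OF assms(1)]
  show "faa_map M X N Y f"
    unfolding faa_map_def
  proof (intro conjI allI impI ballI)
    fix n :: nat assume n: "n \<ge> 1"
    then show "f n \<in> Hom C (npow C (cobj M) X n) (cobj N)"
        "Rst C (f n) = Rst C (proj C (cobj M) X n n \<Zsemi> f 0)" using f by auto
    note fn = this
    fix Z e x a assume x: "x \<in> pt Z e X" and a: "a \<in> {..<n} \<rightarrow> mpt Z e M"
    let ?as = "map a [0..<n]"
    have hx: "x \<in> Hom C Z X" and Z: "Z \<in> Obj C" and e: "rid Z e"
      using x pt_rst[OF x] pt_rid[OF x] by (auto simp: pt_def)
    have as: "set ?as \<subseteq> mpt Z e M" "set ?as \<subseteq> Hom C Z (cobj M)" "length ?as = n"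
      using a by (auto simp: pt_def)
    {
      fix i u v assume i: "i < n" and u: "u \<in> mpt Z e M" and v: "v \<in> mpt Z e M"
      then have "u \<in> Hom C Z (cobj M)" "v \<in> Hom C Z (cobj M)" by (auto simp: pt_def)
      then show "tp (a(i := add M u v)) n x \<Zsemi> f n = add N (tp (a(i := u)) n x \<Zsemi> f n) (tp (a(i := v)) n x \<Zsemi> f n)"
        using f[OF n] i hx Z as(2,3) unfolding additive_def tp_def list_update_map_upt[OF i, symmetric] by blast
    next
      fix i assume i: "i < n"
      have z: "zero M Z \<in> Hom C Z (cobj M)" by (rule zero_Hom[OF assms(1) Z])
      let ?as' = "?as[i := zero M Z]"
      have as': "set ?as' \<subseteq> Hom C Z (cobj M)"
        by (rule subset_trans[OF set_update_subset_insert]) (use as z in auto)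
      have as'': "length ?as' = n" by simp
      have ea: "e \<Zsemi> Rst C (a j) = e \<and> e \<Zsemi> a j = a j" if "j < n" for j
        using a that pt_rst pt_simps by (metis funcset_mem lessThan_iff)
      have ex: "e \<Zsemi> Rst C x = e" "e \<Zsemi> x = x" using pt_rst[OF x] pt_simps[OF x] by auto
      let ?t = "tuple C ?as' x"
      note t = tuple_simps[OF as' hx, unfolded as'']
      \<comment> \<open>The last entry \<open>x\<close> already has restriction \<open>e\<close>, so
        the tuple with the total zero in slot \<open>i\<close> is the same as the tuple with the
        zero cut down to \<open>e\<close>.\<close>
      have "Rst C ?t \<Zsemi> e = Rst C ?t" using tuple_le(2)[OF as' hx] pt_simps[OF x] by simp
      then have "?t = e \<Zsemi> ?t" using restrict_absorb[OF e t(1,2)] by simp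
      also have "\<dots> = tuple C (map (\<lambda>a. e \<Zsemi> a) ?as') (e \<Zsemi> x)"
        by (rule Comp_tuple[OF rid_Hom[OF e] as' hx])
      also have "map (\<lambda>a. e \<Zsemi> a) ?as' = map (a(i := e \<Zsemi> zero M Z)) [0..<n]"
        using i ea by (intro nth_equalityI) (auto simp: nth_list_update)
      finally have t': "?t = tp (a(i := e \<Zsemi> zero M Z)) n x" using ex by (simp add: tp_def)
      have a': "set (map (a(i := e \<Zsemi> zero M Z)) [0..<n]) \<subseteq> mpt Z e M"
        using a rid_zero_pt[OF assms(1) e] by auto
      have "?t \<Zsemi> f n = Rst C (?t \<Zsemi> f n) \<Zsemi> zero N Z"
        using f[OF n] i hx Z as(2,3) unfolding additive_def by blast
      moreover have "Rst C (?t \<Zsemi> f n) = Rst C (x \<Zsemi> f 0)"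
        unfolding t' tp_def using tuple_Comp_proj_Comp[OF a' x O f0, of "f n" "cobj N"] fn by simp
      ultimately show "tp (a(i := e \<Zsemi> zero M Z)) n x \<Zsemi> f n = Rst C (x \<Zsemi> f 0) \<Zsemi> zero N Z"
        using t' by simp
    next
      fix p assume p: "p permutes {..<n}"
      then show "tp (a \<circ> p) n x \<Zsemi> f n = tp a n x \<Zsemi> f n"
        using f[OF n] hx Z as(2,3) unfolding symmetric_def tp_def permute_list_map_upt[OF p, symmetric] by blast
    }
  qed (use assms f0 in auto)
qed

text \<open>
  The value of \<open>f\<^sub>n\<close> at a family indexed by an arbitrary finite set of \<open>n\<close> elements; by symmetry
  the enumeration is irrelevant.
\<close>

definition ev :: "(nat \<Rightarrow> 'm) \<Rightarrow> 'i set \<Rightarrow> ('i \<Rightarrow> 'm) \<Rightarrow> 'm \<Rightarrow> 'm" where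
  "ev f I a x = tuple C (map a (SOME l. distinct l \<and> set l = I)) x \<Zsemi> f (card I)"

lemma some_enum:
  assumes "finite I"
  shows "distinct (SOME l. distinct l \<and> set l = I)" "set (SOME l. distinct l \<and> set l = I) = I"
    "length (SOME l. distinct l \<and> set l = I) = card I"
proof -
  have "distinct (SOME l. distinct l \<and> set l = I) \<and> set (SOME l. distinct l \<and> set l = I) = I"
    using finite_distinct_list[OF assms] by (rule_tac someI_ex) auto
  then show "distinct (SOME l. distinct l \<and> set l = I)" "set (SOME l. distinct l \<and> set l = I) = I"
    by auto
  then show "length (SOME l. distinct l \<and> set l = I) = card I"
    using distinct_card by metis
qed

lemma ev_cong: "\<lbrakk>finite I; \<And>i. i \<in> I \<Longrightarrow> a i = b i\<rbrakk> \<Longrightarrow> ev f I a x = ev f I b x"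
  unfolding ev_def using some_enum(2)[of I] by (metis (mono_tags, lifting) map_eq_conv)

lemma map_pt: "\<lbrakk>set l = I; a \<in> I \<rightarrow> P\<rbrakk> \<Longrightarrow> set (map a l) \<subseteq> P"
  by auto

text \<open>Two duplicate-free enumerations of \<open>I\<close> differ by a permutation, which the
  symmetry of the component absorbs.\<close>

lemma ev_list:
  assumes f: "faa_map M X N Y f" and x: "x \<in> pt Z e X" and l: "distinct l" "set l = I" "l \<noteq> []"
    and a: "a \<in> I \<rightarrow> mpt Z e M"
  shows "ev f I a x = tuple C (map a l) x \<Zsemi> f (length l)"
proof -
  define l' where "l' = (SOME l. distinct l \<and> set l = I)"
  have l': "distinct l'" "set l' = I" "length l' = card I"
    using some_enum[of I] l unfolding l'_def by auto
  have "mset l = mset l'" using l l' set_eq_iff_mset_eq_distinct by blast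
  then obtain p where p: "p permutes {..<length l'}" "permute_list p l' = l"
    by (rule mset_eq_permutation)
  have len: "length l = length l'" using p(2) by auto
  let ?n = "length l'"
  let ?a = "\<lambda>i. a (l' ! i)"
  have "map a l = permute_list p (map a l')"
    using p permute_list_map[of p l' a] by simp
  also have "\<dots> = map (?a \<circ> p) [0..<?n]"
    unfolding map_as_upt[of a l'] by (rule permute_list_map_upt[OF p(1)])
  finally have "tuple C (map a l) x \<Zsemi> f (length l) = tp (?a \<circ> p) ?n x \<Zsemi> f ?n"
    by (simp add: tp_def len)
  also have "\<dots> = tp ?a ?n x \<Zsemi> f ?n"
  proof -
    have "?a \<in> {..<?n} \<rightarrow> mpt Z e M" using a l' by auto
    moreover have "?n \<ge> 1" using l(3) len by (cases l') auto
    ultimately show ?thesis using f x p(1) unfolding faa_map_def by blast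
  qed
  also have "\<dots> = ev f I a x"
    using l' map_as_upt[of a l'] by (simp add: ev_def tp_def l'_def[symmetric])
  finally show ?thesis by simp
qed

lemma ev_tp:
  assumes "faa_map M X N Y f" "x \<in> pt Z e X" "n \<ge> 1" "a \<in> {..<n} \<rightarrow> mpt Z e M"
  shows "tp a n x \<Zsemi> f n = ev f {..<n} a x"
  using ev_list[OF assms(1,2), of "[0..<n]" "{..<n}" a] assms(3,4)
  by (auto simp: tp_def lessThan_atLeast0)

lemma list_of_finite:
  assumes "finite I" "I \<noteq> {}"
  obtains l where "distinct l" "set l = I" "l \<noteq> []"
  using finite_distinct_list[OF assms(1)] assms(2) by force

text \<open>The restriction of the value involves neither \<open>I\<close> nor \<open>a\<close>, by
  \<open>tuple_Comp_proj_Comp\<close>. Values over different blocks can therefore be used together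
  as arguments of a further map at \<open>x \<Zsemi> f 0\<close>.\<close>

lemma ev_pt:
  assumes f: "faa_map M X N Y f" and x: "x \<in> pt Z e X" and I: "finite I" "I \<noteq> {}"
    and a: "a \<in> I \<rightarrow> mpt Z e M"
  shows "ev f I a x \<in> mpt Z (Rst C (x \<Zsemi> f 0)) N"
proof -
  obtain l where l: "distinct l" "set l = I" "l \<noteq> []" by (rule list_of_finite[OF I])
  let ?n = "length l"
  have n: "?n \<ge> 1" using l by (cases l) auto
  note s = faa_map_simps[OF f] faa_map_comp_simps[OF f n]
  have al: "set (map a l) \<subseteq> mpt Z e M" using map_pt[OF l(2) a] .
  have "tuple C (map a l) x \<in> pt Z e (npow C (cobj M) X ?n)"
    using tuple_pt[OF al x] by simp
  moreover have "Rst C (tuple C (map a l) x \<Zsemi> f ?n) = Rst C (x \<Zsemi> f 0)"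
    using tuple_Comp_proj_Comp[OF al x s(9,3), of "f ?n" "cobj N"] s by simp
  ultimately show ?thesis
    using pt_Comp[of _ Z e _ "f ?n" "cobj N"] s(11) ev_list[OF f x l a] by metis
qed

lemma ev_reindex:
  assumes f: "faa_map M X N Y f" and x: "x \<in> pt Z e X" and I: "finite I" "I \<noteq> {}"
    and h: "inj_on h I" and a: "a \<in> h ` I \<rightarrow> mpt Z e M"
  shows "ev f (h ` I) a x = ev f I (\<lambda>i. a (h i)) x"
proof -
  obtain l where l: "distinct l" "set l = I" "l \<noteq> []" by (rule list_of_finite[OF I])
  have "ev f (h ` I) a x = tuple C (map a (map h l)) x \<Zsemi> f (length (map h l))"
    by (rule ev_list[OF f x _ _ _ a]) (use l h in \<open>auto simp: distinct_map\<close>)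
  moreover have "ev f I (\<lambda>i. a (h i)) x = tuple C (map (\<lambda>i. a (h i)) l) x \<Zsemi> f (length l)"
    by (rule ev_list[OF f x l]) (use a in auto)
  ultimately show ?thesis by (simp add: comp_def)
qed

lemma
  assumes f: "faa_map M X N Y f" and x: "x \<in> pt Z e X" and I: "finite I" "i \<in> I"
    and a: "a \<in> I \<rightarrow> mpt Z e M"
  shows ev_add: "\<lbrakk>u \<in> mpt Z e M; v \<in> mpt Z e M\<rbrakk> \<Longrightarrow>
      ev f I (a(i := add M u v)) x = add N (ev f I (a(i := u)) x) (ev f I (a(i := v)) x)"
    and ev_zero: "ev f I (a(i := e \<Zsemi> zero M Z)) x = Rst C (x \<Zsemi> f 0) \<Zsemi> zero N Z"
proof -
  have "I \<noteq> {}" using I by auto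
  then obtain l where l: "distinct l" "set l = I" "l \<noteq> []" by (rule list_of_finite[OF I(1)])
  obtain k where k: "k < length l" "l ! k = i" using I l by (metis in_set_conv_nth)
  let ?n = "length l"
  let ?a = "\<lambda>j. a (l ! j)"
  note s = faa_map_simps[OF f]
  have n: "?n \<ge> 1" using l by (cases l) auto
  have eq: "ev f I (a(i := u)) x = tp (?a(k := u)) ?n x \<Zsemi> f ?n" if "u \<in> mpt Z e M" for u
  proof -
    have "ev f I (a(i := u)) x = tuple C (map (a(i := u)) l) x \<Zsemi> f ?n"
      by (rule ev_list[OF f x l]) (use a that in auto)
    also have "map (a(i := u)) l = map (?a(k := u)) [0..<?n]"
      unfolding map_as_upt[of "a(i := u)"]
      by (rule map_cong) (use fun_upd_nth[OF l(1) k(1)] k(2) in \<open>auto simp del: fun_upd_apply\<close>)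
    finally show ?thesis by (simp only: tp_def)
  qed
  have a': "?a \<in> {..<?n} \<rightarrow> mpt Z e M" using a l by auto
  have z: "e \<Zsemi> zero M Z \<in> mpt Z e M" using rid_zero_pt[OF s(1) pt_rid[OF x]] .
  show "ev f I (a(i := e \<Zsemi> zero M Z)) x = Rst C (x \<Zsemi> f 0) \<Zsemi> zero N Z"
    unfolding eq[OF z] using f x a' k(1) n unfolding faa_map_def by blast
  assume u: "u \<in> mpt Z e M" and v: "v \<in> mpt Z e M"
  show "ev f I (a(i := add M u v)) x = add N (ev f I (a(i := u)) x) (ev f I (a(i := v)) x)"
    unfolding eq[OF u] eq[OF v] eq[OF add_pt[OF s(1) u v]]
    using f x a' k(1) n u v unfolding faa_map_def by blast
qed

lemma Comp_ev:
  assumes f: "faa_map M X N Y f" and x: "x \<in> pt Z e X" and I: "finite I" "I \<noteq> {}"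
    and a: "a \<in> I \<rightarrow> mpt Z e M" and w: "w \<in> Hom C W Z"
  shows "w \<Zsemi> ev f I a x = ev f I (\<lambda>i. w \<Zsemi> a i) (w \<Zsemi> x)"
proof -
  obtain l where l: "distinct l" "set l = I" "l \<noteq> []" by (rule list_of_finite[OF I])
  let ?n = "length l"
  have n: "?n \<ge> 1" using l by (cases l) auto
  note s = faa_map_simps[OF f] faa_map_comp_simps[OF f n]
  have al: "set (map a l) \<subseteq> mpt Z e M" using map_pt[OF l(2) a] .
  have w': "w \<in> Arr C" "Cod C w = Z" using w by (auto simp: Hom_def)
  have t: "tuple C (map a l) x \<in> pt Z e (npow C (cobj M) X ?n)"
    using tuple_pt[OF al x] by simp
  have "w \<Zsemi> ev f I a x = w \<Zsemi> tuple C (map a l) x \<Zsemi> f ?n"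
    unfolding ev_list[OF f x l a] using pt_simps[OF t] w' s by (subst assoc) auto
  also have "w \<Zsemi> tuple C (map a l) x = tuple C (map (\<lambda>i. w \<Zsemi> a i) l) (w \<Zsemi> x)"
    using Comp_tuple[OF w, of "map a l" "cobj M" x X] al x by (auto simp: pt_def comp_def)
  also have "\<dots> \<Zsemi> f ?n = ev f I (\<lambda>i. w \<Zsemi> a i) (w \<Zsemi> x)"
    by (rule ev_list[OF f pt_pull[OF x w] l, symmetric]) (use a pt_pull[OF _ w] in auto)
  finally show ?thesis .
qed

lemma projs_pt:
  assumes "A \<in> Obj C" "X \<in> Obj C"
  shows "proj C A X n n \<in> pt (npow C A X n) (Id C (npow C A X n)) X"
    "proj C A X n \<in> {..<n} \<rightarrow> pt (npow C A X n) (Id C (npow C A X n)) A"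
  using assms by (auto intro!: ptI)

text \<open>The projections form a generic point: their tuple is the identity, so evaluation there
  returns the component itself.\<close>

lemma faa_map_ext:
  assumes f: "faa_map M X N Y f" and g: "faa_map M X N Y g" and 0: "f 0 = g 0"
    and eq: "\<And>(n::nat) Z e a x. \<lbrakk>n \<ge> 1; x \<in> pt Z e X; a \<in> {..<n} \<rightarrow> mpt Z e M\<rbrakk>
      \<Longrightarrow> ev f {..<n} a x = ev g {..<n} a x"
  shows "f = g"
proof
  fix n
  note s = faa_map_simps[OF f]
  show "f n = g n"
  proof (cases "n \<ge> 1")
    case True
    let ?P = "npow C (cobj M) X n"
    have x: "proj C (cobj M) X n n \<in> pt ?P (Id C ?P) X"
      and a: "proj C (cobj M) X n \<in> {..<n} \<rightarrow> mpt ?P (Id C ?P) M"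
      using projs_pt s by auto
    have id: "tp (proj C (cobj M) X n) n (proj C (cobj M) X n n) = Id C ?P"
      unfolding tp_def using tuple_projs s by simp
    show ?thesis
      using ev_tp[OF f x True a] ev_tp[OF g x True a] eq[OF True x a] id
        faa_map_comp_simps[OF f True] faa_map_comp_simps[OF g True] by simp
  next
    case False
    then show ?thesis using 0 by (cases n) auto
  qed
qed

subsection \<open>Composition\<close>

abbreviation partitions :: "'i set \<Rightarrow> 'i set set set" where
  "partitions I \<equiv> {\<pi>. partition_on I \<pi>}"

text \<open>The counterpart of \<open>faa_term\<close> at any point and over any finite index set.
  The outer evaluation is indexed by the blocks themselves, so no ordering of the blocks has to be
  chosen.\<close>

definition cterm :: "(nat \<Rightarrow> 'm) \<Rightarrow> (nat \<Rightarrow> 'm) \<Rightarrow> ('i \<Rightarrow> 'm) \<Rightarrow> 'm \<Rightarrow> 'i set set \<Rightarrow> 'm" where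
  "cterm f g a x \<pi> = ev g \<pi> (\<lambda>B. ev f B a x) (x \<Zsemi> f 0)"

text \<open>The sum is formed among maps with the restriction of
  \<open>x \<Zsemi> f 0 \<Zsemi> g 0\<close>, which every summand has. There, unlike in the full
  hom-monoid, a vanishing summand is the unit.\<close>

definition csum :: "('o, 'm) cmon \<Rightarrow> (nat \<Rightarrow> 'm) \<Rightarrow> (nat \<Rightarrow> 'm) \<Rightarrow> 'o \<Rightarrow> 'i set \<Rightarrow> ('i \<Rightarrow> 'm) \<Rightarrow> 'm \<Rightarrow> 'm" where
  "csum K f g Z I a x =
     finprod (pt_monoid Z (Rst C (x \<Zsemi> f 0 \<Zsemi> g 0)) K) (cterm f g a x) (partitions I)"

lemma faa_comp_0: "faa_comp C P Q f g 0 = f 0 \<Zsemi> g 0"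
  by (simp add: faa_comp_def)

lemma partition_props:
  assumes "finite I" "I \<noteq> {}" "partition_on I \<pi>"
  shows "finite \<pi>" "\<pi> \<noteq> {}" "B \<in> \<pi> \<Longrightarrow> finite B" "B \<in> \<pi> \<Longrightarrow> B \<noteq> {}" "B \<in> \<pi> \<Longrightarrow> B \<subseteq> I"
proof -
  show "finite \<pi>" using finite_elements assms by blast
  show "\<pi> \<noteq> {}" using assms by (auto simp: partition_on_def)
  show "B \<in> \<pi> \<Longrightarrow> B \<noteq> {}" "B \<in> \<pi> \<Longrightarrow> B \<subseteq> I" using partition_on_block[OF assms(3)] by auto
  then show "B \<in> \<pi> \<Longrightarrow> finite B" using assms(1) finite_subset by blast
qed

context
  fixes M X N Y K V f g
  assumes f: "faa_map M X N Y f" and g: "faa_map N Y K V g"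
begin

lemma fg_simps: "f 0 \<Zsemi> g 0 \<in> Hom C X V" "f 0 \<Zsemi> g 0 \<in> Arr C" "Dom C (f 0 \<Zsemi> g 0) = X"
  using faa_map_simps[OF f] faa_map_simps[OF g] by (auto simp: Hom_def)

lemma pt_f0: "x \<in> pt Z e X \<Longrightarrow> x \<Zsemi> f 0 \<in> pt Z (Rst C (x \<Zsemi> f 0)) Y"
  by (rule pt_Comp) (use faa_map_simps[OF f] in auto)

lemma rid_fg: "x \<in> pt Z e X \<Longrightarrow> rid Z (Rst C (x \<Zsemi> f 0 \<Zsemi> g 0))"
  by (rule pt_rid, rule pt_Comp[OF pt_f0]) (use faa_map_simps[OF g] in auto)

lemma ev_blocks:
  assumes "x \<in> pt Z e X" "finite I" "I \<noteq> {}" "a \<in> I \<rightarrow> mpt Z e M" "partition_on I \<pi>"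
  shows "(\<lambda>B. ev f B a x) \<in> \<pi> \<rightarrow> mpt Z (Rst C (x \<Zsemi> f 0)) N"
proof
  fix B assume B: "B \<in> \<pi>"
  note p = partition_props[OF assms(2,3,5)]
  show "ev f B a x \<in> mpt Z (Rst C (x \<Zsemi> f 0)) N"
    by (rule ev_pt[OF f assms(1) p(3)[OF B] p(4)[OF B]]) (use assms(4) p(5)[OF B] in auto)
qed

lemma cterm_pt:
  assumes "x \<in> pt Z e X" "finite I" "I \<noteq> {}" "a \<in> I \<rightarrow> mpt Z e M" "partition_on I \<pi>"
  shows "cterm f g a x \<pi> \<in> mpt Z (Rst C (x \<Zsemi> f 0 \<Zsemi> g 0)) K"
  unfolding cterm_def
  by (rule ev_pt[OF g pt_f0[OF assms(1)] partition_props(1,2)[OF assms(2,3,5)] ev_blocks[OF assms]])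

lemma cterm_Pi:
  assumes "x \<in> pt Z e X" "finite I" "I \<noteq> {}" "a \<in> I \<rightarrow> mpt Z e M"
  shows "cterm f g a x \<in> (partitions I) \<rightarrow> mpt Z (Rst C (x \<Zsemi> f 0 \<Zsemi> g 0)) K"
  using cterm_pt[OF assms] by auto

lemma comm_monoid_fg: "x \<in> pt Z e X \<Longrightarrow> comm_monoid (pt_monoid Z (Rst C (x \<Zsemi> f 0 \<Zsemi> g 0)) K)"
  by (rule comm_monoid_pt[OF faa_map_simps(2)[OF g] rid_fg])

lemma csum_pt:
  assumes "x \<in> pt Z e X" "finite I" "I \<noteq> {}" "a \<in> I \<rightarrow> mpt Z e M"
  shows "csum K f g Z I a x \<in> mpt Z (Rst C (x \<Zsemi> f 0 \<Zsemi> g 0)) K"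
proof -
  interpret comm_monoid "pt_monoid Z (Rst C (x \<Zsemi> f 0 \<Zsemi> g 0)) K"
    by (rule comm_monoid_fg[OF assms(1)])
  show ?thesis unfolding csum_def using finprod_closed[of "cterm f g a x"] cterm_Pi[OF assms] by simp
qed

lemma cterm_cong:
  assumes "finite I" "I \<noteq> {}" "partition_on I \<pi>" "\<And>i. i \<in> I \<Longrightarrow> a i = b i"
  shows "cterm f g a x \<pi> = cterm f g b x \<pi>"
  unfolding cterm_def
proof (rule ev_cong)
  note p = partition_props[OF assms(1,2,3)]
  show "finite \<pi>" by (rule p)
  show "ev f B a x = ev f B b x" if "B \<in> \<pi>" for B
    by (rule ev_cong) (use p(3,5)[OF that] assms(4) in auto)
qed

lemma csum_cong:
  assumes "x \<in> pt Z e X" "finite I" "I \<noteq> {}" "a \<in> I \<rightarrow> mpt Z e M" "\<And>i. i \<in> I \<Longrightarrow> a i = b i"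
  shows "csum K f g Z I a x = csum K f g Z I b x"
proof -
  interpret comm_monoid "pt_monoid Z (Rst C (x \<Zsemi> f 0 \<Zsemi> g 0)) K"
    by (rule comm_monoid_fg[OF assms(1)])
  show ?thesis unfolding csum_def
    by (rule finprod_cong'[symmetric])
      (use cterm_Pi[OF assms(1-4)] cterm_cong[OF assms(2,3) _ assms(5)] in auto)
qed

lemma cterm_reindex:
  assumes x: "x \<in> pt Z e X" and I: "finite I" "I \<noteq> {}" and h: "inj_on h I"
    and a: "a \<in> h ` I \<rightarrow> mpt Z e M" and \<pi>: "partition_on I \<pi>"
  shows "cterm f g a x ((`) h ` \<pi>) = cterm f g (\<lambda>i. a (h i)) x \<pi>"
proof -
  note p = partition_props[OF I \<pi>]
  have hI: "finite (h ` I)" "h ` I \<noteq> {}" using I by auto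
  have inj: "inj_on ((`) h) \<pi>"
    by (rule inj_on_subset[OF inj_on_image_Pow[OF h]]) (use p(5) in auto)
  have "cterm f g a x ((`) h ` \<pi>) = ev g \<pi> (\<lambda>B. ev f (h ` B) a x) (x \<Zsemi> f 0)"
    unfolding cterm_def
    by (rule ev_reindex[OF g pt_f0[OF x] p(1,2) inj])
      (rule ev_blocks[OF x hI a partition_on_image[OF \<pi> h]])
  also have "\<dots> = ev g \<pi> (\<lambda>B. ev f B (\<lambda>i. a (h i)) x) (x \<Zsemi> f 0)"
  proof (rule ev_cong[OF p(1)])
    fix B assume B: "B \<in> \<pi>"
    show "ev f (h ` B) a x = ev f B (\<lambda>i. a (h i)) x"
      by (rule ev_reindex[OF f x p(3)[OF B] p(4)[OF B] inj_on_subset[OF h p(5)[OF B]]]) (use a p(5)[OF B] in auto)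
  qed
  finally show ?thesis by (simp add: cterm_def)
qed

text \<open>An injection carries the partitions of \<open>I\<close> bijectively to those of its
  image, and matching summands agree. Applied to permutations this is the symmetry of the composite;
  applied to \<open>Suc\<close> it reconciles two ways of numbering the variables.\<close>

lemma csum_reindex:
  assumes x: "x \<in> pt Z e X" and I: "finite I" "I \<noteq> {}" and h: "inj_on h I"
    and a: "a \<in> h ` I \<rightarrow> mpt Z e M"
  shows "csum K f g Z (h ` I) a x = csum K f g Z I (\<lambda>i. a (h i)) x"
proof -
  let ?P = "pt_monoid Z (Rst C (x \<Zsemi> f 0 \<Zsemi> g 0)) K"
  interpret comm_monoid ?P
    by (rule comm_monoid_fg[OF x])
  have hI: "finite (h ` I)" "h ` I \<noteq> {}" using I by auto
  let ?H = "\<lambda>\<pi>. (`) h ` \<pi>"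
  have img: "(partitions (h ` I)) = ?H ` (partitions I)"
  proof (intro equalityI subsetI)
    fix \<pi>' assume "\<pi>' \<in> (partitions (h ` I))"
    then have \<pi>': "partition_on (h ` I) \<pi>'" by simp
    let ?g = "the_inv_into I h"
    have "partition_on (?g ` h ` I) ((`) ?g ` \<pi>')"
      by (rule partition_on_image[OF \<pi>']) (rule inj_on_the_inv_into[OF h])
    moreover have "?g ` h ` I = I" using the_inv_into_onto[OF h] .
    moreover have "h ` ?g ` B = B" if "B \<in> \<pi>'" for B
    proof -
      have "h (?g b) = b" if "b \<in> B" for b
        using f_the_inv_into_f[OF h] that partition_on_block(2)[OF \<pi>' \<open>B \<in> \<pi>'\<close>] by auto
      then show ?thesis by (force simp: image_image)
    qed
    then have "?H ((`) ?g ` \<pi>') = \<pi>'" by (simp add: image_image)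
    ultimately show "\<pi>' \<in> ?H ` (partitions I)" by (metis image_eqI mem_Collect_eq)
  qed (use partition_on_image[OF _ h] in auto)
  have inj: "inj_on ?H (partitions I)"
    by (rule inj_on_subset[OF inj_on_image_Pow[OF inj_on_image_Pow[OF h]]])
      (auto dest: partition_on_block)
  have "csum K f g Z (h ` I) a x = finprod (?P)
      (\<lambda>\<pi>. cterm f g a x (?H \<pi>)) (partitions I)"
    unfolding csum_def img
    by (rule finprod_reindex[OF _ inj]) (use cterm_Pi[OF x hI a] in \<open>simp add: img\<close>)
  also have "\<dots> = csum K f g Z I (\<lambda>i. a (h i)) x"
    unfolding csum_def
  proof (rule finprod_cong')
    show "cterm f g (\<lambda>i. a (h i)) x \<in> (partitions I) \<rightarrow> carrier (?P)"
      unfolding pt_monoid_simps by (rule cterm_Pi[OF x I]) (use a in auto)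
  qed (use cterm_reindex[OF x I h a] in auto)
  finally show ?thesis .
qed

text \<open>Naturality in \<open>Z\<close>: sums and evaluations both commute with precomposition.
  The composite is defined at the projections only, and this transports its formula to every other
  point.\<close>

lemma Comp_csum:
  assumes x: "x \<in> pt Z e X" and I: "finite I" "I \<noteq> {}" and a: "a \<in> I \<rightarrow> mpt Z e M"
    and w: "w \<in> Hom C W Z"
  shows "w \<Zsemi> csum K f g Z I a x = csum K f g W I (\<lambda>i. w \<Zsemi> a i) (w \<Zsemi> x)"
proof -
  let ?H = "pt_monoid W (Rst C (w \<Zsemi> x \<Zsemi> f 0 \<Zsemi> g 0)) K"
  note s = faa_map_simps[OF f] faa_map_simps[OF g]
  have wx: "w \<Zsemi> x \<in> pt W (Rst C (w \<Zsemi> e)) X" and wa: "(\<lambda>i. w \<Zsemi> a i) \<in> I \<rightarrow> mpt W (Rst C (w \<Zsemi> e)) M"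
    using pt_pull[OF _ w] x a by auto
  interpret W: comm_monoid ?H
    by (rule comm_monoid_fg[OF wx])
  have w': "w \<in> Arr C" "Cod C w = Z" using w by (auto simp: Hom_def)
  note x' = pt_simps[OF x]
  have wxf: "w \<Zsemi> (x \<Zsemi> f 0) = w \<Zsemi> x \<Zsemi> f 0" using w' x' s by (simp add: assoc)
  have "w \<Zsemi> (x \<Zsemi> f 0 \<Zsemi> g 0) = w \<Zsemi> x \<Zsemi> f 0 \<Zsemi> g 0" using w' x' s by (simp add: assoc)
  then have r: "Rst C (w \<Zsemi> Rst C (x \<Zsemi> f 0 \<Zsemi> g 0)) = Rst C (w \<Zsemi> x \<Zsemi> f 0 \<Zsemi> g 0)"
    using w' x' s by (subst Rst_Comp_Rst) auto
  have "w \<Zsemi> csum K f g Z I a x =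
      finprod (?H) (\<lambda>\<pi>. w \<Zsemi> cterm f g a x \<pi>) (partitions I)"
    unfolding csum_def Comp_finprod[OF faa_map_simps(2)[OF g] rid_fg[OF x] w cterm_Pi[OF x I a]] r ..
  also have "\<dots> = csum K f g W I (\<lambda>i. w \<Zsemi> a i) (w \<Zsemi> x)"
    unfolding csum_def
  proof (rule W.finprod_cong')
    show "cterm f g (\<lambda>i. w \<Zsemi> a i) (w \<Zsemi> x) \<in> (partitions I) \<rightarrow> carrier (?H)"
      unfolding pt_monoid_simps by (rule cterm_Pi[OF wx I wa])
    fix \<pi> assume "\<pi> \<in> (partitions I)"
    then have \<pi>: "partition_on I \<pi>" by simp
    note p = partition_props[OF I \<pi>]
    have "w \<Zsemi> cterm f g a x \<pi> = ev g \<pi> (\<lambda>B. w \<Zsemi> ev f B a x) (w \<Zsemi> (x \<Zsemi> f 0))"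
      unfolding cterm_def
      by (rule Comp_ev[OF g pt_f0[OF x] p(1,2) ev_blocks[OF x I a \<pi>] w])
    also have "\<dots> = cterm f g (\<lambda>i. w \<Zsemi> a i) (w \<Zsemi> x) \<pi>"
      unfolding cterm_def wxf
    proof (rule ev_cong[OF p(1)])
      fix B assume B: "B \<in> \<pi>"
      show "w \<Zsemi> ev f B a x = ev f B (\<lambda>i. w \<Zsemi> a i) (w \<Zsemi> x)"
        by (rule Comp_ev[OF f x p(3)[OF B] p(4)[OF B] _ w]) (use a p(5)[OF B] in auto)
    qed
    finally show "w \<Zsemi> cterm f g a x \<pi> = cterm f g (\<lambda>i. w \<Zsemi> a i) (w \<Zsemi> x) \<pi>" .
  qed simp
  finally show ?thesis .
qed

text \<open>Exactly one block of a partition contains \<open>i\<close>, so the variable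
  \<open>i\<close> enters a summand through a single argument of \<open>g\<close>. Additivity of
  \<open>f\<close> on that block and then of \<open>g\<close> in that argument gives the claim for
  each summand.\<close>

lemma
  assumes x: "x \<in> pt Z e X" and I: "finite I" "i \<in> I" and a: "a \<in> I \<rightarrow> mpt Z e M"
  shows csum_add: "\<lbrakk>u \<in> mpt Z e M; v \<in> mpt Z e M\<rbrakk> \<Longrightarrow>
      csum K f g Z I (a(i := add M u v)) x = add K (csum K f g Z I (a(i := u)) x) (csum K f g Z I (a(i := v)) x)"
    and csum_zero: "csum K f g Z I (a(i := e \<Zsemi> zero M Z)) x = Rst C (x \<Zsemi> f 0 \<Zsemi> g 0) \<Zsemi> zero K Z"
proof -
  let ?H = "pt_monoid Z (Rst C (x \<Zsemi> f 0 \<Zsemi> g 0)) K"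
  note s = faa_map_simps[OF f] faa_map_simps[OF g]
  interpret comm_monoid ?H
    by (rule comm_monoid_fg[OF x])
  have I': "I \<noteq> {}" using I by auto
  have upd: "a(i := u) \<in> I \<rightarrow> mpt Z e M" if "u \<in> mpt Z e M" for u
    using a that by auto
  have blk: "\<exists>B\<in>\<pi>. i \<in> B \<and> (\<lambda>B. ev f B a x) \<in> \<pi> \<rightarrow> mpt Z (Rst C (x \<Zsemi> f 0)) N \<and>
      (\<forall>u. cterm f g (a(i := u)) x \<pi> = ev g \<pi> ((\<lambda>B. ev f B a x)(B := ev f B (a(i := u)) x)) (x \<Zsemi> f 0)) \<and>
      a \<in> B \<rightarrow> mpt Z e M \<and> finite B"
    if \<pi>: "partition_on I \<pi>" for \<pi>
  proof -
    note p = partition_props[OF I(1) I' \<pi>]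
    obtain B where B: "B \<in> \<pi>" "i \<in> B" using \<pi> I by (auto simp: partition_on_def)
    have "cterm f g (a(i := u)) x \<pi> = ev g \<pi> ((\<lambda>B. ev f B a x)(B := ev f B (a(i := u)) x)) (x \<Zsemi> f 0)" for u
      unfolding cterm_def
    proof (rule ev_cong[OF p(1)])
      fix B' assume B': "B' \<in> \<pi>"
      show "ev f B' (a(i := u)) x = ((\<lambda>B. ev f B a x)(B := ev f B (a(i := u)) x)) B'"
      proof (cases "B' = B")
        case False
        then have "i \<notin> B'" using partition_on_block_eqI[OF \<pi> B' B(1)] B(2) by auto
        then have "ev f B' (a(i := u)) x = ev f B' a x"
          by (intro ev_cong) (use p(3)[OF B'] in auto)
        then show ?thesis using False by simp
      qed simp
    qed
    then show ?thesis using B ev_blocks[OF x I(1) I' a \<pi>] a p(3,5)[OF B(1)] by (intro bexI[of _ B]) auto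
  qed
  have "csum K f g Z I (a(i := e \<Zsemi> zero M Z)) x = \<one>\<^bsub>?H\<^esub>"
    unfolding csum_def
  proof (rule finprod_one_eqI)
    fix \<pi> assume "\<pi> \<in> (partitions I)"
    then have \<pi>: "partition_on I \<pi>" by simp
    obtain B where B: "B \<in> \<pi>" "i \<in> B" "(\<lambda>B. ev f B a x) \<in> \<pi> \<rightarrow> mpt Z (Rst C (x \<Zsemi> f 0)) N"
      "\<And>u. cterm f g (a(i := u)) x \<pi> = ev g \<pi> ((\<lambda>B. ev f B a x)(B := ev f B (a(i := u)) x)) (x \<Zsemi> f 0)"
      "a \<in> B \<rightarrow> mpt Z e M" "finite B" using blk[OF \<pi>] by blast
    show "cterm f g (a(i := e \<Zsemi> zero M Z)) x \<pi> = \<one>\<^bsub>?H\<^esub>"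
      unfolding B(4) ev_zero[OF f x B(6,2,5)] pt_monoid_simps(3)
      by (rule ev_zero[OF g pt_f0[OF x] partition_props(1)[OF I(1) I' \<pi>] B(1,3)])
  qed
  then show "csum K f g Z I (a(i := e \<Zsemi> zero M Z)) x = Rst C (x \<Zsemi> f 0 \<Zsemi> g 0) \<Zsemi> zero K Z"
    by simp
  assume u: "u \<in> mpt Z e M" and v: "v \<in> mpt Z e M"
  have "csum K f g Z I (a(i := add M u v)) x = finprod (?H)
    (\<lambda>\<pi>. cterm f g (a(i := u)) x \<pi> \<otimes>\<^bsub>?H\<^esub> cterm f g (a(i := v)) x \<pi>) (partitions I)"
    unfolding csum_def
  proof (rule finprod_cong')
    have "cterm f g (a(i := u)) x \<pi> \<in> carrier (?H)"
      "cterm f g (a(i := v)) x \<pi> \<in> carrier (?H)" if "partition_on I \<pi>" for \<pi>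
      unfolding pt_monoid_simps(1) using cterm_pt[OF x I(1) I' upd that] u v by auto
    then show "(\<lambda>\<pi>. cterm f g (a(i := u)) x \<pi> \<otimes>\<^bsub>?H\<^esub> cterm f g (a(i := v)) x \<pi>)
      \<in> (partitions I) \<rightarrow> carrier (?H)"
      by (intro Pi_I m_closed) auto
    fix \<pi> assume "\<pi> \<in> (partitions I)"
    then have \<pi>: "partition_on I \<pi>" by simp
    obtain B where B: "B \<in> \<pi>" "i \<in> B" "(\<lambda>B. ev f B a x) \<in> \<pi> \<rightarrow> mpt Z (Rst C (x \<Zsemi> f 0)) N"
      "\<And>u. cterm f g (a(i := u)) x \<pi> = ev g \<pi> ((\<lambda>B. ev f B a x)(B := ev f B (a(i := u)) x)) (x \<Zsemi> f 0)"
      "a \<in> B \<rightarrow> mpt Z e M" "finite B" using blk[OF \<pi>] by blast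
    have pt: "ev f B (a(i := u)) x \<in> mpt Z (Rst C (x \<Zsemi> f 0)) N" if "u \<in> mpt Z e M" for u
      by (rule ev_pt[OF f x B(6)]) (use B that in auto)
    show "cterm f g (a(i := add M u v)) x \<pi> = cterm f g (a(i := u)) x \<pi> \<otimes>\<^bsub>?H\<^esub> cterm f g (a(i := v)) x \<pi>"
      unfolding B(4) ev_add[OF f x B(6,2,5) u v] pt_monoid_simps(2)
      by (rule ev_add[OF g pt_f0[OF x] partition_props(1)[OF I(1) I' \<pi>] B(1,3) pt[OF u] pt[OF v]])
  qed simp
  also have "\<dots> = csum K f g Z I (a(i := u)) x \<otimes>\<^bsub>?H\<^esub> csum K f g Z I (a(i := v)) x"
    unfolding csum_def
    by (rule finprod_multf) (simp_all only: pt_monoid_simps(1) cterm_Pi[OF x I(1) I' upd[OF u]] cterm_Pi[OF x I(1) I' upd[OF v]])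
  finally show "csum K f g Z I (a(i := add M u v)) x = add K (csum K f g Z I (a(i := u)) x) (csum K f g Z I (a(i := v)) x)"
    by simp
qed

text \<open>The projections are points of restriction identity, so the ordered summands and the sum
  in the hom-monoid can be replaced by order-free summands and a sum in \<open>pt_monoid\<close>.
  The set of partitions is nonempty, hence the change of unit is harmless.\<close>

lemma faa_comp_eq_csum:
  assumes n: "n \<ge> 1"
  shows "faa_comp C (M, X) (K, V) f g n =
    csum K f g (npow C (cobj M) X n) {1..n} (\<lambda>i. proj C (cobj M) X n (i - 1)) (proj C (cobj M) X n n)"
proof -
  let ?Z = "npow C (cobj M) X n" and ?x = "proj C (cobj M) X n n"
  let ?a = "\<lambda>i. proj C (cobj M) X n (i - 1)"
  let ?r = "Rst C (?x \<Zsemi> f 0 \<Zsemi> g 0)"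
  note s = faa_map_simps[OF f] faa_map_simps[OF g]
  have x: "?x \<in> pt ?Z (Id C ?Z) X" and a0: "proj C (cobj M) X n \<in> {..<n} \<rightarrow> mpt ?Z (Id C ?Z) M"
    using projs_pt s by auto
  have a: "?a \<in> {1..n} \<rightarrow> mpt ?Z (Id C ?Z) M"
    by (rule Pi_I, rule funcset_mem[OF a0]) auto
  have I: "finite {1..n}" "{1..n} \<noteq> {}" using n by auto
  interpret comm_monoid "pt_monoid ?Z ?r K" by (rule comm_monoid_fg[OF x])
  have Z: "?Z \<in> Obj C" using s by simp
  interpret H: comm_monoid "hom_monoid C ?Z K" by (rule comm_monoid_hom[OF s(12) Z])
  have trm: "faa_term C (M, X) f g n \<pi> = cterm f g ?a ?x \<pi>" if \<pi>: "partition_on {1..n} \<pi>" for \<pi>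
  proof -
    note p = partition_props[OF I \<pi>]
    \<comment> \<open>Nonempty disjoint blocks have different minima, so sorting by
      \<open>Min\<close> lists every block exactly once.\<close>
    have inj: "inj_on Min \<pi>"
    proof (rule inj_onI)
      fix B B' assume B: "B \<in> \<pi>" "B' \<in> \<pi>" "Min B = Min B'"
      have "Min B \<in> B" "Min B' \<in> B'" 
        using Min_in[OF p(3)[OF B(1)] p(4)[OF B(1)]] Min_in[OF p(3)[OF B(2)] p(4)[OF B(2)]] .
      then show "B = B'" using partition_on_block_eqI[OF \<pi> B(1,2), of "Min B"] B by simp
    qed
    let ?l = "sorted_key_list_of_set Min \<pi>"
    have l: "distinct ?l" "set ?l = \<pi>"
      using sorted_key_list_of_set_enum[OF inj p(1)] by auto
    then have lc: "length ?l = card \<pi>" using distinct_card by metis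
    have ne: "?l \<noteq> []" using p(2) l(2) by auto
    have blk: "tuple C (map ?a (sorted_list_of_set B)) ?x \<Zsemi> f (card B) = ev f B ?a ?x" if B: "B \<in> \<pi>" for B
    proof -
      have "ev f B ?a ?x = tuple C (map ?a (sorted_list_of_set B)) ?x \<Zsemi> f (length (sorted_list_of_set B))"
        by (rule ev_list[OF f x]) (use p(3,4)[OF B] p(5)[OF B] a in auto)
      then show ?thesis by simp
    qed
    have "cterm f g ?a ?x \<pi> = tuple C (map (\<lambda>B. ev f B ?a ?x) ?l) (?x \<Zsemi> f 0) \<Zsemi> g (card \<pi>)"
      unfolding cterm_def using ev_list[OF g pt_f0[OF x] l(1,2) ne ev_blocks[OF x I a \<pi>]] lc by simp
    also have "map (\<lambda>B. ev f B ?a ?x) ?l =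
        map (\<lambda>B. tuple C (map ?a (sorted_list_of_set B)) ?x \<Zsemi> f (card B)) ?l"
      using blk l(2) by simp
    finally show ?thesis by (simp add: faa_term_def Let_def)
  qed
  have fin: "finite (partitions {1..n})" using finitely_many_partition_on by auto
  have ne: "(partitions {1..n}) \<noteq> {}" using partition_on_space[OF I(2)] by auto
  have "faa_comp C (M, X) (K, V) f g n =
      finprod (hom_monoid C ?Z K) (faa_term C (M, X) f g n) (partitions {1..n})"
    using n by (simp add: faa_comp_def)
  also have "\<dots> = finprod (hom_monoid C ?Z K) (cterm f g ?a ?x) (partitions {1..n})"
    by (rule H.finprod_cong')
      (use cterm_Pi[OF x I a] trm in \<open>auto simp: hom_monoid_def pt_def Pi_iff\<close>)
  also have "\<dots> = csum K f g ?Z {1..n} ?a ?x"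
    unfolding csum_def by (rule finprod_hom_monoid_eq[OF s(12) rid_fg[OF x] fin ne cterm_Pi[OF x I a]])
  finally show ?thesis .
qed

lemma tp_faa_comp:
  assumes x: "x \<in> pt Z e X" and n: "n \<ge> 1" and a: "a \<in> {..<n} \<rightarrow> mpt Z e M"
  shows "tp a n x \<Zsemi> faa_comp C (M, X) (K, V) f g n = csum K f g Z {..<n} a x"
proof -
  let ?P = "npow C (cobj M) X n" and ?p = "proj C (cobj M) X n n"
  let ?a = "\<lambda>i. proj C (cobj M) X n (i - 1)"
  note s = faa_map_simps[OF f] faa_map_simps[OF g]
  have p: "?p \<in> pt ?P (Id C ?P) X" and a0: "proj C (cobj M) X n \<in> {..<n} \<rightarrow> mpt ?P (Id C ?P) M"
    using projs_pt s by auto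
  have a1: "?a \<in> {1..n} \<rightarrow> mpt ?P (Id C ?P) M"
    by (rule Pi_I, rule funcset_mem[OF a0]) auto
  have I: "finite {1..n}" "{1..n} \<noteq> {}" using n by auto
  have as: "set (map a [0..<n]) \<subseteq> mpt Z e M" using a by auto
  have t: "tp a n x \<in> pt Z e ?P" using tuple_pt[OF as x] by (simp add: tp_def)
  then have tH: "tp a n x \<in> Hom C Z ?P" by (simp add: pt_def)
  have tp: "tp a n x \<Zsemi> ?p = x" "\<And>i. i < n \<Longrightarrow> tp a n x \<Zsemi> proj C (cobj M) X n i = a i"
    using tuple_proj[OF as x, of n] tuple_proj[OF as x] s(9) by (auto simp: tp_def)
  have a2: "(\<lambda>i. a (i - 1)) \<in> {1..n} \<rightarrow> mpt Z e M"
    by (rule Pi_I, rule funcset_mem[OF a]) auto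
  have "tp a n x \<Zsemi> faa_comp C (M, X) (K, V) f g n = csum K f g Z {1..n} (\<lambda>i. tp a n x \<Zsemi> ?a i) x"
    unfolding faa_comp_eq_csum[OF n] using Comp_csum[OF p I a1 tH] tp by simp
  also have "\<dots> = csum K f g Z {1..n} (\<lambda>i. a (i - 1)) x"
    by (rule csum_cong[symmetric, OF x I a2]) (use tp(2) in auto)
  \<comment> \<open>Variables are numbered from 1 in the composition formula but from 0 in
    \<open>tp\<close>; the shift is a reindexing along \<open>Suc\<close>.\<close>
  also have "{1..n} = Suc ` {..<n}"
    by (auto simp: image_Suc_lessThan)
  also have "csum K f g Z (Suc ` {..<n}) (\<lambda>i. a (i - 1)) x = csum K f g Z {..<n} (\<lambda>i. a (Suc i - 1)) x"
    by (rule csum_reindex[OF x]) (use n a2 image_Suc_lessThan[of n] in \<open>auto simp: lessThan_empty_iff\<close>)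
  finally show ?thesis by simp
qed

lemma faa_map_comp: "faa_map M X K V (faa_comp C (M, X) (K, V) f g)"
  unfolding faa_map_def faa_comp_0
proof (intro conjI allI impI ballI)
  let ?c = "faa_comp C (M, X) (K, V) f g"
  note s = faa_map_simps[OF f] faa_map_simps[OF g]
  show "tcm M" "tcm K" "f 0 \<Zsemi> g 0 \<in> Hom C X V" using s fg_simps by auto
  fix n :: nat assume n: "1 \<le> n"
  let ?P = "npow C (cobj M) X n" and ?p = "proj C (cobj M) X n n"
  have p: "?p \<in> pt ?P (Id C ?P) X" and a0: "proj C (cobj M) X n \<in> {..<n} \<rightarrow> mpt ?P (Id C ?P) M"
    using projs_pt s by auto
  have I: "finite {1..n}" "{1..n} \<noteq> {}" "finite {..<n}" "{..<n} \<noteq> {}" using n by (auto simp: lessThan_empty_iff)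
  have a1: "(\<lambda>i. proj C (cobj M) X n (i - 1)) \<in> {1..n} \<rightarrow> mpt ?P (Id C ?P) M"
    by (rule Pi_I, rule funcset_mem[OF a0]) auto
  have "?c n \<in> mpt ?P (Rst C (?p \<Zsemi> f 0 \<Zsemi> g 0)) K"
    unfolding faa_comp_eq_csum[OF n] by (rule csum_pt[OF p I(1,2) a1])
  then show "?c n \<in> Hom C ?P (cobj K)"
    "Rst C (?c n) = Rst C (?p \<Zsemi> (f 0 \<Zsemi> g 0))"
    using s by (auto simp: pt_def assoc)
  fix Z e x a assume x: "x \<in> pt Z e X" and a: "a \<in> {..<n} \<rightarrow> mpt Z e M"
  have upd: "a(i := u) \<in> {..<n} \<rightarrow> mpt Z e M" if "u \<in> mpt Z e M" for u i
    using a that by auto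
  {
    fix i u v assume i: "i < n" and u: "u \<in> mpt Z e M" and v: "v \<in> mpt Z e M"
    show "tp (a(i := add M u v)) n x \<Zsemi> ?c n =
      add K (tp (a(i := u)) n x \<Zsemi> ?c n) (tp (a(i := v)) n x \<Zsemi> ?c n)"
      unfolding tp_faa_comp[OF x n upd[OF u]] tp_faa_comp[OF x n upd[OF v]]
        tp_faa_comp[OF x n upd[OF add_pt[OF s(1) u v]]]
      by (rule csum_add[OF x I(3) _ a u v]) (use i in simp)
  next
    fix i assume i: "i < n"
    have z: "e \<Zsemi> zero M Z \<in> mpt Z e M" using rid_zero_pt[OF s(1) pt_rid[OF x]] .
    have "tp (a(i := e \<Zsemi> zero M Z)) n x \<Zsemi> ?c n = Rst C (x \<Zsemi> f 0 \<Zsemi> g 0) \<Zsemi> zero K Z"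
      unfolding tp_faa_comp[OF x n upd[OF z]] by (rule csum_zero[OF x I(3) _ a]) (use i in simp)
    then show "tp (a(i := e \<Zsemi> zero M Z)) n x \<Zsemi> ?c n = Rst C (x \<Zsemi> (f 0 \<Zsemi> g 0)) \<Zsemi> zero K Z"
      using s pt_simps[OF x] by (simp add: assoc)
  next
    fix p assume p: "p permutes {..<n}"
    have img: "p ` {..<n} = {..<n}" by (rule permutes_image[OF p])
    have ap: "a \<circ> p \<in> {..<n} \<rightarrow> mpt Z e M" 
      by (rule Pi_I) (use funcset_mem[OF a] permutes_in_image[OF p] in auto)
    show "tp (a \<circ> p) n x \<Zsemi> ?c n = tp a n x \<Zsemi> ?c n"
      unfolding tp_faa_comp[OF x n ap] tp_faa_comp[OF x n a]
      using csum_reindex[OF x I(3,4) permutes_inj_on[OF p], of a] a img by (simp add: comp_def)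
  }
qed

lemma ev_comp:
  assumes x: "x \<in> pt Z e X" and I: "finite I" "I \<noteq> {}" and a: "a \<in> I \<rightarrow> mpt Z e M"
  shows "ev (faa_comp C (M, X) (K, V) f g) I a x = csum K f g Z I a x"
proof -
  let ?c = "faa_comp C (M, X) (K, V) f g"
  obtain l where l: "distinct l" "set l = I" "l \<noteq> []" by (rule list_of_finite[OF I])
  let ?n = "length l"
  have n: "?n \<ge> 1" using l by (cases l) auto
  have a': "(\<lambda>i. a (l ! i)) \<in> {..<?n} \<rightarrow> mpt Z e M" using a l by auto
  have img: "(!) l ` {..<?n} = I" using l(2) by (auto simp: set_conv_nth)
  have inj: "inj_on ((!) l) {..<?n}" using l(1) by (simp add: inj_on_nth)
  have "ev (?c) I a x = tp (\<lambda>i. a (l ! i)) ?n x \<Zsemi> ?c ?n"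
    unfolding ev_list[OF faa_map_comp x l a] tp_def map_as_upt[of a l, symmetric] ..
  also have "\<dots> = csum K f g Z I a x"
    unfolding tp_faa_comp[OF x n a']
    using csum_reindex[OF x _ _ inj, of a] a img l(3) by (simp add: lessThan_empty_iff)
  finally show ?thesis .
qed

end

section \<open>Associativity of composition\<close>

lemma faa_comp_assoc:
  assumes f: "faa_map M X N Y f" and g: "faa_map N Y K V g" and h: "faa_map K V L W h"
  shows "faa_comp C (M, X) (L, W) (faa_comp C (M, X) (K, V) f g) h =
    faa_comp C (M, X) (L, W) f (faa_comp C (N, Y) (L, W) g h)"
    (is "faa_comp _ _ _ ?fg h = faa_comp _ _ _ f ?gh")
proof -
  note s = faa_map_simps[OF f] faa_map_simps[OF g] faa_map_simps[OF h]
  note fg = faa_map_comp[OF f g] and gh = faa_map_comp[OF g h]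
  note fg_h = faa_map_comp[OF fg h] and f_gh = faa_map_comp[OF f gh]
  show ?thesis
  proof (rule faa_map_ext[OF fg_h f_gh])
    show "faa_comp C (M, X) (L, W) ?fg h 0 = faa_comp C (M, X) (L, W) f ?gh 0"
      using s by (simp add: faa_comp_0 assoc)
    fix n :: nat and Z e a x
    assume n: "n \<ge> 1" and x: "x \<in> pt Z e X" and a: "a \<in> {..<n} \<rightarrow> mpt Z e M"
    let ?I = "{..<n}"
    have I: "finite ?I" "?I \<noteq> {}" using n by (auto simp: lessThan_empty_iff)
    note x' = pt_simps[OF x]
    have xf: "x \<Zsemi> f 0 \<in> pt Z (Rst C (x \<Zsemi> f 0)) Y" by (rule pt_f0[OF f g x])
    let ?e1 = "Rst C (x \<Zsemi> f 0 \<Zsemi> g 0)" and ?e2 = "Rst C (x \<Zsemi> f 0 \<Zsemi> g 0 \<Zsemi> h 0)"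
    let ?y = "x \<Zsemi> f 0 \<Zsemi> g 0"
    have xfg: "?y \<in> pt Z ?e1 V" by (rule pt_f0[OF g h xf])
    have xfg_eq: "x \<Zsemi> (f 0 \<Zsemi> g 0) = ?y"
      and gh_eq: "x \<Zsemi> f 0 \<Zsemi> (g 0 \<Zsemi> h 0) = ?y \<Zsemi> h 0"
      using s x' by (auto simp: assoc)
    let ?G = "pt_monoid Z ?e1 K" and ?H = "pt_monoid Z ?e2 L"
    interpret G: comm_monoid ?G by (rule comm_monoid_fg[OF f g x])
    interpret H: comm_monoid ?H by (rule comm_monoid_fg[OF g h xf])
    let ?ct = "cterm f g a x"
    let ?parts = "\<lambda>S. {\<pi>. partition_on S \<pi>}"
    have ct: "?ct \<rho> \<in> mpt Z ?e1 K" if "partition_on B \<rho>" "B \<noteq> {}" "B \<subseteq> ?I" for B \<rho>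
      by (rule cterm_pt[OF f g x _ that(2) _ that(1)]) (use that a finite_subset in auto)
    have evh: "ev h \<pi> b (?y) \<in> mpt Z ?e2 L"
      if "finite \<pi>" "\<pi> \<noteq> {}" "b \<in> \<pi> \<rightarrow> mpt Z ?e1 K" for \<pi> b
      using ev_pt[OF h xfg that] .
    \<comment> \<open>Every argument of \<open>h\<close> is itself a sum, over the partitions of its
      block \<open>B\<close>. Expanding selects one such partition \<open>\<rho> B\<close> for each
      block.\<close>
    have ctermL: "cterm ?fg h a x \<pi> = finprod ?H (\<lambda>\<rho>. ev h \<pi> (\<lambda>B. ?ct (\<rho> B)) (?y)) (PiE \<pi> ?parts)"
      if \<pi>: "partition_on ?I \<pi>" for \<pi>
    proof -
      note p = partition_props[OF I \<pi>]
      have "cterm ?fg h a x \<pi> = ev h \<pi> (\<lambda>B. finprod ?G ?ct (?parts B)) (?y)"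
        unfolding cterm_def[of ?fg] faa_comp_0 xfg_eq
      proof (rule ev_cong[OF p(1)])
        fix B assume B: "B \<in> \<pi>"
        have "ev ?fg B a x = csum K f g Z B a x"
          by (rule ev_comp[OF f g x p(3)[OF B] p(4)[OF B]]) (use a p(5)[OF B] in auto)
        then show "ev ?fg B a x = finprod ?G (cterm f g a x) (?parts B)"
          by (simp add: csum_def)
      qed
      also have "\<dots> = finprod ?H (\<lambda>\<rho>. ev h \<pi> (\<lambda>B. ?ct (\<rho> B)) (?y)) (PiE \<pi> ?parts)"
      proof (rule finprod_multiadditive[where \<phi> = "\<lambda>b. ev h \<pi> b (?y)" and t = "\<lambda>_. ?ct",
            OF G.comm_monoid_axioms H.comm_monoid_axioms p(1)])
        show "finite (?parts B)" if "B \<in> \<pi>" for B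
          using finitely_many_partition_on[OF p(3)[OF that]] .
        show "?ct \<rho> \<in> carrier ?G" if "B \<in> \<pi>" "\<rho> \<in> ?parts B" for B \<rho>
          using ct[of B \<rho>] p(4,5)[OF that(1)] that(2) by simp
        show "ev h \<pi> b (?y) \<in> carrier ?H" if "b \<in> \<pi> \<rightarrow> carrier ?G" for b
          using evh[OF p(1,2)] that by simp
        show "ev h \<pi> b (?y) = ev h \<pi> b' (?y)" if "\<And>B. B \<in> \<pi> \<Longrightarrow> b B = b' B" for b b'
          by (rule ev_cong[OF p(1) that])
        show "ev h \<pi> (b(B := u \<otimes>\<^bsub>?G\<^esub> v)) (?y) =
            ev h \<pi> (b(B := u)) (?y) \<otimes>\<^bsub>?H\<^esub> ev h \<pi> (b(B := v)) (?y)"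
          if "b \<in> \<pi> \<rightarrow> carrier ?G" "B \<in> \<pi>" "u \<in> carrier ?G" "v \<in> carrier ?G" for b B u v
          unfolding pt_monoid_simps(2)
          by (rule ev_add[OF h xfg p(1) that(2) that(1,3,4)[unfolded pt_monoid_simps(1)]])
        show "ev h \<pi> (b(B := \<one>\<^bsub>?G\<^esub>)) (?y) = \<one>\<^bsub>?H\<^esub>"
          if "b \<in> \<pi> \<rightarrow> carrier ?G" "B \<in> \<pi>" for b B
          unfolding pt_monoid_simps(3)
          by (rule ev_zero[OF h xfg p(1) that(2) that(1)[unfolded pt_monoid_simps(1)]])
      qed
      finally show ?thesis .
    qed
    \<comment> \<open>\<open>?ct T\<close> depends on the set of blocks \<open>T\<close> alone, so
      the summand of a nested partition is a function of \<open>\<tau>\<close>. Both double sums are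
      compared through it.\<close>
    define \<Phi> where "\<Phi> \<tau> = ev h \<tau> ?ct (?y)" for \<tau>
    have \<Phi>: "\<Phi> \<tau> \<in> carrier ?H" if "partition_on ?I \<sigma>" "partition_on \<sigma> \<tau>" for \<sigma> \<tau>
      unfolding \<Phi>_def pt_monoid_simps
    proof (rule evh)
      note p = partition_props[OF I that(1)]
      note q = partition_props[OF p(1,2) that(2)]
      show "finite \<tau>" "\<tau> \<noteq> {}" by (rule q(1), rule q(2))
      have "?ct T \<in> mpt Z ?e1 K" if T: "T \<in> \<tau>" for T
      proof (rule ct)
        show "partition_on (\<Union>T) T"
          by (rule partition_on_merge(3)[OF \<open>partition_on ?I \<sigma>\<close> \<open>partition_on \<sigma> \<tau>\<close> T])
        show "\<Union>T \<noteq> {}" "\<Union>T \<subseteq> ?I" using q(4,5)[OF T] p(4,5) by blast+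
      qed
      then show "?ct \<in> \<tau> \<rightarrow> mpt Z ?e1 K" by auto
    qed
    \<comment> \<open>\<open>\<rho>\<close> is injective on \<open>\<pi>\<close>, so the arguments
      of \<open>h\<close> may be indexed by the sets \<open>\<rho> B\<close> instead of by the
      blocks \<open>B\<close>.\<close>
    have reidx: "ev h \<pi> (\<lambda>B. ?ct (\<rho> B)) (?y) = \<Phi> (\<rho> ` \<pi>)"
      if \<pi>: "partition_on ?I \<pi>" and \<rho>: "\<rho> \<in> PiE \<pi> ?parts" for \<pi> \<rho>
      unfolding \<Phi>_def
    proof (rule ev_reindex[OF h xfg, symmetric])
      note p = partition_props[OF I \<pi>]
      have \<rho>': "partition_on B (\<rho> B)" if "B \<in> \<pi>" for B using \<rho> that by auto
      show "finite \<pi>" "\<pi> \<noteq> {}" by (rule p(1), rule p(2))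
      show "inj_on \<rho> \<pi>" by (rule partition_on_flatten(3)[OF \<pi> \<rho>'])
      show "?ct \<in> \<rho> ` \<pi> \<rightarrow> mpt Z ?e1 K"
        using ct \<rho>' p(4,5) by blast
    qed
    let ?S1 = "SIGMA \<pi>:?parts ?I. PiE \<pi> ?parts" and ?S2 = "SIGMA \<sigma>:?parts ?I. ?parts \<sigma>"
    let ?b = "\<lambda>(\<pi>, \<rho>). (\<Union>B\<in>\<pi>. \<rho> B, \<rho> ` \<pi>)"
    have bij: "bij_betw ?b ?S1 ?S2" by (rule bij_betw_nested_partitions)
    have fin: "finite (?parts ?I)" by (rule finitely_many_partition_on[OF I(1)])
    have "ev (faa_comp C (M, X) (L, W) ?fg h) ?I a x = csum L ?fg h Z ?I a x"
      by (rule ev_comp[OF fg h x I a])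
    also have "\<dots> = finprod ?H (\<lambda>\<pi>. finprod ?H (\<lambda>\<rho>. \<Phi> (\<rho> ` \<pi>)) (PiE \<pi> ?parts)) (?parts ?I)"
      unfolding csum_def faa_comp_0 xfg_eq
    proof (rule H.finprod_cong')
      have cl: "\<Phi> (\<rho> ` \<pi>) \<in> carrier ?H" if "partition_on ?I \<pi>" "\<rho> \<in> PiE \<pi> ?parts" for \<pi> \<rho>
        by (rule \<Phi>[OF partition_on_flatten(1,2)[OF that(1)]]) (use that(2) in auto)
      then show "(\<lambda>\<pi>. finprod ?H (\<lambda>\<rho>. \<Phi> (\<rho> ` \<pi>)) (PiE \<pi> ?parts)) \<in> ?parts ?I \<rightarrow> carrier ?H"
        by (intro Pi_I H.finprod_closed) auto
      fix \<pi> assume "\<pi> \<in> ?parts ?I"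
      then have \<pi>: "partition_on ?I \<pi>" by simp
      show "cterm ?fg h a x \<pi> = finprod ?H (\<lambda>\<rho>. \<Phi> (\<rho> ` \<pi>)) (PiE \<pi> ?parts)"
        unfolding ctermL[OF \<pi>]
        by (rule H.finprod_cong') (use reidx[OF \<pi>] cl[OF \<pi>] in auto)
    qed simp
    also have "\<dots> = finprod ?H (\<lambda>(\<pi>, \<rho>). \<Phi> (\<rho> ` \<pi>)) ?S1"
    proof (rule H.finprod_Sigma[OF fin])
      fix \<pi> assume "\<pi> \<in> ?parts ?I"
      then have \<pi>: "partition_on ?I \<pi>" by simp
      note p = partition_props[OF I \<pi>]
      show "finite (PiE \<pi> ?parts)"
        by (rule finite_PiE[OF p(1)]) (rule finitely_many_partition_on[OF p(3)])
      fix \<rho> assume "\<rho> \<in> PiE \<pi> ?parts"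
      then show "\<Phi> (\<rho> ` \<pi>) \<in> carrier ?H"
        by (intro \<Phi>[OF partition_on_flatten(1,2)[OF \<pi>]]) auto
    qed
    also have "\<dots> = finprod ?H (\<lambda>p. (\<lambda>(\<sigma>, \<tau>). \<Phi> \<tau>) (?b p)) ?S1"
      by (simp add: case_prod_beta')
    also have "\<dots> = finprod ?H (\<lambda>(\<sigma>, \<tau>). \<Phi> \<tau>) (?b ` ?S1)"
      by (rule H.finprod_reindex[symmetric])
        (use bij \<Phi> in \<open>auto simp: bij_betw_def intro!: partition_on_flatten\<close>)
    also have "?b ` ?S1 = ?S2" using bij by (simp add: bij_betw_def)
    also have "finprod ?H (\<lambda>(\<sigma>, \<tau>). \<Phi> \<tau>) ?S2 = finprod ?H (\<lambda>\<sigma>. finprod ?H \<Phi> (?parts \<sigma>)) (?parts ?I)"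
      by (rule H.finprod_Sigma[symmetric, OF fin])
        (use \<Phi> finitely_many_partition_on partition_props(1)[OF I] in auto)
    also have "\<dots> = csum L f ?gh Z ?I a x"
      unfolding csum_def faa_comp_0 gh_eq
    proof (rule H.finprod_cong'[symmetric])
      show "(\<lambda>\<sigma>. finprod ?H \<Phi> (?parts \<sigma>)) \<in> ?parts ?I \<rightarrow> carrier ?H"
        using \<Phi> by (intro Pi_I H.finprod_closed) auto
      fix \<sigma> assume "\<sigma> \<in> ?parts ?I"
      then have \<sigma>: "partition_on ?I \<sigma>" by simp
      note p = partition_props[OF I \<sigma>]
      have "cterm f ?gh a x \<sigma> = csum L g h Z \<sigma> (\<lambda>B. ev f B a x) (x \<Zsemi> f 0)"
        unfolding cterm_def
        by (rule ev_comp[OF g h xf p(1,2) ev_blocks[OF f g x I a \<sigma>]])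
      also have "\<dots> = finprod ?H \<Phi> (?parts \<sigma>)"
      proof -
        \<comment> \<open>A set \<open>T\<close> of blocks is read as a partition in the summand for
          \<open>f\<close> and \<open>g\<close>, and as an index set when \<open>g\<close> is
          evaluated at the values of \<open>f\<close> on blocks; by definition the two give the same
          map.\<close>
        have "?ct = (\<lambda>T. ev g T (\<lambda>B. ev f B a x) (x \<Zsemi> f 0))"
          by (rule ext) (rule cterm_def)
        then have "cterm g h (\<lambda>B. ev f B a x) (x \<Zsemi> f 0) = \<Phi>"
          by (intro ext) (simp only: cterm_def[of g h] \<Phi>_def)
        then show ?thesis by (simp only: csum_def)
      qed
      finally show "cterm f ?gh a x \<sigma> = finprod ?H \<Phi> (?parts \<sigma>)" .
    qed simp
    also have "\<dots> = ev (faa_comp C (M, X) (L, W) f ?gh) ?I a x"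
      by (rule ev_comp[OF f gh x I a, symmetric])
    finally show "ev (faa_comp C (M, X) (L, W) ?fg h) ?I a x = ev (faa_comp C (M, X) (L, W) f ?gh) ?I a x" .
  qed
qed

subsection \<open>Linear maps\<close>

text \<open>
  Identities, restrictions, projections and maps to the terminal object all have the following form.
\<close>

definition lin :: "('o, 'm) cmon \<Rightarrow> 'o \<Rightarrow> ('o, 'm) cmon \<Rightarrow> 'm \<Rightarrow> 'm \<Rightarrow> nat \<Rightarrow> 'm" where
  "lin M X N \<theta> \<phi> n =
     (if n = 0 then \<theta>
      else Rst C (proj C (cobj M) X n n \<Zsemi> \<theta>) \<Zsemi>
        (if n = 1 then proj C (cobj M) X 1 0 \<Zsemi> \<phi> else zero N (npow C (cobj M) X n)))"

text \<open>Total monoid homomorphisms, in pointwise form. Totality leaves the restriction of the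
  first component of \<open>lin\<close> to be determined by \<open>\<theta>\<close>, as required of
  a map of the category.\<close>

definition mhom :: "('o, 'm) cmon \<Rightarrow> ('o, 'm) cmon \<Rightarrow> 'm \<Rightarrow> bool" where
  "mhom M N \<phi> \<longleftrightarrow> tcm M \<and> tcm N \<and> \<phi> \<in> Hom C (cobj M) (cobj N) \<and> total C \<phi> \<and>
     (\<forall>Z e. \<forall>u\<in>mpt Z e M. \<forall>v\<in>mpt Z e M. add M u v \<Zsemi> \<phi> = add N (u \<Zsemi> \<phi>) (v \<Zsemi> \<phi>)) \<and>
     (\<forall>Z e. rid Z e \<longrightarrow> e \<Zsemi> zero M Z \<Zsemi> \<phi> = e \<Zsemi> zero N Z)"

lemma mhom_Id: "tcm M \<Longrightarrow> mhom M M (Id C (cobj M))"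
proof -
  assume M: "tcm M"
  have "add M u v \<Zsemi> Id C (cobj M) = add M (u \<Zsemi> Id C (cobj M)) (v \<Zsemi> Id C (cobj M))"
    if "u \<in> mpt Z e M" "v \<in> mpt Z e M" for Z e u v
    using pt_simps[OF that(1)] pt_simps[OF that(2)] pt_simps[OF add_pt[OF M that]] by simp
  moreover have "e \<Zsemi> zero M Z \<Zsemi> Id C (cobj M) = e \<Zsemi> zero M Z" if "rid Z e" for Z e
    using pt_simps[OF rid_zero_pt[OF M that]] by simp
  ultimately show ?thesis
    unfolding mhom_def using M by (simp add: Hom_def total_def)
qed

context
  fixes M X N Y \<theta> \<phi>
  assumes \<theta>: "\<theta> \<in> Hom C X Y" and \<phi>: "mhom M N \<phi>"
begin

lemma lin_simps: "tcm M" "tcm N" "\<theta> \<in> Arr C" "Dom C \<theta> = X" "Cod C \<theta> = Y" "\<phi> \<in> Arr C"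
  "Dom C \<phi> = cobj M" "Cod C \<phi> = cobj N" "total C \<phi>" "\<phi> \<in> Hom C (cobj M) (cobj N)" "X \<in> Obj C" "cobj M \<in> Obj C" "cobj N \<in> Obj C"
  using \<theta> \<phi> by (auto simp: mhom_def Hom_def)

lemma tuple_lin:
  assumes as: "set as \<subseteq> mpt Z e M" and x: "x \<in> pt Z e X" and ne: "as \<noteq> []"
  shows "tuple C as x \<Zsemi> lin M X N \<theta> \<phi> (length as) =
    Rst C (x \<Zsemi> \<theta>) \<Zsemi> (if length as = 1 then as ! 0 \<Zsemi> \<phi> else zero N Z)"
proof -
  note s = lin_simps
  let ?n = "length as"
  let ?P = "npow C (cobj M) X ?n" and ?p = "proj C (cobj M) X ?n ?n"
  let ?t = "tuple C as x" and ?r = "Rst C (x \<Zsemi> \<theta>)"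
  define k where "k = (if ?n = 1 then proj C (cobj M) X 1 0 \<Zsemi> \<phi> else zero N ?P)"
  note t = pt_simps[OF tuple_pt[OF as x]]
  note x' = pt_simps[OF x] pt_rst[OF x]
  have p: "?p \<in> Arr C" "Dom C ?p = ?P" "Cod C ?p = X" using s by auto
  have k: "k \<in> Arr C" "Dom C k = ?P" "Cod C k = cobj N"
    using s proj_simps[of "cobj M" X 0 1] by (auto simp: k_def)
  have tp: "?t \<Zsemi> ?p = x" using tuple_proj[OF as x, of ?n] s by simp
  have "?t \<Zsemi> (Rst C (?p \<Zsemi> \<theta>) \<Zsemi> k) = ?t \<Zsemi> Rst C (?p \<Zsemi> \<theta>) \<Zsemi> k"
    using s t p k by (simp add: assoc)
  also have "?t \<Zsemi> Rst C (?p \<Zsemi> \<theta>) = ?r \<Zsemi> ?t"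
    using s t p tp Comp_Rst[of ?t "?p \<Zsemi> \<theta>"] assoc[of ?t ?p \<theta>] by simp
  also have "?r \<Zsemi> ?t \<Zsemi> k = ?r \<Zsemi> (?t \<Zsemi> k)"
    using s t x' k by (simp add: assoc)
  also have "?t \<Zsemi> k = (if ?n = 1 then as ! 0 \<Zsemi> \<phi> else e \<Zsemi> zero N Z)"
  proof (cases "?n = 1")
    case True
    have "?t \<Zsemi> proj C (cobj M) X 1 0 = as ! 0" using tuple_proj[OF as x, of 0] s True by simp
    then show ?thesis
      using assoc[of ?t "proj C (cobj M) X 1 0" \<phi>] proj_simps[of "cobj M" X 0 1] s t True by (simp add: k_def)
  next
    case False
    then show ?thesis using Comp_zero[OF s(2), of ?t Z ?P] t by (simp add: k_def Hom_def)
  qed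
  also have "?r \<Zsemi> (if ?n = 1 then as ! 0 \<Zsemi> \<phi> else e \<Zsemi> zero N Z) = ?r \<Zsemi> (if ?n = 1 then as ! 0 \<Zsemi> \<phi> else zero N Z)"
    using s x' Rst_Comp_le(2)[of x \<theta>] assoc[of ?r e "zero N Z"] by simp
  finally show ?thesis using ne by (simp add: lin_def k_def)
qed

text \<open>For \<open>n = 1\<close> the clauses are those of the homomorphism
  \<open>\<phi>\<close>. For larger \<open>n\<close> the value is a zero of fixed restriction, which
  is additive because zero plus zero is zero.\<close>

lemma faa_map_lin: "faa_map M X N Y (lin M X N \<theta> \<phi>)"
  unfolding faa_map_def
proof (intro conjI allI impI ballI)
  note s = lin_simps
  have l0: "lin M X N \<theta> \<phi> 0 = \<theta>" by (simp add: lin_def)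
  show "tcm M" "tcm N" "lin M X N \<theta> \<phi> 0 \<in> Hom C X Y" using s \<theta> l0 by auto
  fix n :: nat assume n: "1 \<le> n"
  let ?P = "npow C (cobj M) X n" and ?p = "proj C (cobj M) X n n"
  have "Rst C (proj C (cobj M) X 1 0 \<Zsemi> \<phi>) = Id C (npow C (cobj M) X 1)"
    using Rst_Comp_total[of "proj C (cobj M) X 1 0" \<phi>] proj_simps[of "cobj M" X 0 1] s by simp
  then show "lin M X N \<theta> \<phi> n \<in> Hom C ?P (cobj N)"
    "Rst C (lin M X N \<theta> \<phi> n) = Rst C (?p \<Zsemi> lin M X N \<theta> \<phi> 0)"
    using s n proj_simps[of "cobj M" X 0 1] by (auto simp: lin_def Hom_def)
  fix Z e x a assume x: "x \<in> pt Z e X" and a: "a \<in> {..<n} \<rightarrow> mpt Z e M"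
  note x' = pt_simps[OF x] pt_rst[OF x]
  let ?r = "Rst C (x \<Zsemi> \<theta>)"
  have r: "rid Z ?r" "?r \<in> Hom C Z Z" "?r \<in> Arr C" "Cod C ?r = Z" using s x' by (auto simp: rid_def Hom_def)
  have re: "?r \<Zsemi> e = ?r" using Rst_Comp_le(2)[of x \<theta>] s x' by simp
  have rz: "?r \<Zsemi> zero N Z \<in> mpt Z ?r N" by (rule rid_zero_pt[OF s(2) r(1)])
  have tp: "tp b n x \<Zsemi> lin M X N \<theta> \<phi> n = ?r \<Zsemi> (if n = 1 then b 0 \<Zsemi> \<phi> else zero N Z)"
    if "b \<in> {..<n} \<rightarrow> mpt Z e M" for b
  proof -
    have "set (map b [0..<n]) \<subseteq> mpt Z e M" using that by auto
    from tuple_lin[OF this x] show ?thesis using n by (simp add: tp_def)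
  qed
  have upd: "a(i := u) \<in> {..<n} \<rightarrow> mpt Z e M" if "u \<in> mpt Z e M" for u i
    using a that by auto
  {
    fix i u v assume i: "i < n" and u: "u \<in> mpt Z e M" and v: "v \<in> mpt Z e M"
    have "?r \<Zsemi> (add M u v \<Zsemi> \<phi>) = add N (?r \<Zsemi> (u \<Zsemi> \<phi>)) (?r \<Zsemi> (v \<Zsemi> \<phi>))"
      using Comp_add[OF s(2) r(2)] \<phi> u v pt_Comp_total[OF u s(10,9)] pt_Comp_total[OF v s(10,9)]
      unfolding mhom_def by (auto simp: pt_def)
    then show "tp (a(i := add M u v)) n x \<Zsemi> lin M X N \<theta> \<phi> n =
      add N (tp (a(i := u)) n x \<Zsemi> lin M X N \<theta> \<phi> n) (tp (a(i := v)) n x \<Zsemi> lin M X N \<theta> \<phi> n)"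
      using i add_zero_pt[OF s(2) rz] tp[OF upd[OF u]] tp[OF upd[OF v]] tp[OF upd[OF add_pt[OF s(1) u v]]] by simp
  next
    fix i assume i: "i < n"
    have z: "e \<Zsemi> zero M Z \<in> mpt Z e M" using rid_zero_pt[OF s(1) pt_rid[OF x]] .
    have "e \<Zsemi> zero M Z \<Zsemi> \<phi> = e \<Zsemi> zero N Z"
      using \<phi> pt_rid[OF x] unfolding mhom_def by blast
    then show "tp (a(i := e \<Zsemi> zero M Z)) n x \<Zsemi> lin M X N \<theta> \<phi> n = Rst C (x \<Zsemi> lin M X N \<theta> \<phi> 0) \<Zsemi> zero N Z"
      using i tp[OF upd[OF z]] re r s x' assoc[of ?r e "zero N Z"] by (simp add: l0)
  next
    fix p assume p: "p permutes {..<n}"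
    have ap: "a \<circ> p \<in> {..<n} \<rightarrow> mpt Z e M"
      by (rule Pi_I) (use funcset_mem[OF a] permutes_in_image[OF p] in auto)
    have "p 0 = 0" if "n = 1" using permutes_in_image[OF p, of 0] that by auto
    then show "tp (a \<circ> p) n x \<Zsemi> lin M X N \<theta> \<phi> n = tp a n x \<Zsemi> lin M X N \<theta> \<phi> n"
      using tp[OF a] tp[OF ap] by simp
  }
qed

lemma
  assumes x: "x \<in> pt Z e X" and a: "a \<in> I \<rightarrow> mpt Z e M"
  shows ev_lin_singleton: "I = {i} \<Longrightarrow> ev (lin M X N \<theta> \<phi>) I a x = Rst C (x \<Zsemi> \<theta>) \<Zsemi> (a i \<Zsemi> \<phi>)"
    and ev_lin_zero: "\<lbrakk>finite I; I \<noteq> {}; \<nexists>i. I = {i}\<rbrakk> \<Longrightarrow> ev (lin M X N \<theta> \<phi>) I a x = Rst C (x \<Zsemi> \<theta>) \<Zsemi> zero N Z"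
proof -
  show "ev (lin M X N \<theta> \<phi>) I a x = Rst C (x \<Zsemi> \<theta>) \<Zsemi> (a i \<Zsemi> \<phi>)" if "I = {i}"
    using ev_list[OF faa_map_lin x, of "[i]" I a] tuple_lin[OF _ x, of "[a i]"] a that by simp
  assume I: "finite I" "I \<noteq> {}" and ns: "\<nexists>i. I = {i}"
  obtain l where l: "distinct l" "set l = I" "l \<noteq> []" by (rule list_of_finite[OF I])
  have "length l \<noteq> 1" using l ns by (auto simp: length_Suc_conv)
  then show "ev (lin M X N \<theta> \<phi>) I a x = Rst C (x \<Zsemi> \<theta>) \<Zsemi> zero N Z"
    using ev_list[OF faa_map_lin x l a] tuple_lin[OF map_pt[OF l(2) a] x] l(3) by simp
qed

end

lemma lin_0: "lin M X N \<theta> \<phi> 0 = \<theta>"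
  by (simp add: lin_def)

lemma faa_map_component:
  assumes f: "faa_map M X N Y f" and n: "n \<ge> 1"
  shows "f n = ev f {..<n} (proj C (cobj M) X n) (proj C (cobj M) X n n)"
proof -
  note s = faa_map_simps[OF f] faa_map_comp_simps[OF f n]
  have "tp (proj C (cobj M) X n) n (proj C (cobj M) X n n) \<Zsemi> f n = f n"
    unfolding tp_def using tuple_projs s by simp
  then show ?thesis using ev_tp[OF f projs_pt(1)[OF s(9,7)] n projs_pt(2)[OF s(9,7)]] by simp
qed

text \<open>The outer map vanishes on families of two or more arguments, so only the partition with
  the single block \<open>I\<close> contributes.\<close>

lemma ev_comp_lin:
  assumes f: "faa_map M X N Y f" and \<theta>: "\<theta> \<in> Hom C Y V" and \<phi>: "mhom N K \<phi>"
    and x: "x \<in> pt Z e X" and I: "finite I" "I \<noteq> {}" and a: "a \<in> I \<rightarrow> mpt Z e M"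
  shows "ev (faa_comp C (M, X) (K, V) f (lin N Y K \<theta> \<phi>)) I a x = Rst C (x \<Zsemi> f 0 \<Zsemi> \<theta>) \<Zsemi> (ev f I a x \<Zsemi> \<phi>)"
proof -
  note g = faa_map_lin[OF \<theta> \<phi>]
  let ?g = "lin N Y K \<theta> \<phi>"
  let ?r = "Rst C (x \<Zsemi> f 0 \<Zsemi> \<theta>)"
  let ?H = "pt_monoid Z ?r K"
  interpret H: comm_monoid ?H using comm_monoid_fg[OF f g x] by (simp add: lin_0)
  \<comment> \<open>A constant family, so that the sum takes the shape of one supported at the
    single index \<open>{I}\<close>, which \<open>finprod_singleton_swap\<close> collapses.\<close>
  let ?F = "\<lambda>_. ?r \<Zsemi> (ev f I a x \<Zsemi> \<phi>)"
  note xf = pt_f0[OF f g x]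
  have I_I: "partition_on I {I}" by (rule partition_on_space[OF I(2)])
  have one: "cterm f ?g a x {I} = ?r \<Zsemi> (ev f I a x \<Zsemi> \<phi>)"
    unfolding cterm_def
    by (rule ev_lin_singleton[OF \<theta> \<phi> xf ev_blocks[OF f g x I a I_I] refl])
  have other: "cterm f ?g a x \<pi> = \<one>\<^bsub>?H\<^esub>" if \<pi>: "partition_on I \<pi>" "\<pi> \<noteq> {I}" for \<pi>
  proof -
    note p = partition_props[OF I \<pi>(1)]
    have "\<nexists>B. \<pi> = {B}" using \<pi> by (auto simp: partition_on_def)
    then show ?thesis
      unfolding cterm_def pt_monoid_simps(3)
      by (intro ev_lin_zero[OF \<theta> \<phi> xf ev_blocks[OF f g x I a \<pi>(1)] p(1,2)])
  qed
  have cl: "?F \<in> (partitions I) \<rightarrow> carrier ?H"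
    using cterm_pt[OF f g x I a I_I] one by (simp add: lin_0)
  have "ev (faa_comp C (M, X) (K, V) f ?g) I a x = finprod ?H (cterm f ?g a x) (partitions I)"
    unfolding ev_comp[OF f g x I a] csum_def lin_0 ..
  also have "\<dots> = finprod ?H (\<lambda>\<pi>. if \<pi> = {I} then ?F \<pi> else \<one>\<^bsub>?H\<^esub>) (partitions I)"
  proof (rule H.finprod_cong')
    show "(\<lambda>\<pi>. if \<pi> = {I} then ?F \<pi> else \<one>\<^bsub>?H\<^esub>) \<in> (partitions I) \<rightarrow> carrier ?H"
      using funcset_mem[OF cl] H.one_closed by (intro Pi_I) (simp del: pt_monoid_simps)
    show "cterm f ?g a x \<pi> = (if \<pi> = {I} then ?F \<pi> else \<one>\<^bsub>?H\<^esub>)" if "\<pi> \<in> (partitions I)" for \<pi>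
      using one other[of \<pi>] that by (cases "\<pi> = {I}") (simp_all del: pt_monoid_simps)
  qed simp
  also have "\<dots> = ?F {I}"
    by (rule H.finprod_singleton_swap) (use I_I finitely_many_partition_on[OF I(1)] cl in auto)
  finally show ?thesis .
qed

text \<open>A block with two or more elements gives a zero argument, and \<open>g\<close> vanishes
  as soon as one argument is zero. Only the partition into singletons is left, and its blocks are
  reindexed by their elements.\<close>

lemma ev_lin_comp:
  assumes \<theta>: "\<theta> \<in> Hom C X Y" and \<phi>: "mhom M N \<phi>" and g: "faa_map N Y K V g"
    and x: "x \<in> pt Z e X" and I: "finite I" "I \<noteq> {}" and a: "a \<in> I \<rightarrow> mpt Z e M"
  shows "ev (faa_comp C (M, X) (K, V) (lin M X N \<theta> \<phi>) g) I a x =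
    ev g I (\<lambda>i. Rst C (x \<Zsemi> \<theta>) \<Zsemi> (a i \<Zsemi> \<phi>)) (x \<Zsemi> \<theta>)"
proof -
  let ?f = "lin M X N \<theta> \<phi>"
  note f = faa_map_lin[OF \<theta> \<phi>]
  let ?H = "pt_monoid Z (Rst C (x \<Zsemi> \<theta> \<Zsemi> g 0)) K"
  interpret H: comm_monoid ?H using comm_monoid_fg[OF f g x] by (simp add: lin_0)
  note xf = pt_f0[OF f g x, unfolded lin_0]
  let ?S = "(\<lambda>i. {i}) ` I"
  let ?F = "\<lambda>_. ev g I (\<lambda>i. Rst C (x \<Zsemi> \<theta>) \<Zsemi> (a i \<Zsemi> \<phi>)) (x \<Zsemi> \<theta>)"
  have S: "partition_on I ?S" by (rule partition_on_singletons)
  have one: "cterm ?f g a x ?S = ?F ?S"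
  proof -
    have "cterm ?f g a x ?S = ev g I (\<lambda>i. ev ?f {i} a x) (x \<Zsemi> \<theta>)"
      unfolding cterm_def lin_0
      by (rule ev_reindex[OF g xf I]) (use ev_blocks[OF f g x I a S, unfolded lin_0] in auto)
    also have "\<dots> = ?F ?S"
      by (rule ev_cong[OF I(1)], rule ev_lin_singleton[OF \<theta> \<phi> x _ refl]) (use a in auto)
    finally show ?thesis .
  qed
  have other: "cterm ?f g a x \<pi> = \<one>\<^bsub>?H\<^esub>" if \<pi>: "partition_on I \<pi>" "\<pi> \<noteq> ?S" for \<pi>
  proof -
    note p = partition_props[OF I \<pi>(1)]
    \<comment> \<open>A partition of \<open>I\<close> all of whose blocks are singletons must
      contain each \<open>{i}\<close>, and so equals \<open>?S\<close>.\<close>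
    have "\<exists>B\<in>\<pi>. \<nexists>i. B = {i}"
    proof (rule ccontr)
      assume "\<not> ?thesis"
      then have sing: "\<exists>i. B = {i}" if "B \<in> \<pi>" for B using that by blast
      have U: "\<Union>\<pi> = I" using \<pi>(1) by (simp add: partition_on_def)
      have "B \<in> ?S" if "B \<in> \<pi>" for B using sing[OF that] p(5)[OF that] by auto
      moreover have "{i} \<in> \<pi>" if i: "i \<in> I" for i
      proof -
        obtain B where "B \<in> \<pi>" "i \<in> B" using i U by auto
        then show ?thesis using sing[of B] by auto
      qed
      ultimately have "\<pi> = ?S" by auto
      then show False using \<pi>(2) by simp
    qed
    then obtain B where B: "B \<in> \<pi>" "\<nexists>i. B = {i}" by blast
    have z: "ev ?f B a x = Rst C (x \<Zsemi> \<theta>) \<Zsemi> zero N Z"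
      by (rule ev_lin_zero[OF \<theta> \<phi> x _ p(3)[OF B(1)] p(4)[OF B(1)] B(2)]) (use a p(5)[OF B(1)] in auto)
    have "cterm ?f g a x \<pi> = ev g \<pi> ((\<lambda>B. ev ?f B a x)(B := Rst C (x \<Zsemi> \<theta>) \<Zsemi> zero N Z)) (x \<Zsemi> \<theta>)"
      unfolding cterm_def lin_0 using z by (subst fun_upd_idem) simp_all
    also have "\<dots> = \<one>\<^bsub>?H\<^esub>"
      unfolding pt_monoid_simps(3)
      by (rule ev_zero[OF g xf p(1) B(1) ev_blocks[OF f g x I a \<pi>(1), unfolded lin_0]])
    finally show ?thesis .
  qed
  have cl: "?F \<in> (partitions I) \<rightarrow> carrier ?H"
    using cterm_pt[OF f g x I a S] one by (simp add: lin_0)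
  have "ev (faa_comp C (M, X) (K, V) ?f g) I a x = finprod ?H (cterm ?f g a x) (partitions I)"
    unfolding ev_comp[OF f g x I a] csum_def lin_0 ..
  also have "\<dots> = finprod ?H (\<lambda>\<pi>. if \<pi> = ?S then ?F \<pi> else \<one>\<^bsub>?H\<^esub>) (partitions I)"
  proof (rule H.finprod_cong')
    show "(\<lambda>\<pi>. if \<pi> = ?S then ?F \<pi> else \<one>\<^bsub>?H\<^esub>) \<in> (partitions I) \<rightarrow> carrier ?H"
      using funcset_mem[OF cl] H.one_closed by (intro Pi_I) (simp del: pt_monoid_simps)
    show "cterm ?f g a x \<pi> = (if \<pi> = ?S then ?F \<pi> else \<one>\<^bsub>?H\<^esub>)" if "\<pi> \<in> (partitions I)" for \<pi>
      using one other[of \<pi>] that by (cases "\<pi> = ?S") (simp_all del: pt_monoid_simps)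
  qed simp
  also have "\<dots> = ?F ?S"
    by (rule H.finprod_singleton_swap) (use S finitely_many_partition_on[OF I(1)] cl in auto)
  finally show ?thesis .
qed

section \<open>Identities, restrictions and the restriction axioms\<close>

lemma faa_id_eq_lin:
  assumes "tcm M" "X \<in> Obj C"
  shows "faa_id C (M, X) = lin M X M (Id C X) (Id C (cobj M))"
proof
  fix n
  show "faa_id C (M, X) n = lin M X M (Id C X) (Id C (cobj M)) n"
    using assms proj_simps[of "cobj M" X 0 1] by (simp add: faa_id_def lin_def Let_def)
qed

lemma faa_rst_eq_lin:
  assumes f: "faa_map M X N Y f"
  shows "faa_rst C (M, X) f = lin M X M (Rst C (f 0)) (Id C (cobj M))"
proof
  fix n
  note s = faa_map_simps[OF f]
  have "Rst C (proj C (cobj M) X n n \<Zsemi> Rst C (f 0)) = Rst C (proj C (cobj M) X n n \<Zsemi> f 0)"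
    using s by (intro Rst_Comp_Rst) auto
  then show "faa_rst C (M, X) f n = lin M X M (Rst C (f 0)) (Id C (cobj M)) n"
    using s proj_simps[of "cobj M" X 0 1] by (simp add: faa_rst_def lin_def Let_def)
qed

lemma faa_map_id: "\<lbrakk>tcm M; X \<in> Obj C\<rbrakk> \<Longrightarrow> faa_map M X M X (faa_id C (M, X))"
  unfolding faa_id_eq_lin by (rule faa_map_lin[OF Id_Hom mhom_Id])

lemma faa_map_rst:
  assumes f: "faa_map M X N Y f"
  shows "faa_map M X M X (faa_rst C (M, X) f)"
  unfolding faa_rst_eq_lin[OF f]
  by (rule faa_map_lin[OF Rst_Hom[OF faa_map_simps(3)[OF f]] mhom_Id[OF faa_map_simps(1)[OF f]]])

lemma faa_id_simps:
  assumes "tcm M" "X \<in> Obj C"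
  shows "faa_id C (M, X) n \<in> Arr C" "Dom C (faa_id C (M, X) n) = npow C (cobj M) X n"
    "Rst C (faa_id C (M, X) n) = Id C (npow C (cobj M) X n)"
  using assms proj_simps[of "cobj M" X 0 1] by (auto simp: faa_id_def Let_def)

lemma faa_map_Arr:
  assumes f: "faa_map M X N Y f"
  shows "f n \<in> Arr C" "Dom C (f n) = npow C (cobj M) X n"
    "Cod C (f n) = (if n = 0 then Y else cobj N)"
  using faa_map_simps[OF f] faa_map_comp_simps[OF f, of n] by (cases n; auto)+

lemma faa_map_Rst_eq:
  assumes f: "faa_map M X N Y f"
  shows "Rst C (f n) = Rst C (proj C (cobj M) X n n \<Zsemi> f 0)"
  using faa_map_simps[OF f] faa_map_comp_simps[OF f, of n] by (cases n) auto

lemma faa_rst_component: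
  assumes f: "faa_map M X N Y f"
  shows "faa_rst C (M, X) f n = Rst C (f n) \<Zsemi> faa_id C (M, X) n"
  using faa_map_simps[OF f] faa_map_Rst_eq[OF f, of n] by (simp add: faa_rst_def faa_id_def Let_def)

lemma comp_lin_component:
  assumes f: "faa_map M X N Y f" and \<theta>: "\<theta> \<in> Hom C Y V" and \<phi>: "mhom N K \<phi>" and n: "n \<ge> 1"
  shows "faa_comp C (M, X) (K, V) f (lin N Y K \<theta> \<phi>) n =
    Rst C (proj C (cobj M) X n n \<Zsemi> (f 0 \<Zsemi> \<theta>)) \<Zsemi> (f n \<Zsemi> \<phi>)"
proof -
  note s = faa_map_simps[OF f]
  have I: "finite {..<n}" "{..<n} \<noteq> {}" using n by (auto simp: lessThan_empty_iff)
  have \<theta>': "\<theta> \<in> Arr C" "Dom C \<theta> = Y" using \<theta> by (auto simp: Hom_def)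
  have "proj C (cobj M) X n n \<Zsemi> (f 0 \<Zsemi> \<theta>) = proj C (cobj M) X n n \<Zsemi> f 0 \<Zsemi> \<theta>"
    using s \<theta>' by (simp add: assoc)
  then show ?thesis
    using faa_map_component[OF faa_map_comp[OF f faa_map_lin[OF \<theta> \<phi>]] n]
      ev_comp_lin[OF f \<theta> \<phi> projs_pt(1)[OF s(9,7)] I projs_pt(2)[OF s(9,7)]]
      faa_map_component[OF f n] by simp
qed

text \<open>For total \<open>\<theta>\<close> the leading factor in
  \<open>comp_lin_component\<close> is the restriction of \<open>f n\<close>, which
  \<open>f n\<close> absorbs. Postcomposing with identities and projections thus acts on each
  component separately.\<close>

lemma comp_lin_total_component:
  assumes f: "faa_map M X N Y f" and \<theta>: "\<theta> \<in> Hom C Y V" "total C \<theta>" and \<phi>: "mhom N K \<phi>"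
  shows "faa_comp C (M, X) (K, V) f (lin N Y K \<theta> \<phi>) n = f n \<Zsemi> (if n = 0 then \<theta> else \<phi>)"
proof (cases "n = 0")
  case True
  then show ?thesis by (simp add: faa_comp_0 lin_0)
next
  case False
  then have n: "n \<ge> 1" by simp
  note s = faa_map_simps[OF f] faa_map_comp_simps[OF f n]
  have \<theta>': "\<theta> \<in> Arr C" "Dom C \<theta> = Y" using \<theta> by (auto simp: Hom_def)
  have \<phi>': "\<phi> \<in> Arr C" "Dom C \<phi> = cobj N" "total C \<phi>" using \<phi> by (auto simp: mhom_def Hom_def)
  have "Rst C (proj C (cobj M) X n n \<Zsemi> (f 0 \<Zsemi> \<theta>)) = Rst C (f n)"
    using Rst_Comp_total[of "proj C (cobj M) X n n \<Zsemi> f 0" \<theta>] s \<theta> \<theta>' by (simp add: assoc)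
  moreover have "Rst C (f n) \<Zsemi> (f n \<Zsemi> \<phi>) = f n \<Zsemi> \<phi>"
    by (rule Rst_left_Comp) (use s \<phi>' in auto)
  ultimately show ?thesis using comp_lin_component[OF f \<theta>(1) \<phi> n] False by simp
qed

text \<open>A restriction is linear with identity homomorphism part, so composing with it evaluates
  \<open>f n\<close> at the projections cut down by \<open>?r\<close>, and naturality pulls
  \<open>?r\<close> out in front. Together with \<open>faa_rst_component\<close> this turns R1, R2
  and R3 into statements about single components.\<close>

lemma rst_comp_component:
  assumes g: "faa_map M X K V g" and f: "faa_map M X N Y f"
  shows "faa_comp C (M, X) (N, Y) (faa_rst C (M, X) g) f n = Rst C (g n) \<Zsemi> f n"
proof (cases "n = 0")
  case True
  then show ?thesis by (simp add: faa_comp_0 faa_rst_eq_lin[OF g] lin_0)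
next
  case False
  then have n: "n \<ge> 1" by simp
  note s = faa_map_simps[OF f] and t = faa_map_simps[OF g]
  have I: "finite {..<n}" "{..<n} \<noteq> {}" using n by (auto simp: lessThan_empty_iff)
  let ?x = "proj C (cobj M) X n n" and ?a = "proj C (cobj M) X n" and ?P = "npow C (cobj M) X n"
  have x: "?x \<in> pt ?P (Id C ?P) X" and a: "?a \<in> {..<n} \<rightarrow> mpt ?P (Id C ?P) M"
    using projs_pt[OF s(9,7)] by auto
  let ?r = "Rst C (?x \<Zsemi> g 0)"
  have r: "?r \<in> Hom C ?P ?P" using s t by (simp add: Hom_def)
  have r': "Rst C (?x \<Zsemi> Rst C (g 0)) = ?r" using s t by (intro Rst_Comp_Rst) auto
  have rx: "?x \<Zsemi> Rst C (g 0) = ?r \<Zsemi> ?x" using s t by (intro Comp_Rst) auto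
  note rst = faa_map_rst[OF g]
  have "faa_comp C (M, X) (N, Y) (faa_rst C (M, X) g) f n =
      ev (faa_comp C (M, X) (N, Y) (faa_rst C (M, X) g) f) {..<n} ?a ?x"
    by (rule faa_map_component[OF faa_map_comp[OF rst f] n])
  also have "\<dots> = ev f {..<n} (\<lambda>i. ?r \<Zsemi> (?a i \<Zsemi> Id C (cobj M))) (?r \<Zsemi> ?x)"
    unfolding faa_rst_eq_lin[OF g]
    using ev_lin_comp[OF Rst_Hom[OF t(3)] mhom_Id[OF t(1)] f x I a] r' rx by simp
  also have "\<dots> = ev f {..<n} (\<lambda>i. ?r \<Zsemi> ?a i) (?r \<Zsemi> ?x)"
    by (rule ev_cong[OF I(1)]) (use s in auto)
  also have "\<dots> = ?r \<Zsemi> ev f {..<n} ?a ?x"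
    by (rule Comp_ev[OF f x I a r, symmetric])
  also have "\<dots> = Rst C (g n) \<Zsemi> f n"
    using faa_map_component[OF f n] faa_map_comp_simps(5)[OF g n] by simp
  finally show ?thesis .
qed

text \<open>The identity is its own restriction and its components are total, so this is a case of
  composing with a restriction.\<close>

lemma faa_id_left:
  assumes f: "faa_map M X N Y f"
  shows "faa_comp C (M, X) (N, Y) (faa_id C (M, X)) f = f"
proof
  fix n
  note s = faa_map_simps[OF f]
  note id = faa_map_id[OF s(1,7)]
  have "faa_rst C (M, X) (faa_id C (M, X)) = faa_id C (M, X)"
    using faa_rst_component[OF id] faa_id_simps[OF s(1,7)] by auto
  then show "faa_comp C (M, X) (N, Y) (faa_id C (M, X)) f n = f n"
    using rst_comp_component[OF id f, of n] faa_id_simps(3)[OF s(1,7)] faa_map_Arr[OF f, of n] by simp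
qed

lemma faa_id_right:
  assumes f: "faa_map M X N Y f"
  shows "faa_comp C (M, X) (N, Y) f (faa_id C (N, Y)) = f"
proof
  fix n
  note s = faa_map_simps[OF f]
  show "faa_comp C (M, X) (N, Y) f (faa_id C (N, Y)) n = f n"
    unfolding faa_id_eq_lin[OF s(2,8)]
    using comp_lin_total_component[OF f Id_Hom[OF s(8)] _ mhom_Id[OF s(2)]] faa_map_Arr[OF f, of n] s
    by (simp add: total_def)
qed

lemma faa_R1:
  assumes f: "faa_map M X N Y f"
  shows "faa_comp C (M, X) (N, Y) (faa_rst C (M, X) f) f = f"
  using rst_comp_component[OF f f] faa_map_Arr[OF f] by auto

lemma faa_R2:
  assumes f: "faa_map M X N Y f" and g: "faa_map M X K V g"
  shows "faa_comp C (M, X) (M, X) (faa_rst C (M, X) f) (faa_rst C (M, X) g) =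
    faa_comp C (M, X) (M, X) (faa_rst C (M, X) g) (faa_rst C (M, X) f)"
proof
  fix n
  note F = faa_map_Arr[OF f, of n] and G = faa_map_Arr[OF g, of n]
    and i = faa_id_simps[OF faa_map_simps(1,7)[OF f], of n]
  have "Rst C (f n) \<Zsemi> (Rst C (g n) \<Zsemi> faa_id C (M, X) n) = Rst C (f n) \<Zsemi> Rst C (g n) \<Zsemi> faa_id C (M, X) n"
    using F G i by (simp add: assoc)
  also have "Rst C (f n) \<Zsemi> Rst C (g n) = Rst C (g n) \<Zsemi> Rst C (f n)"
    using F G by (intro Rst_commute) auto
  also have "Rst C (g n) \<Zsemi> Rst C (f n) \<Zsemi> faa_id C (M, X) n = Rst C (g n) \<Zsemi> (Rst C (f n) \<Zsemi> faa_id C (M, X) n)"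
    using F G i by (simp add: assoc)
  finally show "faa_comp C (M, X) (M, X) (faa_rst C (M, X) f) (faa_rst C (M, X) g) n =
    faa_comp C (M, X) (M, X) (faa_rst C (M, X) g) (faa_rst C (M, X) f) n"
    by (simp only: rst_comp_component[OF f faa_map_rst[OF g]] rst_comp_component[OF g faa_map_rst[OF f]]
      faa_rst_component[OF f] faa_rst_component[OF g])
qed

lemma faa_R3:
  assumes f: "faa_map M X N Y f" and g: "faa_map M X K V g"
  shows "faa_rst C (M, X) (faa_comp C (M, X) (K, V) (faa_rst C (M, X) f) g) =
    faa_comp C (M, X) (M, X) (faa_rst C (M, X) f) (faa_rst C (M, X) g)"
proof
  fix n
  note F = faa_map_Arr[OF f, of n] and G = faa_map_Arr[OF g, of n]
    and i = faa_id_simps[OF faa_map_simps(1,7)[OF f], of n]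
  show "faa_rst C (M, X) (faa_comp C (M, X) (K, V) (faa_rst C (M, X) f) g) n =
    faa_comp C (M, X) (M, X) (faa_rst C (M, X) f) (faa_rst C (M, X) g) n"
    unfolding faa_rst_component[OF faa_map_comp[OF faa_map_rst[OF f] g]] rst_comp_component[OF f g]
      rst_comp_component[OF f faa_map_rst[OF g]] faa_rst_component[OF g]
    using F G i by (simp add: assoc)
qed

text \<open>In position 0 this is R4 of the base category. In later positions both sides are
  \<open>f n\<close> cut down to the domain of \<open>(fg)_n\<close>, which is that of the last
  projection followed by \<open>f 0 \<Zsemi> g 0\<close>.\<close>

lemma faa_R4:
  assumes f: "faa_map M X N Y f" and g: "faa_map N Y K V g"
  shows "faa_comp C (M, X) (N, Y) f (faa_rst C (N, Y) g) =
    faa_comp C (M, X) (N, Y) (faa_rst C (M, X) (faa_comp C (M, X) (K, V) f g)) f"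
proof
  fix n
  note s = faa_map_simps[OF f] and t = faa_map_simps[OF g]
  note fg = faa_map_comp[OF f g]
  show "faa_comp C (M, X) (N, Y) f (faa_rst C (N, Y) g) n =
    faa_comp C (M, X) (N, Y) (faa_rst C (M, X) (faa_comp C (M, X) (K, V) f g)) f n"
  proof (cases "n = 0")
    case True
    then show ?thesis
      unfolding True rst_comp_component[OF fg f] unfolding faa_comp_0 faa_rst_eq_lin[OF g] lin_0
      using s t by (intro Comp_Rst) auto
  next
    case False
    then have n: "n \<ge> 1" by simp
    let ?p = "proj C (cobj M) X n n"
    have "Rst C (?p \<Zsemi> (f 0 \<Zsemi> Rst C (g 0))) = Rst C (?p \<Zsemi> f 0 \<Zsemi> Rst C (g 0))"
      using s t by (simp add: assoc)
    also have "\<dots> = Rst C (?p \<Zsemi> f 0 \<Zsemi> g 0)" using s t by (intro Rst_Comp_Rst) auto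
    also have "\<dots> = Rst C (faa_comp C (M, X) (K, V) f g n)"
      using faa_map_Rst_eq[OF fg, of n] s t by (simp add: faa_comp_0 assoc)
    finally show ?thesis
      unfolding rst_comp_component[OF fg f] faa_rst_eq_lin[OF g]
      using comp_lin_component[OF f Rst_Hom[OF t(3)] mhom_Id[OF s(2)] n] faa_map_comp_simps[OF f n] by simp
  qed
qed

text \<open>The restriction of every \<open>f n\<close> is governed by \<open>f 0\<close>, and the
  last projection is total, so totality is decided in position 0.\<close>

lemma faa_rst_eq_id_iff:
  assumes f: "faa_map M X N Y f"
  shows "faa_rst C (M, X) f = faa_id C (M, X) \<longleftrightarrow> total C (f 0)"
proof
  note s = faa_map_simps[OF f]
  assume "faa_rst C (M, X) f = faa_id C (M, X)"
  then have "faa_rst C (M, X) f 0 = faa_id C (M, X) 0" by simp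
  then show "total C (f 0)" using s by (simp add: faa_rst_def faa_id_def Let_def total_def)
next
  note s = faa_map_simps[OF f]
  assume t: "total C (f 0)"
  have "Rst C (f n) = Id C (npow C (cobj M) X n)" for n
    using faa_map_Rst_eq[OF f, of n] Rst_Comp_total[OF _ t, of "proj C (cobj M) X n n"] s by simp
  then show "faa_rst C (M, X) f = faa_id C (M, X)"
    using faa_rst_component[OF f] faa_id_simps[OF s(1,7)] by auto
qed

subsection \<open>Products of monoids\<close>

definition one_cmon :: "('o, 'm) cmon" where
  "one_cmon = CMon (One C) (bang C (Prod C (One C) (One C))) (Id C (One C))"

definition prod_cmon :: "('o, 'm) cmon \<Rightarrow> ('o, 'm) cmon \<Rightarrow> ('o, 'm) cmon" where
  "prod_cmon M N =
     (let A = cobj M; B = cobj N; AB = Prod C A B; P = prj0 C AB AB; Q = prj1 C AB AB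
      in CMon AB
        (pair C (add M (P \<Zsemi> prj0 C A B) (Q \<Zsemi> prj0 C A B)) (add N (P \<Zsemi> prj1 C A B) (Q \<Zsemi> prj1 C A B)))
        (pair C (czero M) (czero N)))"

text \<open>Two maps into the terminal object with the same restriction are equal, so each law only
  needs both sides to be total.\<close>

lemma tcm_one: "tcm one_cmon"
proof -
  note O = One_Obj
  let ?I = "One C" and ?II = "Prod C (One C) (One C)"
  have bH: "bang C ?II \<in> Hom C ?II ?I" "total C (bang C ?II)" using O by (auto simp: Hom_def total_def)
  have iH: "Id C ?I \<in> Hom C ?I ?I" "total C (Id C ?I)" using O by (auto simp: Hom_def total_def)
  have sel: "cobj one_cmon = ?I" "cadd one_cmon = bang C ?II" "czero one_cmon = Id C ?I"
    by (auto simp: one_cmon_def)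
  have ad: "add one_cmon u v \<in> pt T e ?I" if "u \<in> pt T e ?I" "v \<in> pt T e ?I" for T e u v
    unfolding add_maps_def sel by (rule pt_Comp_total[OF pair_pt(1)[OF that] bH])
  have z: "zero one_cmon ?I \<in> pt ?I (Id C ?I) ?I"
    unfolding zero_map_def sel by (rule pt_Comp_total[OF _ iH]) (use O in \<open>auto intro!: ptI\<close>)
  have i: "Id C ?I \<in> pt ?I (Id C ?I) ?I" using O by (auto intro!: ptI)
  have eqI: "u = v" if "u \<in> pt T e ?I" "v \<in> pt T e ?I" for T e u v
    using to_One_eqI[of u T v] that by (auto simp: pt_def)
  let ?T = "Prod C ?II ?I"
  have pq: "prj0 C ?I ?I \<in> pt ?II (Id C ?II) ?I" "prj1 C ?I ?I \<in> pt ?II (Id C ?II) ?I"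
    using O by (auto intro!: ptI)
  have pqH: "prj0 C ?I ?I \<in> Hom C ?II ?I" "prj1 C ?I ?I \<in> Hom C ?II ?I"
    using pq by (auto simp: pt_def)
  have P: "prj0 C ?II ?I \<in> pt ?T (Id C ?T) ?II" using O by (auto intro!: ptI)
  note a = pt_Comp_total[OF P pqH(1) prj_total(1)[OF O O]] and b = pt_Comp_total[OF P pqH(2) prj_total(2)[OF O O]]
  have c: "prj1 C ?II ?I \<in> pt ?T (Id C ?T) ?I" using O by (auto intro!: ptI)
  show ?thesis
    unfolding total_comm_monoid_def Let_def sel(1)
    using O bH iH eqI[OF ad[OF ad[OF a b] c] ad[OF a ad[OF b c]]] eqI[OF ad[OF z i] i] eqI[OF ad[OF i z] i]
      eqI[OF ad[OF pq] ad[OF pq(2,1)]] by (simp only: sel simp_thms)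
qed

lemma cobj_one [simp]: "cobj one_cmon = One C"
  by (simp add: one_cmon_def)

lemma mhom_bang:
  assumes M: "tcm M"
  shows "mhom M one_cmon (bang C (cobj M))"
proof -
  have A: "cobj M \<in> Obj C" using M by simp
  have b: "bang C (cobj M) \<in> Hom C (cobj M) (One C)" "total C (bang C (cobj M))"
    using A by (auto simp: Hom_def total_def)
  note pO = pt_Comp_total[OF _ b]
  have eqI: "u = v" if "u \<in> pt Z e (One C)" "v \<in> pt Z e (One C)" for Z e u v
    using to_One_eqI[of u Z v] that by (auto simp: pt_def)
  have "add M u v \<Zsemi> bang C (cobj M) = add one_cmon (u \<Zsemi> bang C (cobj M)) (v \<Zsemi> bang C (cobj M))"
    if "u \<in> mpt Z e M" "v \<in> mpt Z e M" for Z e u v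
    by (rule eqI[OF pO[OF add_pt[OF M that]] add_pt[OF tcm_one, unfolded cobj_one, OF pO[OF that(1)] pO[OF that(2)]]])
  moreover have "e \<Zsemi> zero M Z \<Zsemi> bang C (cobj M) = e \<Zsemi> zero one_cmon Z" if "rid Z e" for Z e
    by (rule eqI[OF pO[OF rid_zero_pt[OF M that]] rid_zero_pt[OF tcm_one that, unfolded cobj_one]])
  ultimately show ?thesis unfolding mhom_def using M tcm_one b by simp
qed

context
  fixes M N
  assumes M: "tcm M" and N: "tcm N"
begin

lemma cobj_prod [simp]: "cobj (prod_cmon M N) = Prod C (cobj M) (cobj N)"
  by (simp add: prod_cmon_def Let_def)

text \<open>The structure maps are given by projections. Pulling them back along the pairing of
  \<open>u\<close> and \<open>v\<close>, or along the map to the terminal object, turns them into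
  componentwise operations on points.\<close>

lemma prod_cmon_data:
  defines "A \<equiv> cobj M" and "B \<equiv> cobj N"
  shows "cadd (prod_cmon M N) \<in> Hom C (Prod C (Prod C A B) (Prod C A B)) (Prod C A B)"
    "total C (cadd (prod_cmon M N))"
    "czero (prod_cmon M N) \<in> Hom C (One C) (Prod C A B)" "total C (czero (prod_cmon M N))"
    and prod_add_pt: "\<lbrakk>u \<in> pt Z e (Prod C A B); v \<in> pt Z e (Prod C A B)\<rbrakk> \<Longrightarrow>
      add (prod_cmon M N) u v \<in> pt Z e (Prod C A B) \<and>
      add (prod_cmon M N) u v \<Zsemi> prj0 C A B = add M (u \<Zsemi> prj0 C A B) (v \<Zsemi> prj0 C A B) \<and>
      add (prod_cmon M N) u v \<Zsemi> prj1 C A B = add N (u \<Zsemi> prj1 C A B) (v \<Zsemi> prj1 C A B)"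
    and prod_zero_pt: "rid Z e \<Longrightarrow> e \<Zsemi> zero (prod_cmon M N) Z \<in> pt Z e (Prod C A B) \<and>
      e \<Zsemi> zero (prod_cmon M N) Z \<Zsemi> prj0 C A B = e \<Zsemi> zero M Z \<and>
      e \<Zsemi> zero (prod_cmon M N) Z \<Zsemi> prj1 C A B = e \<Zsemi> zero N Z"
proof -
  let ?AB = "Prod C A B"
  let ?S = "Prod C ?AB ?AB"
  let ?P = "prj0 C ?AB ?AB" and ?Q = "prj1 C ?AB ?AB" and ?p = "prj0 C A B" and ?q = "prj1 C A B"
  have O: "A \<in> Obj C" "B \<in> Obj C" "?AB \<in> Obj C" "?S \<in> Obj C"
    using M N by (auto simp: A_def B_def)
  have pq: "?p \<in> Hom C ?AB A" "total C ?p" "?q \<in> Hom C ?AB B" "total C ?q"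
    using O by (auto simp: Hom_def prj_total)
  have PQ: "?P \<in> pt ?S (Id C ?S) ?AB" "?Q \<in> pt ?S (Id C ?S) ?AB"
    using O by (auto intro!: ptI)
  note c = pt_Comp_total[OF PQ(1) pq(1,2)] pt_Comp_total[OF PQ(2) pq(1,2)]
    pt_Comp_total[OF PQ(1) pq(3,4)] pt_Comp_total[OF PQ(2) pq(3,4)]
  let ?s = "add M (?P \<Zsemi> ?p) (?Q \<Zsemi> ?p)" and ?t = "add N (?P \<Zsemi> ?q) (?Q \<Zsemi> ?q)"
  have st: "?s \<in> pt ?S (Id C ?S) A" "?t \<in> pt ?S (Id C ?S) B"
    using add_pt[OF M] add_pt[OF N] c by (auto simp: A_def B_def)
  note pst = pair_pt[OF st]
  have ca: "cadd (prod_cmon M N) = pair C ?s ?t" "czero (prod_cmon M N) = pair C (czero M) (czero N)"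
    by (auto simp: prod_cmon_def Let_def A_def B_def)
  show "cadd (prod_cmon M N) \<in> Hom C ?S ?AB" "total C (cadd (prod_cmon M N))"
    using pst(1) pt_simps[OF pst(1)] by (auto simp: ca pt_def total_def)
  have z: "czero M \<in> pt (One C) (Id C (One C)) A" "czero N \<in> pt (One C) (Id C (One C)) B"
    using M N tcm_simps(9)[OF M] tcm_simps(9)[OF N] by (auto intro!: ptI simp: A_def B_def total_def)
  note pz = pair_pt[OF z]
  show "czero (prod_cmon M N) \<in> Hom C (One C) ?AB" "total C (czero (prod_cmon M N))"
    using pz(1) pt_simps[OF pz(1)] by (auto simp: ca pt_def total_def)
  {
    assume u: "u \<in> pt Z e ?AB" and v: "v \<in> pt Z e ?AB"
    note uv = pair_pt[OF u v]
    have uvH: "pair C u v \<in> Hom C Z ?S" "pair C u v \<in> Arr C" "Cod C (pair C u v) = ?S"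
      using uv(1) pt_simps[OF uv(1)] by (auto simp: pt_def)
    have x: "pair C u v \<Zsemi> (?P \<Zsemi> k) = u \<Zsemi> k" "pair C u v \<Zsemi> (?Q \<Zsemi> k) = v \<Zsemi> k"
      if "k \<in> Arr C" "Dom C k = ?AB" for k
      using uv uvH O that by (auto simp: assoc[symmetric])
    have s: "pair C u v \<Zsemi> ?s = add M (u \<Zsemi> ?p) (v \<Zsemi> ?p)"
      using Comp_add[OF M uvH(1), of "?P \<Zsemi> ?p" "?Q \<Zsemi> ?p"] c x O by (simp add: pt_def A_def)
    have t: "pair C u v \<Zsemi> ?t = add N (u \<Zsemi> ?q) (v \<Zsemi> ?q)"
      using Comp_add[OF N uvH(1), of "?P \<Zsemi> ?q" "?Q \<Zsemi> ?q"] c x O by (simp add: pt_def B_def)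
    have "add (prod_cmon M N) u v = pair C u v \<Zsemi> pair C ?s ?t" by (simp add: add_maps_def ca)
    moreover have "pair C u v \<Zsemi> pair C ?s ?t \<in> pt Z e ?AB"
      using pst(1) pt_simps[OF pst(1)] by (intro pt_Comp_total[OF uv(1)]) (auto simp: pt_def total_def)
    moreover have "pair C u v \<Zsemi> pair C ?s ?t \<Zsemi> ?p = pair C u v \<Zsemi> ?s"
      "pair C u v \<Zsemi> pair C ?s ?t \<Zsemi> ?q = pair C u v \<Zsemi> ?t"
      using uvH pst pt_simps[OF pst(1)] O by (auto simp: assoc)
    ultimately show "add (prod_cmon M N) u v \<in> pt Z e ?AB \<and>
      add (prod_cmon M N) u v \<Zsemi> ?p = add M (u \<Zsemi> ?p) (v \<Zsemi> ?p) \<and>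
      add (prod_cmon M N) u v \<Zsemi> ?q = add N (u \<Zsemi> ?q) (v \<Zsemi> ?q)"
      using s t by simp
  next
    assume e: "rid Z e"
    then have e': "e \<in> Arr C" "Dom C e = Z" "Cod C e = Z" "Rst C e = e" "Z \<in> Obj C" by (auto simp: rid_def)
    have bz: "bang C Z \<in> Arr C" "Cod C (bang C Z) = One C" "Dom C (bang C Z) = Z" using e' by auto
    have eb: "e \<Zsemi> bang C Z \<in> pt Z e (One C)"
      using e' bz by (intro ptI) (auto simp: Rst_Comp_total total_def)
    have "e \<Zsemi> zero (prod_cmon M N) Z = e \<Zsemi> bang C Z \<Zsemi> pair C (czero M) (czero N)"
      using pt_simps[OF pz(1)] e' bz by (simp add: zero_map_def ca assoc)
    moreover have "e \<Zsemi> bang C Z \<Zsemi> pair C (czero M) (czero N) \<in> pt Z e ?AB"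
      using pz(1) pt_simps[OF pz(1)] by (intro pt_Comp_total[OF eb]) (auto simp: pt_def total_def)
    moreover have "e \<Zsemi> bang C Z \<Zsemi> pair C (czero M) (czero N) \<Zsemi> ?p = e \<Zsemi> zero M Z"
      "e \<Zsemi> bang C Z \<Zsemi> pair C (czero M) (czero N) \<Zsemi> ?q = e \<Zsemi> zero N Z"
      using pz pt_simps[OF pz(1)] O e' bz M N by (auto simp: assoc zero_map_def)
    ultimately show "e \<Zsemi> zero (prod_cmon M N) Z \<in> pt Z e ?AB \<and>
      e \<Zsemi> zero (prod_cmon M N) Z \<Zsemi> ?p = e \<Zsemi> zero M Z \<and> e \<Zsemi> zero (prod_cmon M N) Z \<Zsemi> ?q = e \<Zsemi> zero N Z"
      by simp
  }
qed

lemma prod_pt_eqI: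
  assumes "u \<in> pt Z e (Prod C (cobj M) (cobj N))" "v \<in> pt Z e (Prod C (cobj M) (cobj N))"
    "u \<Zsemi> prj0 C (cobj M) (cobj N) = v \<Zsemi> prj0 C (cobj M) (cobj N)"
    "u \<Zsemi> prj1 C (cobj M) (cobj N) = v \<Zsemi> prj1 C (cobj M) (cobj N)"
  shows "u = v"
  by (rule Prod_eqI[OF _ _ _ _ assms(3,4)]) (use assms(1,2) M N in \<open>auto simp: pt_def\<close>)

text \<open>Each law holds after both projections, and a map into the product is determined by
  these. The diagrams are then the laws at the relevant projections, which have a common
  restriction.\<close>

lemma tcm_prod: "tcm (prod_cmon M N)"
proof -
  let ?A = "cobj M" and ?B = "cobj N"
  let ?AB = "Prod C ?A ?B"
  let ?p = "prj0 C ?A ?B" and ?q = "prj1 C ?A ?B"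
  have O: "?A \<in> Obj C" "?B \<in> Obj C" "?AB \<in> Obj C" using M N by auto
  have pq: "?p \<in> Hom C ?AB ?A" "total C ?p" "?q \<in> Hom C ?AB ?B" "total C ?q"
    using O by (auto simp: Hom_def prj_total)
  note ap = prod_add_pt and zp = prod_zero_pt
  have up: "u \<Zsemi> ?p \<in> pt Z e ?A" "u \<Zsemi> ?q \<in> pt Z e ?B" if "u \<in> pt Z e ?AB" for u Z e
    using pt_Comp_total[OF that pq(1,2)] pt_Comp_total[OF that pq(3,4)] .
  have comm: "add (prod_cmon M N) u v = add (prod_cmon M N) v u"
    if "u \<in> pt Z e ?AB" "v \<in> pt Z e ?AB" for u v Z e
    by (rule prod_pt_eqI)
      (use ap[OF that] ap[OF that(2,1)] add_commute_pt[OF M up(1)[OF that(1)] up(1)[OF that(2)]]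
        add_commute_pt[OF N up(2)[OF that(1)] up(2)[OF that(2)]] in auto)
  have ass: "add (prod_cmon M N) (add (prod_cmon M N) u v) w = add (prod_cmon M N) u (add (prod_cmon M N) v w)"
    if "u \<in> pt Z e ?AB" "v \<in> pt Z e ?AB" "w \<in> pt Z e ?AB" for u v w Z e
  proof -
    note uv = ap[OF that(1,2)] and vw = ap[OF that(2,3)]
    show ?thesis
      by (rule prod_pt_eqI)
        (use uv vw ap[OF conjunct1[OF uv] that(3)] ap[OF that(1) conjunct1[OF vw]]
          add_assoc_pt[OF M up(1)[OF that(1)] up(1)[OF that(2)] up(1)[OF that(3)]]
          add_assoc_pt[OF N up(2)[OF that(1)] up(2)[OF that(2)] up(2)[OF that(3)]] in auto)
  qed
  have unit: "add (prod_cmon M N) (e \<Zsemi> zero (prod_cmon M N) Z) u = u" if "u \<in> pt Z e ?AB" for u Z e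
  proof -
    note z = zp[OF pt_rid[OF that]]
    show ?thesis
      by (rule prod_pt_eqI[OF _ that])
        (use z ap[OF conjunct1[OF z] that] add_zero_pt[OF M up(1)[OF that]] add_zero_pt[OF N up(2)[OF that]] in auto)
  qed
  let ?S = "Prod C ?AB ?AB" and ?T = "Prod C (Prod C ?AB ?AB) ?AB"
  let ?P = "prj0 C ?AB ?AB" and ?Q = "prj1 C ?AB ?AB"
  let ?a = "prj0 C ?S ?AB \<Zsemi> ?P" and ?b = "prj0 C ?S ?AB \<Zsemi> ?Q" and ?c = "prj1 C ?S ?AB"
  have O': "?S \<in> Obj C" "?T \<in> Obj C" using O by auto
  have PQ: "?P \<in> pt ?S (Id C ?S) ?AB" "?Q \<in> pt ?S (Id C ?S) ?AB" using O O' by (auto intro!: ptI)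
  have abc: "?a \<in> pt ?T (Id C ?T) ?AB" "?b \<in> pt ?T (Id C ?T) ?AB" "?c \<in> pt ?T (Id C ?T) ?AB"
    using O O' prj_total[OF O(3,3)] by (auto intro!: ptI simp: Rst_Comp_total)
  have i: "Id C ?AB \<in> pt ?AB (Id C ?AB) ?AB" using O by (auto intro!: ptI)
  have zz: "Id C ?AB \<Zsemi> zero (prod_cmon M N) ?AB = zero (prod_cmon M N) ?AB"
  proof -
    have "zero (prod_cmon M N) ?AB \<in> Arr C \<and> Dom C (zero (prod_cmon M N) ?AB) = ?AB"
      unfolding zero_map_def using prod_cmon_data(3) O by (auto simp: Hom_def)
    then show ?thesis by simp
  qed
  have zpt: "zero (prod_cmon M N) ?AB \<in> pt ?AB (Id C ?AB) ?AB"
    using zp[OF rid_Id[OF O(3)]] zz by simp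
  show ?thesis
    unfolding total_comm_monoid_def Let_def cobj_prod
    using O(3) prod_cmon_data ass[OF abc] comm[OF PQ] unit[OF i] comm[OF i zpt] zz by simp
qed

lemma mhom_prj:
  "mhom (prod_cmon M N) M (prj0 C (cobj M) (cobj N))"
  "mhom (prod_cmon M N) N (prj1 C (cobj M) (cobj N))"
  unfolding mhom_def
  using M N tcm_prod prod_add_pt prod_zero_pt prj_total[of "cobj M" "cobj N"] by (auto simp: Hom_def)

end

lemma Rst_pair_Hom:
  assumes "u \<in> pt Z d A" "v \<in> pt Z e B"
  shows "pair C u v \<in> pt Z (d \<Zsemi> e) (Prod C A B)"
    "pair C u v \<Zsemi> prj0 C A B = e \<Zsemi> u" "pair C u v \<Zsemi> prj1 C A B = d \<Zsemi> v"
  using pt_simps[OF assms(1)] pt_simps[OF assms(2)] by (auto intro!: ptI simp: pair_prj)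

text \<open>At a point the values of \<open>f n\<close> and \<open>g n\<close> have restrictions
  \<open>?r\<close> and \<open>?q\<close> that may differ, so their pairing lives on the meet of the
  two. Additivity and the zero law are checked after projecting to \<open>N\<close> and
  \<open>K\<close>.\<close>

lemma faa_map_pair:
  assumes f: "faa_map M X N Y f" and g: "faa_map M X K V g"
  shows "faa_map M X (prod_cmon N K) (Prod C Y V) (\<lambda>n. pair C (f n) (g n))"
  unfolding faa_map_def
proof (intro conjI allI impI ballI)
  note s = faa_map_simps[OF f] and t = faa_map_simps[OF g]
  note NK = tcm_prod[OF s(2) t(2)]
  show "tcm M" "tcm (prod_cmon N K)" "pair C (f 0) (g 0) \<in> Hom C X (Prod C Y V)"
    using s t NK by (auto simp: Hom_def)
  fix n :: nat assume n: "1 \<le> n"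
  let ?P = "npow C (cobj M) X n" and ?p = "proj C (cobj M) X n n"
  note sn = faa_map_comp_simps[OF f n] and tn = faa_map_comp_simps[OF g n]
  show "pair C (f n) (g n) \<in> Hom C ?P (cobj (prod_cmon N K))"
    using sn tn cobj_prod[OF s(2) t(2)] by (auto simp: Hom_def)
  have "Rst C (?p \<Zsemi> pair C (f 0) (g 0)) = Rst C (pair C (?p \<Zsemi> f 0) (?p \<Zsemi> g 0))"
    using s t by (subst Comp_pair) auto
  then show "Rst C (pair C (f n) (g n)) = Rst C (?p \<Zsemi> pair C (f 0) (g 0))"
    using s t sn tn by simp
  fix Z e x a assume x: "x \<in> pt Z e X" and a: "a \<in> {..<n} \<rightarrow> mpt Z e M"
  let ?u = "\<lambda>b. tp b n x \<Zsemi> f n" and ?v = "\<lambda>b. tp b n x \<Zsemi> g n"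
  let ?r = "Rst C (x \<Zsemi> f 0)" and ?q = "Rst C (x \<Zsemi> g 0)"
  note x' = pt_simps[OF x]
  have I: "finite {..<n}" "{..<n} \<noteq> {}" using n by (auto simp: lessThan_empty_iff)
  have tpp: "tp b n x \<Zsemi> pair C (f n) (g n) = pair C (?u b) (?v b) \<and>
      ?u b \<in> mpt Z ?r N \<and> ?v b \<in> mpt Z ?q K" if b: "b \<in> {..<n} \<rightarrow> mpt Z e M" for b
  proof -
    have "set (map b [0..<n]) \<subseteq> mpt Z e M" using b by auto
    from tuple_pt[OF this x] have "tp b n x \<in> pt Z e ?P" by (simp add: tp_def)
    then have "tp b n x \<in> Arr C" "Cod C (tp b n x) = ?P" by (auto dest: pt_simps)
    then have "tp b n x \<Zsemi> pair C (f n) (g n) = pair C (?u b) (?v b)"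
      using sn tn by (intro Comp_pair) auto
    then show ?thesis
      using ev_pt[OF f x I b] ev_pt[OF g x I b] ev_tp[OF f x n b] ev_tp[OF g x n b] by simp
  qed
  have rq: "?r \<in> Hom C Z Z" "?q \<in> Hom C Z Z" "?r \<in> Arr C" "?q \<in> Arr C" "Cod C ?r = Z" "Cod C ?q = Z" "Dom C ?r = Z" "Dom C ?q = Z" "Rst C ?r = ?r" "Rst C ?q = ?q"
    using s t x' by (auto simp: Hom_def)
  have qr: "?q \<Zsemi> ?r = ?r \<Zsemi> ?q" using s t x' by (intro Rst_commute) auto
  have upd: "a(i := u) \<in> {..<n} \<rightarrow> mpt Z e M" if "u \<in> mpt Z e M" for u i
    using a that by auto
  {
    fix i u v assume i: "i < n" and u: "u \<in> mpt Z e M" and v: "v \<in> mpt Z e M"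
    note U = tpp[OF upd[OF u, of i]] and V = tpp[OF upd[OF v, of i]]
    note uv = tpp[OF upd[OF add_pt[OF s(1) u v], of i]]
    have fU: "?u (a(i := u)) \<in> mpt Z ?r N" and gU: "?v (a(i := u)) \<in> mpt Z ?q K"
      and fV: "?u (a(i := v)) \<in> mpt Z ?r N" and gV: "?v (a(i := v)) \<in> mpt Z ?q K"
      using U V by auto
    have fadd: "?u (a(i := add M u v)) = add N (?u (a(i := u))) (?u (a(i := v)))"
      using f n x a i u v unfolding faa_map_def by blast
    have gadd: "?v (a(i := add M u v)) = add K (?v (a(i := u))) (?v (a(i := v)))"
      using g n x a i u v unfolding faa_map_def by blast
    let ?l = "pair C (add N (?u (a(i := u))) (?u (a(i := v)))) (add K (?v (a(i := u))) (?v (a(i := v))))"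
    let ?k = "add (prod_cmon N K) (pair C (?u (a(i := u))) (?v (a(i := u)))) (pair C (?u (a(i := v))) (?v (a(i := v))))"
    note pU = Rst_pair_Hom[OF fU gU] and pV = Rst_pair_Hom[OF fV gV]
    note pUV = Rst_pair_Hom[OF add_pt[OF s(2) fU fV] add_pt[OF t(2) gU gV]]
    note rhs = prod_add_pt[OF s(2) t(2) pU(1) pV(1)]
    have "?l =
      ?k"
    proof (rule prod_pt_eqI[OF s(2) t(2) pUV(1) conjunct1[OF rhs]])
      show "?l \<Zsemi> prj0 C (cobj N) (cobj K) =
        ?k \<Zsemi> prj0 C (cobj N) (cobj K)"
        \<comment> \<open>Projecting to the first factor leaves the restriction \<open>?q\<close> of
          the other factor in front, and precomposition with it distributes over the sum.\<close>
        unfolding conjunct1[OF conjunct2[OF rhs]] pUV(2) pU(2) pV(2)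
        by (rule Comp_add[OF s(2) rq(2)]) (use fU fV in \<open>auto simp: pt_def\<close>)
      show "?l \<Zsemi> prj1 C (cobj N) (cobj K) =
        ?k \<Zsemi> prj1 C (cobj N) (cobj K)"
        unfolding conjunct2[OF conjunct2[OF rhs]] pUV(3) pU(3) pV(3)
        by (rule Comp_add[OF t(2) rq(1)]) (use gU gV in \<open>auto simp: pt_def\<close>)
    qed
    then show "tp (a(i := add M u v)) n x \<Zsemi> pair C (f n) (g n) = add (prod_cmon N K)
        (tp (a(i := u)) n x \<Zsemi> pair C (f n) (g n)) (tp (a(i := v)) n x \<Zsemi> pair C (f n) (g n))"
      unfolding conjunct1[OF U] conjunct1[OF V] conjunct1[OF uv] fadd gadd .
  next
    fix i assume i: "i < n"
    have z: "e \<Zsemi> zero M Z \<in> mpt Z e M" using rid_zero_pt[OF s(1) pt_rid[OF x]] .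
    note Zt = tpp[OF upd[OF z, of i]]
    have fz: "?u (a(i := e \<Zsemi> zero M Z)) = ?r \<Zsemi> zero N Z" using f n x a i unfolding faa_map_def by blast
    have gz: "?v (a(i := e \<Zsemi> zero M Z)) = ?q \<Zsemi> zero K Z" using g n x a i unfolding faa_map_def by blast
    have r: "rid Z ?r" and q: "rid Z ?q" and rqr: "rid Z (?r \<Zsemi> ?q)" using rq Rst_Rst_Comp[of "x \<Zsemi> f 0" ?q] s t x' by (auto simp: rid_def)
    note p = Rst_pair_Hom[OF rid_zero_pt[OF s(2) r] rid_zero_pt[OF t(2) q]]
    note pz = prod_zero_pt[OF s(2) t(2) rqr]
    have Zo: "Z \<in> Obj C" using pt_rst[OF x] by simp
    have "pair C (?r \<Zsemi> zero N Z) (?q \<Zsemi> zero K Z) = ?r \<Zsemi> ?q \<Zsemi> zero (prod_cmon N K) Z"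
    proof (rule prod_pt_eqI[OF s(2) t(2) p(1) conjunct1[OF pz]])
      show "pair C (?r \<Zsemi> zero N Z) (?q \<Zsemi> zero K Z) \<Zsemi> prj0 C (cobj N) (cobj K) =
        ?r \<Zsemi> ?q \<Zsemi> zero (prod_cmon N K) Z \<Zsemi> prj0 C (cobj N) (cobj K)"
        unfolding conjunct1[OF conjunct2[OF pz]] p(2)
        using rq s t Zo qr assoc[of ?q ?r "zero N Z"] by simp
      show "pair C (?r \<Zsemi> zero N Z) (?q \<Zsemi> zero K Z) \<Zsemi> prj1 C (cobj N) (cobj K) =
        ?r \<Zsemi> ?q \<Zsemi> zero (prod_cmon N K) Z \<Zsemi> prj1 C (cobj N) (cobj K)"
        unfolding conjunct2[OF conjunct2[OF pz]] p(3)
        using rq s t Zo by (simp add: assoc)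
    qed
    moreover have "Rst C (x \<Zsemi> pair C (f 0) (g 0)) = ?r \<Zsemi> ?q"
      using s t x' by (subst Comp_pair) auto
    ultimately show "tp (a(i := e \<Zsemi> zero M Z)) n x \<Zsemi> pair C (f n) (g n) =
        Rst C (x \<Zsemi> pair C (f 0) (g 0)) \<Zsemi> zero (prod_cmon N K) Z"
      unfolding conjunct1[OF Zt] fz gz by simp
  next
    fix p assume p: "p permutes {..<n}"
    have ap: "a \<circ> p \<in> {..<n} \<rightarrow> mpt Z e M"
      by (rule Pi_I) (use funcset_mem[OF a] permutes_in_image[OF p] in auto)
    have "?u (a \<circ> p) = ?u a" using f n x a p unfolding faa_map_def by blast
    moreover have "?v (a \<circ> p) = ?v a" using g n x a p unfolding faa_map_def by blast
    ultimately show "tp (a \<circ> p) n x \<Zsemi> pair C (f n) (g n) = tp a n x \<Zsemi> pair C (f n) (g n)"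
      using tpp[OF a] tpp[OF ap] by simp
  }
qed

subsection \<open>The Faa di Bruno category\<close>

abbreviation fm :: "('o, 'm) faa_obj \<Rightarrow> ('o, 'm) faa_obj \<Rightarrow> (nat \<Rightarrow> 'm) \<Rightarrow> bool" where
  "fm P Q \<equiv> faa_map (fst P) (snd P) (fst Q) (snd Q)"

definition faa_prod :: "('o, 'm) faa_obj \<Rightarrow> ('o, 'm) faa_obj \<Rightarrow> ('o, 'm) faa_obj" where
  "faa_prod P Q = (prod_cmon (fst P) (fst Q), Prod C (snd P) (snd Q))"

definition faa_prj0 :: "('o, 'm) faa_obj \<Rightarrow> ('o, 'm) faa_obj \<Rightarrow> nat \<Rightarrow> 'm" where
  "faa_prj0 P Q = lin (fst (faa_prod P Q)) (snd (faa_prod P Q)) (fst P)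
     (prj0 C (snd P) (snd Q)) (prj0 C (cobj (fst P)) (cobj (fst Q)))"

definition faa_prj1 :: "('o, 'm) faa_obj \<Rightarrow> ('o, 'm) faa_obj \<Rightarrow> nat \<Rightarrow> 'm" where
  "faa_prj1 P Q = lin (fst (faa_prod P Q)) (snd (faa_prod P Q)) (fst Q)
     (prj1 C (snd P) (snd Q)) (prj1 C (cobj (fst P)) (cobj (fst Q)))"

text \<open>\<open>faa_comp\<close> needs the source for the powers and the target monoid for the
  sums; both are read off the two arrows being composed.\<close>

definition faa_cat :: "(('o, 'm) faa_obj, ('o, 'm) faa_arr) crcat" where
  "faa_cat =
     \<lparr>Obj = faa_Obj C,
      Arr = {(P, f, Q). fm P Q f},
      Dom = fst,
      Cod = (\<lambda>u. snd (snd u)),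
      Id = (\<lambda>P. (P, faa_id C P, P)),
      Comp = (\<lambda>u v. (fst u, faa_comp C (fst u) (snd (snd v)) (fst (snd u)) (fst (snd v)), snd (snd v))),
      Rst = (\<lambda>u. (fst u, faa_rst C (fst u) (fst (snd u)), fst u)),
      One = (one_cmon, One C),
      Prod = faa_prod,
      prj0 = (\<lambda>P Q. (faa_prod P Q, faa_prj0 P Q, P)),
      prj1 = (\<lambda>P Q. (faa_prod P Q, faa_prj1 P Q, Q))\<rparr>"

lemma faa_cat_simps [simp]:
  "Obj faa_cat = faa_Obj C"
  "(P, f, Q) \<in> Arr faa_cat \<longleftrightarrow> fm P Q f"
  "Dom faa_cat u = fst u" "Cod faa_cat u = snd (snd u)"
  "Id faa_cat P = (P, faa_id C P, P)"
  "Comp faa_cat (P, f, Q) (Q', g, R) = (P, faa_comp C P R f g, R)"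
  "Rst faa_cat (P, f, Q) = (P, faa_rst C P f, P)"
  "One faa_cat = (one_cmon, One C)" "Prod faa_cat = faa_prod"
  "prj0 faa_cat P Q = (faa_prod P Q, faa_prj0 P Q, P)"
  "prj1 faa_cat P Q = (faa_prod P Q, faa_prj1 P Q, Q)"
  by (simp_all add: faa_cat_def)

lemma Hom_faa_cat: "Hom faa_cat P Q = {(P, f, Q) | f. fm P Q f}"
  by (auto simp: Hom_def)

lemma Arr_faa_catE:
  assumes "u \<in> Arr faa_cat"
  obtains P f Q where "u = (P, f, Q)" "fm P Q f"
  using assms by (cases u) auto

lemma faa_Obj_iff: "P \<in> faa_Obj C \<longleftrightarrow> tcm (fst P) \<and> snd P \<in> Obj C"
  by (cases P) (simp add: faa_Obj_def)

lemma fm_Obj: "fm P Q f \<Longrightarrow> P \<in> faa_Obj C" "fm P Q f \<Longrightarrow> Q \<in> faa_Obj C"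
  using faa_map_simps by (auto simp: faa_Obj_iff)

lemma
  assumes "fm P Q f"
  shows fm_rst: "fm P P (faa_rst C P f)"
    and fm_R1: "faa_comp C P Q (faa_rst C P f) f = f"
    and fm_total: "faa_rst C P f = faa_id C P \<longleftrightarrow> total C (f 0)"
    and fm_comp: "fm Q R g \<Longrightarrow> fm P R (faa_comp C P R f g)"
    and fm_rst_comp: "fm P R k \<Longrightarrow> faa_comp C P R (faa_rst C P f) k n = Rst C (f n) \<Zsemi> k n"
proof -
  show "fm P P (faa_rst C P f)" "faa_comp C P Q (faa_rst C P f) f = f"
    "faa_rst C P f = faa_id C P \<longleftrightarrow> total C (f 0)"
    using faa_map_rst[OF assms] faa_R1[OF assms] faa_rst_eq_id_iff[OF assms] by simp_all
  show "fm P R (faa_comp C P R f g)" if "fm Q R g"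
    using faa_map_comp[OF assms that] by simp
  show "faa_comp C P R (faa_rst C P f) k n = Rst C (f n) \<Zsemi> k n" if "fm P R k"
    using rst_comp_component[OF assms that] by simp
qed

lemma total_faa_cat: "fm P Q f \<Longrightarrow> total faa_cat (P, f, Q) \<longleftrightarrow> total C (f 0)"
  by (simp add: total_def fm_total[unfolded total_def])

lemma restriction_category_faa_cat: "restriction_category faa_cat"
proof
  fix u assume "u \<in> Arr faa_cat"
  then obtain P f Q where u: "u = (P, f, Q)" "fm P Q f" by (rule Arr_faa_catE)
  show "Dom faa_cat u \<in> Obj faa_cat" "Cod faa_cat u \<in> Obj faa_cat"
    using u fm_Obj by auto
  show "Comp faa_cat (Rst faa_cat u) u = u"
    using u fm_R1 by simp
next
  fix P assume "P \<in> Obj faa_cat"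
  then show "Id faa_cat P \<in> Hom faa_cat P P"
    using faa_map_id[of "fst P" "snd P"] by (simp add: Hom_faa_cat faa_Obj_iff)
qed (auto simp: Hom_faa_cat faa_id_left faa_id_right faa_comp_assoc faa_R3
    intro: faa_map_rst faa_map_comp faa_R2 faa_R4)

section \<open>Terminal object and products of the new category\<close>

lemma fm_to_One:
  assumes "fm P (one_cmon, One C) f"
  shows "f n \<in> Hom C (npow C (cobj (fst P)) (snd P) n) (One C)"
  using faa_map_Arr[OF assms, of n] by (auto simp: Hom_def)

text \<open>All components end in the terminal object, so they are determined by their restrictions,
  and these are determined by the restriction in position 0.\<close>

lemma fm_to_One_eqI:
  assumes "fm P (one_cmon, One C) f" "fm P (one_cmon, One C) g" "Rst C (f 0) = Rst C (g 0)"
  shows "f = g"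
proof
  fix n
  have R: "Rst C (h n) = Rst C (proj C (cobj (fst P)) (snd P) n n \<Zsemi> Rst C (h 0))"
    if "fm P (one_cmon, One C) h" for h
    using faa_map_Rst_eq[OF that, of n] faa_map_simps[OF that] by (simp add: Rst_Comp_Rst)
  show "f n = g n"
    using R[OF assms(1)] R[OF assms(2)] assms(3)
    by (intro to_One_eqI[OF fm_to_One[OF assms(1)] fm_to_One[OF assms(2)]]) simp
qed

lemma fm_bang:
  assumes "P \<in> faa_Obj C"
  shows "fm P (one_cmon, One C) (lin (fst P) (snd P) one_cmon (bang C (snd P)) (bang C (cobj (fst P))))"
  using assms by (auto simp: faa_Obj_iff Hom_def intro!: faa_map_lin mhom_bang)

lemma
  assumes "P \<in> faa_Obj C" "Q \<in> faa_Obj C"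
  shows faa_prod_Obj: "faa_prod P Q \<in> faa_Obj C"
    and fm_prj0: "fm (faa_prod P Q) P (faa_prj0 P Q)"
    and fm_prj1: "fm (faa_prod P Q) Q (faa_prj1 P Q)"
    and total_faa_prj: "total C (faa_prj0 P Q 0)" "total C (faa_prj1 P Q 0)"
proof -
  have PQ: "tcm (fst P)" "tcm (fst Q)" "snd P \<in> Obj C" "snd Q \<in> Obj C"
    using assms by (auto simp: faa_Obj_iff)
  show "faa_prod P Q \<in> faa_Obj C" using PQ tcm_prod by (auto simp: faa_Obj_iff faa_prod_def)
  have H: "prj0 C (snd P) (snd Q) \<in> Hom C (Prod C (snd P) (snd Q)) (snd P)"
    "prj1 C (snd P) (snd Q) \<in> Hom C (Prod C (snd P) (snd Q)) (snd Q)"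
    using PQ by (auto simp: Hom_def)
  show "fm (faa_prod P Q) P (faa_prj0 P Q)" "fm (faa_prod P Q) Q (faa_prj1 P Q)"
    unfolding faa_prj0_def faa_prj1_def faa_prod_def fst_conv snd_conv
    using faa_map_lin[OF H(1) mhom_prj(1)[OF PQ(1,2)]] faa_map_lin[OF H(2) mhom_prj(2)[OF PQ(1,2)]] .
  show "total C (faa_prj0 P Q 0)" "total C (faa_prj1 P Q 0)"
    using PQ prj_total by (simp_all add: faa_prj0_def faa_prj1_def lin_0)
qed

lemma fm_comp_prj:
  assumes h: "fm R (faa_prod P Q) h" and P: "P \<in> faa_Obj C" and Q: "Q \<in> faa_Obj C"
  shows "faa_comp C R P h (faa_prj0 P Q) n =
      h n \<Zsemi> prj0 C (if n = 0 then snd P else cobj (fst P)) (if n = 0 then snd Q else cobj (fst Q))"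
    and "faa_comp C R Q h (faa_prj1 P Q) n =
      h n \<Zsemi> prj1 C (if n = 0 then snd P else cobj (fst P)) (if n = 0 then snd Q else cobj (fst Q))"
proof -
  have PQ: "tcm (fst P)" "tcm (fst Q)" "snd P \<in> Obj C" "snd Q \<in> Obj C"
    using assms by (auto simp: faa_Obj_iff)
  have H: "prj0 C (snd P) (snd Q) \<in> Hom C (Prod C (snd P) (snd Q)) (snd P)"
    "prj1 C (snd P) (snd Q) \<in> Hom C (Prod C (snd P) (snd Q)) (snd Q)"
    using PQ by (auto simp: Hom_def)
  have h': "faa_map (fst R) (snd R) (prod_cmon (fst P) (fst Q)) (Prod C (snd P) (snd Q)) h"
    using h by (simp add: faa_prod_def)
  show "faa_comp C R P h (faa_prj0 P Q) n =
      h n \<Zsemi> prj0 C (if n = 0 then snd P else cobj (fst P)) (if n = 0 then snd Q else cobj (fst Q))"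
    using comp_lin_total_component[OF h' H(1) prj_total(1)[OF PQ(3,4)] mhom_prj(1)[OF PQ(1,2)]]
    by (simp add: faa_prj0_def faa_prod_def)
  show "faa_comp C R Q h (faa_prj1 P Q) n =
      h n \<Zsemi> prj1 C (if n = 0 then snd P else cobj (fst P)) (if n = 0 then snd Q else cobj (fst Q))"
    using comp_lin_total_component[OF h' H(2) prj_total(2)[OF PQ(3,4)] mhom_prj(2)[OF PQ(1,2)]]
    by (simp add: faa_prj1_def faa_prod_def)
qed

text \<open>Composing with a projection and composing with a restriction both act componentwise. The
  two equations therefore say that each \<open>h n\<close> solves the pairing problem for
  \<open>f n\<close> and \<open>g n\<close> in the base category, where the solution is
  unique.\<close>

lemma fm_pairing_iff:
  assumes f: "fm R P f" and g: "fm R Q g" and h: "fm R (faa_prod P Q) h"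
  shows "faa_comp C R P h (faa_prj0 P Q) = faa_comp C R P (faa_rst C R g) f \<and>
      faa_comp C R Q h (faa_prj1 P Q) = faa_comp C R Q (faa_rst C R f) g \<longleftrightarrow>
    h = (\<lambda>n. pair C (f n) (g n))"
proof -
  note O = fm_Obj(2)[OF f] fm_Obj(2)[OF g]
  have PQ: "tcm (fst P)" "tcm (fst Q)" "snd P \<in> Obj C" "snd Q \<in> Obj C"
    using O by (auto simp: faa_Obj_iff)
  have "h n \<Zsemi> prj0 C (if n = 0 then snd P else cobj (fst P)) (if n = 0 then snd Q else cobj (fst Q)) = Rst C (g n) \<Zsemi> f n \<and>
      h n \<Zsemi> prj1 C (if n = 0 then snd P else cobj (fst P)) (if n = 0 then snd Q else cobj (fst Q)) = Rst C (f n) \<Zsemi> g n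
      \<longleftrightarrow> h n = pair C (f n) (g n)" (is "?L \<longleftrightarrow> ?R") for n
  proof -
    note F = faa_map_Arr[OF f, of n] and G = faa_map_Arr[OF g, of n] and H = faa_map_Arr[OF h, of n]
    have D: "Dom C (f n) = Dom C (g n)" using F G by simp
    have Hh: "h n \<in> Hom C (Dom C (f n)) (Prod C (Cod C (f n)) (Cod C (g n)))"
      using F G H cobj_prod[OF PQ(1,2)] by (auto simp: Hom_def faa_prod_def)
    then have "?L \<longleftrightarrow> is_pairing C (f n) (g n) (h n)"
      using F G by (simp add: is_pairing_def)
    also have "\<dots> \<longleftrightarrow> ?R"
      by (rule iffI) (erule pair_unique[OF F(1) G(1) D], erule ssubst, rule pair_is_pairing[OF F(1) G(1) D])
    finally show ?thesis .
  qed
  then show ?thesis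
    unfolding fun_eq_iff fm_comp_prj[OF h O] fm_rst_comp[OF g f] fm_rst_comp[OF f g] by blast
qed

lemma cartesian_restriction_category_faa_cat: "cartesian_restriction_category faa_cat"
proof -
  interpret F: restriction_category faa_cat by (rule restriction_category_faa_cat)
  have bang1: "\<exists>!t. t \<in> Hom faa_cat P (One faa_cat) \<and> total faa_cat t" if P: "P \<in> faa_Obj C" for P
  proof (rule ex1I)
    let ?b = "lin (fst P) (snd P) one_cmon (bang C (snd P)) (bang C (cobj (fst P)))"
    note b = fm_bang[OF P]
    have b0: "total C (?b 0)" using P by (simp add: lin_0 faa_Obj_iff total_def)
    then show "(P, ?b, (one_cmon, One C)) \<in> Hom faa_cat P (One faa_cat) \<and> total faa_cat (P, ?b, (one_cmon, One C))"
      using b total_faa_cat[OF b] by (simp add: Hom_faa_cat)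
    fix t assume t: "t \<in> Hom faa_cat P (One faa_cat) \<and> total faa_cat t"
    then obtain f where f: "t = (P, f, (one_cmon, One C))" "fm P (one_cmon, One C) f"
      by (auto simp: Hom_faa_cat)
    then have f0: "total C (f 0)" using t total_faa_cat by blast
    have "f = ?b"
      by (rule fm_to_One_eqI[OF f(2) b])
        (use f0 b0 faa_map_Arr[OF f(2), of 0] faa_map_Arr[OF b, of 0] in \<open>simp add: total_def\<close>)
    then show "t = (P, ?b, (one_cmon, One C))" using f by simp
  qed
  show ?thesis
  proof
    show "One faa_cat \<in> Obj faa_cat" using tcm_one One_Obj by (simp add: faa_Obj_iff)
  next
    fix P assume "P \<in> Obj faa_cat"
    then show "\<exists>!t. t \<in> Hom faa_cat P (One faa_cat) \<and> total faa_cat t" using bang1 by simp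
  next
    fix u P assume "u \<in> Hom faa_cat P (One faa_cat)"
    then obtain f where u: "u = (P, f, (one_cmon, One C))" and f: "fm P (one_cmon, One C) f"
      by (auto simp: Hom_faa_cat)
    have P: "P \<in> faa_Obj C" by (rule fm_Obj(1)[OF f])
    have bang: "bang faa_cat P \<in> Hom faa_cat P (One faa_cat) \<and> total faa_cat (bang faa_cat P)"
      unfolding bang_def by (rule theI'[OF bang1[OF P]])
    then obtain b where b': "bang faa_cat P = (P, b, (one_cmon, One C))" "fm P (one_cmon, One C) b"
      unfolding Hom_faa_cat faa_cat_simps by blast
    then have b: "bang faa_cat P = (P, b, (one_cmon, One C))" "fm P (one_cmon, One C) b" "total C (b 0)"
      using bang total_faa_cat[OF b'(2)] by simp_all
    have "faa_comp C P (one_cmon, One C) (faa_rst C P f) b = f"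
    proof (rule fm_to_One_eqI[OF fm_comp[OF fm_rst[OF f] b(2)] f])
      show "Rst C (faa_comp C P (one_cmon, One C) (faa_rst C P f) b 0) = Rst C (f 0)"
        unfolding fm_rst_comp[OF f b(2)]
        using faa_map_Arr[OF f, of 0] faa_map_Arr[OF b(2), of 0] b(3) by (simp add: Rst_Comp_total)
    qed
    then show "u = Comp faa_cat (Rst faa_cat u) (bang faa_cat P)" using u b by simp
  next
    fix P Q assume "P \<in> Obj faa_cat" "Q \<in> Obj faa_cat"
    then have PQ: "P \<in> faa_Obj C" "Q \<in> faa_Obj C" by auto
    show "Prod faa_cat P Q \<in> Obj faa_cat" using faa_prod_Obj[OF PQ] by simp
    show "prj0 faa_cat P Q \<in> Hom faa_cat (Prod faa_cat P Q) P \<and> total faa_cat (prj0 faa_cat P Q)"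
      using fm_prj0[OF PQ] total_faa_prj(1)[OF PQ] total_faa_cat by (simp add: Hom_faa_cat)
    show "prj1 faa_cat P Q \<in> Hom faa_cat (Prod faa_cat P Q) Q \<and> total faa_cat (prj1 faa_cat P Q)"
      using fm_prj1[OF PQ] total_faa_prj(2)[OF PQ] total_faa_cat by (simp add: Hom_faa_cat)
  next
    fix u v R P Q assume "u \<in> Hom faa_cat R P" "v \<in> Hom faa_cat R Q"
    then obtain f g where u: "u = (R, f, P)" and f: "fm R P f" and v: "v = (R, g, Q)" and g: "fm R Q g"
      by (auto simp: Hom_faa_cat)
    let ?h = "\<lambda>n. pair C (f n) (g n)"
    have h: "fm R (faa_prod P Q) ?h"
      using faa_map_pair[OF f g] by (simp add: faa_prod_def)
    have iff: "is_pairing faa_cat u v w \<longleftrightarrow> (\<exists>k. w = (R, k, faa_prod P Q) \<and> fm R (faa_prod P Q) k \<and> k = ?h)" for w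
    proof -
      have "is_pairing faa_cat u v w \<longleftrightarrow> (\<exists>k. w = (R, k, faa_prod P Q) \<and> fm R (faa_prod P Q) k \<and>
          faa_comp C R P k (faa_prj0 P Q) = faa_comp C R P (faa_rst C R g) f \<and>
          faa_comp C R Q k (faa_prj1 P Q) = faa_comp C R Q (faa_rst C R f) g)"
        by (auto simp: is_pairing_def Hom_faa_cat u v)
      also have "\<dots> \<longleftrightarrow> (\<exists>k. w = (R, k, faa_prod P Q) \<and> fm R (faa_prod P Q) k \<and> k = ?h)"
        using fm_pairing_iff[OF f g] by blast
      finally show ?thesis .
    qed
    show "\<exists>!w. is_pairing faa_cat u v w"
      unfolding iff using h by auto
  qed
qed

lemma fm_iff_faa_Hom:
  "\<lbrakk>P \<in> faa_Obj C; Q \<in> faa_Obj C\<rbrakk> \<Longrightarrow> f \<in> faa_Hom C P Q \<longleftrightarrow> fm P Q f"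
  using faa_Hom_iff[of "fst P" "fst Q" f "snd P" "snd Q"] by (simp add: faa_Obj_iff)

end

theorem theorem3p7:
  fixes C :: "('o, 'm, 'z) crcat_scheme"
  assumes "cartesian_restriction_category C"
  shows "\<exists>F :: (('o, 'm) faa_obj, ('o, 'm) faa_arr) crcat.
    cartesian_restriction_category F \<and>
    Obj F = faa_Obj C \<and>
    (\<forall>P\<in>faa_Obj C. \<forall>Q\<in>faa_Obj C. Hom F P Q = {(P, f, Q) | f. f \<in> faa_Hom C P Q}) \<and>
    (\<forall>P\<in>faa_Obj C. Id F P = (P, faa_id C P, P)) \<and>
    (\<forall>P\<in>faa_Obj C. \<forall>Q\<in>faa_Obj C. \<forall>R\<in>faa_Obj C. \<forall>f\<in>faa_Hom C P Q. \<forall>g\<in>faa_Hom C Q R.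
       Comp F (P, f, Q) (Q, g, R) = (P, faa_comp C P R f g, R)) \<and>
    (\<forall>P\<in>faa_Obj C. \<forall>Q\<in>faa_Obj C. \<forall>f\<in>faa_Hom C P Q.
       Rst F (P, f, Q) = (P, faa_rst C P f, P))"
proof -
  interpret cartesian_restriction_category C by (rule assms)
  show ?thesis
    using cartesian_restriction_category_faa_cat
    by (intro exI[of _ faa_cat]) (simp add: Hom_faa_cat fm_iff_faa_Hom)
qed

end
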